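(* Let $G$ be a Garside group with simple divisors $\mathcal{D}$. The complex $\widehat{\mathcal{X}}_{\mathcal{D}}$ is a contractible $G$-complex, and the quotient $G\backslash\widehat{\mathcal{X}}_{\mathcal{D}}$ is a finite $K(G,1)$.
   Context: An element $m\neq 1$ of a monoid $M$ is indivisible if $m=ab$ implies $a=1$ or $b=1$. For $m\in M$, $\|m\|$ is the supremum of the lengths of all expressions of $m$ as a product of indivisible elements. $M$ is atomic if it is generated by its indivisible elements and $\|m\|<\infty$ for all $m$. A Garside monoid is an atomic monoid $M$ such that: (1) left and right cancellation laws hold; (2) any two elements admit a least common multiple and a greatest common divisor on both the left and the right; (3) there is an element $\Delta\in M$ (Garside element) whose set of left divisors equals its set of right divisors, this set $\mathcal{D}$ (the simple divisors) is finite, and it generates $M$. A Garside monoid $G^+$ embeds in its group of fractions $G$, called a Garside group. A flag complex is a simplicial complex in which every complete subgraph on $n$ vertices of the $1$-skeleton is the $1$-skeleton of an $(n-1)$-simplex. Let $\mathcal{C}_{\mathcal{D}}$ be the Cayley graph of $G$ with respect to $\mathcal{D}$: vertices are the elements of $G$, and there is an edge from $g$ to $g\mu$ for $g\in G$, $\mu\in\mathcal{D}\setminus\{1\}$. $\widehat{\mathcal{X}}_{\mathcal{D}}$ is the flag complex with $1$-skeleton $\mathcal{C}_{\mathcal{D}}$. $G$ acts on $\mathcal{C}_{\mathcal{D}}$, hence on $\widehat{\mathcal{X}}_{\mathcal{D}}$, by left multiplication. *)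

theory Defs
  imports "HOL-Analysis.Analysis" "HOL-Algebra.Group_Action"
begin

section \<open>Garside monoids and Garside groups\<close>

definition monoid_prod :: "('a, 'b) monoid_scheme \<Rightarrow> 'a list \<Rightarrow> 'a"
  where "monoid_prod M xs = foldr (\<lambda>x y. x \<otimes>\<^bsub>M\<^esub> y) xs \<one>\<^bsub>M\<^esub>"

definition monoid_generates :: "('a, 'b) monoid_scheme \<Rightarrow> 'a set \<Rightarrow> bool"
  where "monoid_generates M S \<longleftrightarrow>
    S \<subseteq> carrier M \<and> (\<forall>m\<in>carrier M. \<exists>xs. set xs \<subseteq> S \<and> monoid_prod M xs = m)"

definition indivisibles :: "('a, 'b) monoid_scheme \<Rightarrow> 'a set"
  where "indivisibles M =
    {m \<in> carrier M. m \<noteq> \<one>\<^bsub>M\<^esub> \<and>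
       (\<forall>a\<in>carrier M. \<forall>b\<in>carrier M. m = a \<otimes>\<^bsub>M\<^esub> b \<longrightarrow> a = \<one>\<^bsub>M\<^esub> \<or> b = \<one>\<^bsub>M\<^esub>)}"

definition monoid_norm :: "('a, 'b) monoid_scheme \<Rightarrow> 'a \<Rightarrow> enat"
  where "monoid_norm M m =
    (SUP xs \<in> {xs. set xs \<subseteq> indivisibles M \<and> monoid_prod M xs = m}. enat (length xs))"

definition left_divides :: "('a, 'b) monoid_scheme \<Rightarrow> 'a \<Rightarrow> 'a \<Rightarrow> bool"
  where "left_divides M a b \<longleftrightarrow> (\<exists>c\<in>carrier M. b = a \<otimes>\<^bsub>M\<^esub> c)"

definition right_divides :: "('a, 'b) monoid_scheme \<Rightarrow> 'a \<Rightarrow> 'a \<Rightarrow> bool"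
  where "right_divides M a b \<longleftrightarrow> (\<exists>c\<in>carrier M. b = c \<otimes>\<^bsub>M\<^esub> a)"

text \<open>The next two predicates are used with either of the two divisibility relations of \<open>M\<close>.\<close>

definition is_lcm ::
    "('a, 'b) monoid_scheme \<Rightarrow> ('a \<Rightarrow> 'a \<Rightarrow> bool) \<Rightarrow> 'a \<Rightarrow> 'a \<Rightarrow> 'a \<Rightarrow> bool"
  where "is_lcm M divs a b m \<longleftrightarrow>
    m \<in> carrier M \<and> divs a m \<and> divs b m \<and>
    (\<forall>n\<in>carrier M. divs a n \<and> divs b n \<longrightarrow> divs m n)"

definition is_gcd ::
    "('a, 'b) monoid_scheme \<Rightarrow> ('a \<Rightarrow> 'a \<Rightarrow> bool) \<Rightarrow> 'a \<Rightarrow> 'a \<Rightarrow> 'a \<Rightarrow> bool"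
  where "is_gcd M divs a b d \<longleftrightarrow>
    d \<in> carrier M \<and> divs d a \<and> divs d b \<and>
    (\<forall>n\<in>carrier M. divs n a \<and> divs n b \<longrightarrow> divs n d)"

definition left_divisors :: "('a, 'b) monoid_scheme \<Rightarrow> 'a \<Rightarrow> 'a set"
  where "left_divisors M m = {a \<in> carrier M. left_divides M a m}"

definition right_divisors :: "('a, 'b) monoid_scheme \<Rightarrow> 'a \<Rightarrow> 'a set"
  where "right_divisors M m = {a \<in> carrier M. right_divides M a m}"

locale atomic_monoid = monoid M for M (structure) +
  assumes generated_by_indivisibles: "monoid_generates M (indivisibles M)"
    and finite_norm: "m \<in> carrier M \<Longrightarrow> monoid_norm M m < \<infinity>"

locale garside_monoid = atomic_monoid M for M (structure) and \<Delta> +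
  assumes left_cancel:
      "\<lbrakk>a \<in> carrier M; b \<in> carrier M; c \<in> carrier M; c \<otimes> a = c \<otimes> b\<rbrakk> \<Longrightarrow> a = b"
    and right_cancel:
      "\<lbrakk>a \<in> carrier M; b \<in> carrier M; c \<in> carrier M; a \<otimes> c = b \<otimes> c\<rbrakk> \<Longrightarrow> a = b"
    and lcm_left:
      "\<lbrakk>a \<in> carrier M; b \<in> carrier M\<rbrakk> \<Longrightarrow> \<exists>m. is_lcm M (left_divides M) a b m"
    and lcm_right:
      "\<lbrakk>a \<in> carrier M; b \<in> carrier M\<rbrakk> \<Longrightarrow> \<exists>m. is_lcm M (right_divides M) a b m"
    and gcd_left:
      "\<lbrakk>a \<in> carrier M; b \<in> carrier M\<rbrakk> \<Longrightarrow> \<exists>d. is_gcd M (left_divides M) a b d"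
    and gcd_right:
      "\<lbrakk>a \<in> carrier M; b \<in> carrier M\<rbrakk> \<Longrightarrow> \<exists>d. is_gcd M (right_divides M) a b d"
    and garside_element: "\<Delta> \<in> carrier M"
    and divisors_eq: "left_divisors M \<Delta> = right_divisors M \<Delta>"
    and finite_divisors: "finite (left_divisors M \<Delta>)"
    and divisors_generate: "monoid_generates M (left_divisors M \<Delta>)"

text \<open>The Garside monoid is identified with its image \<open>P\<close> in its group of fractions \<open>G\<close>.\<close>

locale garside_group = group G + submonoid P G for G (structure) and P and \<Delta> +
  assumes garside: "garside_monoid (G\<lparr>carrier := P\<rparr>) \<Delta>"
    and fractions: "carrier G = {a \<otimes> inv b | a b. a \<in> P \<and> b \<in> P}"

definition simple_divisors :: "('a, 'b) monoid_scheme \<Rightarrow> 'a set \<Rightarrow> 'a \<Rightarrow> 'a set"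
  where "simple_divisors G P \<Delta> = left_divisors (G\<lparr>carrier := P\<rparr>) \<Delta>"


section \<open>Flag complexes\<close>

text \<open>Abstract simplicial complexes are given by their nonempty simplices; the vertices are the
  points \<open>v\<close> with \<open>{v} \<in> K\<close>. A (simple, undirected) graph is a vertex set \<open>V\<close> with a set \<open>E\<close> of
  two-element subsets of \<open>V\<close>.\<close>

definition abstract_simplicial_complex :: "'v set set \<Rightarrow> bool"
  where "abstract_simplicial_complex K \<longleftrightarrow>
    (\<forall>s\<in>K. finite s \<and> s \<noteq> {}) \<and> (\<forall>s\<in>K. \<forall>t. t \<subseteq> s \<and> t \<noteq> {} \<longrightarrow> t \<in> K)"

definition has_one_skeleton :: "'v set set \<Rightarrow> 'v set \<Rightarrow> 'v set set \<Rightarrow> bool"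
  where "has_one_skeleton K V E \<longleftrightarrow> V = {v. {v} \<in> K} \<and> E = {e \<in> K. card e = 2}"

definition complete_on :: "'v set set \<Rightarrow> 'v set \<Rightarrow> bool"
  where "complete_on E s \<longleftrightarrow> (\<forall>u\<in>s. \<forall>v\<in>s. u \<noteq> v \<longrightarrow> {u, v} \<in> E)"

definition is_flag_complex :: "'v set set \<Rightarrow> bool"
  where "is_flag_complex K \<longleftrightarrow>
    abstract_simplicial_complex K \<and>
    (\<forall>s. finite s \<and> s \<noteq> {} \<and> (\<forall>v\<in>s. {v} \<in> K) \<and> complete_on {e \<in> K. card e = 2} s \<longrightarrow> s \<in> K)"

definition flag_complex :: "'v set \<Rightarrow> 'v set set \<Rightarrow> 'v set set"
  where "flag_complex V E = {s. finite s \<and> s \<noteq> {} \<and> s \<subseteq> V \<and> complete_on E s}"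

lemma is_flag_complex_iff:
  assumes "\<And>e. e \<in> E \<Longrightarrow> e \<subseteq> V \<and> card e = 2"
  shows "is_flag_complex K \<and> has_one_skeleton K V E \<longleftrightarrow> K = flag_complex V E"
proof
  assume K: "is_flag_complex K \<and> has_one_skeleton K V E"
  show "K = flag_complex V E"
  proof (intro Set.set_eqI iffI)
    fix s assume s: "s \<in> K"
    have sub: "t \<in> K" if "t \<subseteq> s" "t \<noteq> {}" for t
      using K s that unfolding is_flag_complex_def abstract_simplicial_complex_def by blast
    have "finite s" "s \<noteq> {}"
      using K s unfolding is_flag_complex_def abstract_simplicial_complex_def by blast+
    moreover have "s \<subseteq> V"
      using K sub unfolding has_one_skeleton_def by auto
    moreover have "complete_on E s"
      using K sub unfolding has_one_skeleton_def complete_on_def by auto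
    ultimately show "s \<in> flag_complex V E"
      by (simp add: flag_complex_def)
  next
    fix s assume "s \<in> flag_complex V E"
    then have s: "finite s" "s \<noteq> {}" "s \<subseteq> V" "complete_on E s"
      by (auto simp: flag_complex_def)
    have V: "V = {v. {v} \<in> K}" and E: "E = {e \<in> K. card e = 2}"
      using K by (auto simp: has_one_skeleton_def)
    have "\<forall>v\<in>s. {v} \<in> K"
      using s(3) V by blast
    then show "s \<in> K"
      using K s(1,2) s(4)[unfolded E] unfolding is_flag_complex_def by blast
  qed
next
  assume K: "K = flag_complex V E"
  have V: "V = {v. {v} \<in> K}"
    by (auto simp: K flag_complex_def complete_on_def)
  have E: "E = {e \<in> K. card e = 2}"
  proof (intro Set.set_eqI iffI)
    fix e assume "e \<in> E"
    moreover from this obtain u v where "e = {u, v}" "u \<noteq> v"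
      using assms by (meson card_2_iff)
    ultimately show "e \<in> {e \<in> K. card e = 2}"
      using assms[of e] by (auto simp: K flag_complex_def complete_on_def insert_commute)
  next
    fix e assume e: "e \<in> {e \<in> K. card e = 2}"
    then obtain u v where "e = {u, v}" "u \<noteq> v"
      by (auto simp: card_2_iff)
    with e show "e \<in> E"
      by (auto simp: K flag_complex_def complete_on_def)
  qed
  have "abstract_simplicial_complex K"
    unfolding abstract_simplicial_complex_def
  proof (intro conjI ballI allI impI)
    fix s assume s: "s \<in> K"
    then show "finite s" "s \<noteq> {}"
      by (auto simp: K flag_complex_def)
    fix t assume t: "t \<subseteq> s \<and> t \<noteq> {}"
    then have "finite t"
      using \<open>finite s\<close> finite_subset by blast
    with s t show "t \<in> K"
      unfolding K flag_complex_def complete_on_def by blast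
  qed
  moreover have "s \<in> K" if "finite s" "s \<noteq> {}" "\<forall>v\<in>s. {v} \<in> K" "complete_on E s" for s
  proof -
    have "s \<subseteq> V"
      by (subst V) (use that(3) in blast)
    then show ?thesis
      using that by (simp add: K flag_complex_def)
  qed
  ultimately show "is_flag_complex K \<and> has_one_skeleton K V E"
    unfolding is_flag_complex_def has_one_skeleton_def
    by (simp only: V[symmetric] E[symmetric]) blast
qed

definition cayley_edges :: "('a, 'b) monoid_scheme \<Rightarrow> 'a set \<Rightarrow> 'a set set"
  where "cayley_edges G S = {{g, g \<otimes>\<^bsub>G\<^esub> \<mu>} | g \<mu>. g \<in> carrier G \<and> \<mu> \<in> S - {\<one>\<^bsub>G\<^esub>}}"

definition cayley_flag_complex :: "('a, 'b) monoid_scheme \<Rightarrow> 'a set \<Rightarrow> 'a set set"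
  where "cayley_flag_complex G S = flag_complex (carrier G) (cayley_edges G S)"


section \<open>Geometric realization\<close>

text \<open>Points are systems of barycentric coordinates on the vertices, extended by \<open>0\<close> to the
  ambient type; the topology is the weak (coherent) one.\<close>

definition closed_simplex :: "'v set \<Rightarrow> ('v \<Rightarrow> real) set"
  where "closed_simplex s =
    {\<alpha>. (\<forall>v. 0 \<le> \<alpha> v) \<and> (\<forall>v. v \<notin> s \<longrightarrow> \<alpha> v = 0) \<and> (\<Sum>v\<in>s. \<alpha> v) = 1}"

definition open_simplex :: "'v set \<Rightarrow> ('v \<Rightarrow> real) set"
  where "open_simplex s = {\<alpha> \<in> closed_simplex s. \<forall>v\<in>s. 0 < \<alpha> v}"

definition realization :: "'v set set \<Rightarrow> ('v \<Rightarrow> real) topology"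
  where "realization K = topology (\<lambda>U.
    U \<subseteq> (\<Union>s\<in>K. closed_simplex s) \<and>
    (\<forall>s\<in>K. openin (top_of_set (closed_simplex s)) (U \<inter> closed_simplex s)))"

lemma openin_realization:
  "openin (realization K) U \<longleftrightarrow>
    U \<subseteq> (\<Union>s\<in>K. closed_simplex s) \<and>
    (\<forall>s\<in>K. openin (top_of_set (closed_simplex s)) (U \<inter> closed_simplex s))"
proof -
  have "istopology (\<lambda>U. U \<subseteq> (\<Union>s\<in>K. closed_simplex s) \<and>
    (\<forall>s\<in>K. openin (top_of_set (closed_simplex s)) (U \<inter> closed_simplex s)))"
    unfolding istopology_def
  proof (intro conjI allI impI)
    fix S T :: "('a \<Rightarrow> real) set"
    assume S: "S \<subseteq> (\<Union>s\<in>K. closed_simplex s) \<and>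
        (\<forall>s\<in>K. openin (top_of_set (closed_simplex s)) (S \<inter> closed_simplex s))"
      and T: "T \<subseteq> (\<Union>s\<in>K. closed_simplex s) \<and>
        (\<forall>s\<in>K. openin (top_of_set (closed_simplex s)) (T \<inter> closed_simplex s))"
    show "S \<inter> T \<subseteq> (\<Union>s\<in>K. closed_simplex s)"
      using S by blast
    have eq: "S \<inter> T \<inter> closed_simplex s = (S \<inter> closed_simplex s) \<inter> (T \<inter> closed_simplex s)" for s
      by blast
    show "\<forall>s\<in>K. openin (top_of_set (closed_simplex s)) (S \<inter> T \<inter> closed_simplex s)"
      unfolding eq using S T by blast
  next
    fix \<U> :: "('a \<Rightarrow> real) set set"
    assume U: "\<forall>S\<in>\<U>. S \<subseteq> (\<Union>s\<in>K. closed_simplex s) \<and>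
        (\<forall>s\<in>K. openin (top_of_set (closed_simplex s)) (S \<inter> closed_simplex s))"
    show "\<Union>\<U> \<subseteq> (\<Union>s\<in>K. closed_simplex s)"
      using U by blast
    have eq: "\<Union>\<U> \<inter> closed_simplex s = \<Union>((\<lambda>S. S \<inter> closed_simplex s) ` \<U>)" for s
      by blast
    show "\<forall>s\<in>K. openin (top_of_set (closed_simplex s)) (\<Union>\<U> \<inter> closed_simplex s)"
      unfolding eq using U by (intro ballI openin_Union) auto
  qed
  then show ?thesis
    by (simp add: realization_def topology_inverse')
qed

lemma topspace_realization: "topspace (realization K) = (\<Union>s\<in>K. closed_simplex s)"
proof (rule antisym)
  show "topspace (realization K) \<subseteq> (\<Union>s\<in>K. closed_simplex s)"
    using openin_realization[of K "topspace (realization K)"] by simp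
  have "(\<Union>t\<in>K. closed_simplex t) \<inter> closed_simplex s = closed_simplex s" if "s \<in> K" for s
    using that by blast
  then have "openin (realization K) (\<Union>s\<in>K. closed_simplex s)"
    by (simp add: openin_realization)
  then show "(\<Union>s\<in>K. closed_simplex s) \<subseteq> topspace (realization K)"
    by (rule openin_subset)
qed

text \<open>The affine extension of a map of vertices.\<close>

definition realization_map :: "('v \<Rightarrow> 'w) \<Rightarrow> ('v \<Rightarrow> real) \<Rightarrow> ('w \<Rightarrow> real)"
  where "realization_map f \<alpha> = (\<lambda>w. \<Sum>v | \<alpha> v \<noteq> 0 \<and> f v = w. \<alpha> v)"


section \<open>CW complexes and G-complexes\<close>

definition closed_disc :: "nat \<Rightarrow> (nat \<Rightarrow> real) topology"
  where "closed_disc n = subtopology (Euclidean_space n) {x. (\<Sum>i<n. x i ^ 2) \<le> 1}"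

definition open_disc :: "nat \<Rightarrow> (nat \<Rightarrow> real) topology"
  where "open_disc n = subtopology (Euclidean_space n) {x. (\<Sum>i<n. x i ^ 2) < 1}"

definition disc_boundary :: "nat \<Rightarrow> (nat \<Rightarrow> real) set"
  where "disc_boundary n = topspace (closed_disc n) - topspace (open_disc n)"

definition characteristic_map ::
    "'a topology \<Rightarrow> nat \<Rightarrow> 'a set \<Rightarrow> ((nat \<Rightarrow> real) \<Rightarrow> 'a) \<Rightarrow> bool"
  where "characteristic_map X n e \<Phi> \<longleftrightarrow>
    continuous_map (closed_disc n) X \<Phi> \<and> homeomorphic_map (open_disc n) (subtopology X e) \<Phi>"

text \<open>\<open>C\<close> is the set of open cells.\<close>

definition CW_complex :: "'a topology \<Rightarrow> 'a set set \<Rightarrow> bool"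
  where "CW_complex X C \<longleftrightarrow>
    Hausdorff_space X \<and>
    \<Union>C = topspace X \<and> pairwise disjnt C \<and>
    (\<exists>dim. \<forall>e\<in>C. \<exists>\<Phi>. characteristic_map X (dim e) e \<Phi> \<and>
       (\<exists>F. finite F \<and> F \<subseteq> {e'\<in>C. dim e' < dim e} \<and> \<Phi> ` disc_boundary (dim e) \<subseteq> \<Union>F)) \<and>
    (\<forall>A. A \<subseteq> topspace X \<longrightarrow>
       (closedin X A \<longleftrightarrow> (\<forall>e\<in>C. closedin X (A \<inter> Abstract_Topology.closure_of X e))))"

definition finite_CW_complex :: "'a topology \<Rightarrow> 'a set set \<Rightarrow> bool"
  where "finite_CW_complex X C \<longleftrightarrow> CW_complex X C \<and> finite C"

definition G_complex ::
    "('g, 'b) monoid_scheme \<Rightarrow> 'a topology \<Rightarrow> 'a set set \<Rightarrow> ('g \<Rightarrow> 'a \<Rightarrow> 'a) \<Rightarrow> bool"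
  where "G_complex G X C \<phi> \<longleftrightarrow>
    CW_complex X C \<and> group_action G (topspace X) \<phi> \<and>
    (\<forall>g\<in>carrier G. homeomorphic_map X X (\<phi> g) \<and> (\<forall>e\<in>C. \<phi> g ` e \<in> C))"

definition orbit_space ::
    "('g, 'b) monoid_scheme \<Rightarrow> 'a topology \<Rightarrow> ('g \<Rightarrow> 'a \<Rightarrow> 'a) \<Rightarrow> 'a set topology"
  where "orbit_space G X \<phi> = topology (\<lambda>U.
    U \<subseteq> orbits G (topspace X) \<phi> \<and> openin X {x \<in> topspace X. orbit G \<phi> x \<in> U})"

lemma quotient_map_orbit_space: "quotient_map X (orbit_space G X \<phi>) (orbit G \<phi>)"
proof -
  let ?P = "\<lambda>U. U \<subseteq> orbits G (topspace X) \<phi> \<and> openin X {x \<in> topspace X. orbit G \<phi> x \<in> U}"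
  have "istopology ?P"
    unfolding istopology_def
  proof (intro conjI allI impI)
    fix S T assume S: "?P S" and T: "?P T"
    show "S \<inter> T \<subseteq> orbits G (topspace X) \<phi>"
      using S by blast
    have "{x \<in> topspace X. orbit G \<phi> x \<in> S \<inter> T} =
        {x \<in> topspace X. orbit G \<phi> x \<in> S} \<inter> {x \<in> topspace X. orbit G \<phi> x \<in> T}"
      by blast
    then show "openin X {x \<in> topspace X. orbit G \<phi> x \<in> S \<inter> T}"
      using S T by auto
  next
    fix \<U> assume U: "\<forall>S\<in>\<U>. ?P S"
    show "\<Union>\<U> \<subseteq> orbits G (topspace X) \<phi>"
      using U by blast
    have "{x \<in> topspace X. orbit G \<phi> x \<in> \<Union>\<U>} =
        \<Union>((\<lambda>S. {x \<in> topspace X. orbit G \<phi> x \<in> S}) ` \<U>)"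
      by blast
    then show "openin X {x \<in> topspace X. orbit G \<phi> x \<in> \<Union>\<U>}"
      using U by auto
  qed
  then have op: "openin (orbit_space G X \<phi>) U \<longleftrightarrow> ?P U" for U
    by (simp add: orbit_space_def topology_inverse')
  have eq: "orbits G (topspace X) \<phi> = orbit G \<phi> ` topspace X"
    by (auto simp: orbits_def)
  have "{x \<in> topspace X. orbit G \<phi> x \<in> orbits G (topspace X) \<phi>} = topspace X"
    by (auto simp: eq)
  then have "openin (orbit_space G X \<phi>) (orbits G (topspace X) \<phi>)"
    by (simp add: op)
  moreover have "topspace (orbit_space G X \<phi>) \<subseteq> orbits G (topspace X) \<phi>"
    using op[of "topspace (orbit_space G X \<phi>)"] by simp
  ultimately have "topspace (orbit_space G X \<phi>) = orbit G \<phi> ` topspace X"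
    using openin_subset eq by blast
  then show ?thesis
    by (simp add: quotient_map_def op eq)
qed

definition orbit_cells ::
    "('g, 'b) monoid_scheme \<Rightarrow> 'a set set \<Rightarrow> ('g \<Rightarrow> 'a \<Rightarrow> 'a) \<Rightarrow> 'a set set set"
  where "orbit_cells G C \<phi> = (\<lambda>e. orbit G \<phi> ` e) ` C"


section \<open>Homotopy groups and Eilenberg-MacLane spaces\<close>

definition cube :: "nat \<Rightarrow> (nat \<Rightarrow> real) topology"
  where "cube n = subtopology (Euclidean_space n) {x. \<forall>i<n. 0 \<le> x i \<and> x i \<le> 1}"

definition cube_boundary :: "nat \<Rightarrow> (nat \<Rightarrow> real) set"
  where "cube_boundary n = {x \<in> topspace (cube n). \<exists>i<n. x i = 0 \<or> x i = 1}"

definition n_loops :: "nat \<Rightarrow> 'a topology \<Rightarrow> 'a \<Rightarrow> ((nat \<Rightarrow> real) \<Rightarrow> 'a) set"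
  where "n_loops n X x0 = {f. continuous_map (cube n) X f \<and> f ` cube_boundary n \<subseteq> {x0}}"

definition homotopic_n_loops ::
    "nat \<Rightarrow> 'a topology \<Rightarrow> 'a \<Rightarrow> ((nat \<Rightarrow> real) \<Rightarrow> 'a) \<Rightarrow> ((nat \<Rightarrow> real) \<Rightarrow> 'a) \<Rightarrow> bool"
  where "homotopic_n_loops n X x0 f g \<longleftrightarrow>
    homotopic_with (\<lambda>h. h ` cube_boundary n \<subseteq> {x0}) (cube n) X f g"

definition concat_n_loops ::
    "((nat \<Rightarrow> real) \<Rightarrow> 'a) \<Rightarrow> ((nat \<Rightarrow> real) \<Rightarrow> 'a) \<Rightarrow> (nat \<Rightarrow> real) \<Rightarrow> 'a"
  where "concat_n_loops f g =
    (\<lambda>x. if x 0 \<le> 1/2 then f (x(0 := 2 * x 0)) else g (x(0 := 2 * x 0 - 1)))"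

text \<open>Only meaningful for \<open>n \<ge> 1\<close> and \<open>x0 \<in> topspace X\<close>.\<close>

definition homotopy_group ::
    "nat \<Rightarrow> 'a topology \<Rightarrow> 'a \<Rightarrow> ((nat \<Rightarrow> real) \<Rightarrow> 'a) set monoid"
  where "homotopy_group n X x0 =
    \<lparr>carrier = {{g. homotopic_n_loops n X x0 f g} | f. f \<in> n_loops n X x0},
     monoid.mult = (\<lambda>A B. {h. \<exists>f\<in>A. \<exists>g\<in>B. homotopic_n_loops n X x0 (concat_n_loops f g) h}),
     one = {g. homotopic_n_loops n X x0 (\<lambda>x. x0) g}\<rparr>"

definition Eilenberg_MacLane_space :: "('g, 'b) monoid_scheme \<Rightarrow> nat \<Rightarrow> 'a topology \<Rightarrow> bool"
  where "Eilenberg_MacLane_space G n X \<longleftrightarrow>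
    topspace X \<noteq> {} \<and> path_connected_space X \<and>
    (\<forall>x\<in>topspace X. homotopy_group n X x \<cong> G \<and>
       (\<forall>k. k \<ge> 1 \<and> k \<noteq> n \<longrightarrow>
          carrier (homotopy_group k X x) = {\<one>\<^bsub>homotopy_group k X x\<^esub>}))"


section \<open>The complex of a Garside group\<close>

definition garside_complex :: "('g, 'b) monoid_scheme \<Rightarrow> 'g set \<Rightarrow> ('g \<Rightarrow> real) topology"
  where "garside_complex G S = realization (cayley_flag_complex G S)"

definition garside_cells :: "('g, 'b) monoid_scheme \<Rightarrow> 'g set \<Rightarrow> ('g \<Rightarrow> real) set set"
  where "garside_cells G S = open_simplex ` cayley_flag_complex G S"

definition garside_action ::
    "('g, 'b) monoid_scheme \<Rightarrow> 'g set \<Rightarrow> 'g \<Rightarrow> ('g \<Rightarrow> real) \<Rightarrow> ('g \<Rightarrow> real)"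
  where "garside_action G S g =
    restrict (realization_map (\<lambda>h. g \<otimes>\<^bsub>G\<^esub> h)) (topspace (garside_complex G S))"

end

theory Submission
  imports Defs
begin

text \<open>Write \<open>g \<le> h\<close> for \<open>inv g \<otimes> h \<in> P\<close>. Least common multiples in the Garside monoid make this
  left-invariant order a lattice order on the whole group. Conjugation by \<open>\<Delta>\<close> preserves the
  monoid, so right multiplication by \<open>\<Delta>\<close> is an automorphism of the lattice, and every element
  lies between two powers of \<open>\<Delta>\<close>. Two distinct vertices are adjacent iff \<open>u \<le> v \<le> u \<Delta>\<close> or
  \<open>v \<le> u \<le> v \<Delta>\<close>, so the simplices of the flag complex are the finite chains
  \<open>g\<^sub>0 < \<dots> < g\<^sub>k\<close> with \<open>g\<^sub>k \<le> g\<^sub>0 \<Delta>\<close>.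

  Contractibility. Clamping \<open>g\<close> to an interval \<open>[\<Delta>\<^sup>-\<^sup>a, \<Delta>\<^sup>b]\<close> of the lattice is a simplicial map. When one
  end of the interval moves by a single factor \<open>\<Delta>\<close>, the clamped chain and its successor bound a
  triangulated prism inside the complex (\<open>adj_clamp\<close>, \<open>prism_compatible_clamp\<close>), which gives a homotopy.
  For the interval \<open>[1, 1]\<close> the map is constant, and on each finite set of vertices it is
  eventually the identity. As the complex is locally finite, the infinitely many homotopies can be
  run one after the other in unit time (\<open>contractible_realization\<close>).

  The quotient. A group element that preserves a simplex fixes its least vertex and is trivial, so the
  action is free; local finiteness makes it properly discontinuous. Hence paths, loops and homotopies
  lift from the quotient. Since the total space is contractible, a lifted loop is determined up to
  homotopy by its end points, which identifies the fundamental group with \<open>G\<close>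
  (\<open>fundamental_group_orbit_space\<close>), and spheres of dimension at least two lift to null-homotopic
  ones. Every simplex has a translate whose least vertex is \<open>\<one>\<close> and whose other vertices are simple
  divisors, so the quotient has finitely many cells.\<close>


section \<open>Free properly discontinuous actions\<close>

text \<open>Comparing two points \<open>x\<close> and \<open>y\<close> in the second condition serves three purposes: with \<open>x = y\<close> it
  produces evenly covered neighbourhoods, with \<open>g = \<one>\<close> it separates points of the space, and
  with \<open>x\<close> and \<open>y\<close> in different orbits it separates points of the quotient.\<close>

locale free_discontinuous_action = group_action G "topspace X" \<phi>
  for G :: "('g, 'm) monoid_scheme" (structure) and X :: "'a topology" and \<phi> +
  assumes continuous_action: "g \<in> carrier G \<Longrightarrow> continuous_map X X (\<phi> g)"
    and properly_discontinuous: "\<lbrakk>x \<in> topspace X; y \<in> topspace X\<rbrakk> \<Longrightarrow>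
        \<exists>U V. openin X U \<and> openin X V \<and> x \<in> U \<and> y \<in> V \<and>
           (\<forall>g\<in>carrier G. \<phi> g x \<noteq> y \<longrightarrow> \<phi> g ` U \<inter> V = {})"
    and free: "\<lbrakk>g \<in> carrier G; x \<in> topspace X; \<phi> g x = x\<rbrakk> \<Longrightarrow> g = \<one>"
begin

abbreviation B where "B \<equiv> orbit_space G X \<phi>"
abbreviation q where "q \<equiv> orbit G \<phi>"

lemma group_G: "group G"
  using group_hom group_hom.axioms(1) by auto

lemma act_one: "x \<in> topspace X \<Longrightarrow> \<phi> \<one> x = x"
  by (metis id_eq_one restrict_apply')

lemma act_closed: "\<lbrakk>g \<in> carrier G; x \<in> topspace X\<rbrakk> \<Longrightarrow> \<phi> g x \<in> topspace X"
  using element_image by blast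

lemma act_inv: "\<lbrakk>g \<in> carrier G; x \<in> topspace X\<rbrakk> \<Longrightarrow> \<phi> (inv g) (\<phi> g x) = x"
  using orbit_sym_aux by blast

lemma act_cancel:
  assumes "g \<in> carrier G" "h \<in> carrier G" "x \<in> topspace X" "\<phi> g x = \<phi> h x"
  shows "g = h"
proof -
  interpret group G by (rule group_G)
  have "\<phi> (inv h \<otimes> g) x = x"
    using assms by (simp add: composition_rule act_inv)
  then have "inv h \<otimes> g = \<one>"
    using assms free by simp
  then show ?thesis
    using assms by (metis inv_equality inv_inv inv_closed)
qed

lemma homeomorphic_action:
  assumes "g \<in> carrier G" shows "homeomorphic_map X X (\<phi> g)"
proof -
  interpret group G by (rule group_G)
  have "homeomorphic_maps X X (\<phi> g) (\<phi> (inv g))"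
    unfolding homeomorphic_maps_def
    using assms continuous_action act_inv inv_inv inv_closed by metis
  then show ?thesis
    using homeomorphic_map_maps by blast
qed

lemma quotient_map_q: "quotient_map X B q"
  by (rule quotient_map_orbit_space)

lemma continuous_map_q: "continuous_map X B q"
  using quotient_map_q quotient_imp_continuous_map by blast

lemma topspace_B: "topspace B = q ` topspace X"
  using quotient_map_q by (simp add: quotient_imp_surjective_map)

lemma q_eq_iff:
  assumes "x \<in> topspace X" "y \<in> topspace X"
  shows "q x = q y \<longleftrightarrow> (\<exists>g\<in>carrier G. y = \<phi> g x)"
proof
  assume "q x = q y"
  then have "y \<in> q x"
    using orbit_refl assms by simp
  then show "\<exists>g\<in>carrier G. y = \<phi> g x"
    by (auto simp: orbit_def)
next
  assume "\<exists>g\<in>carrier G. y = \<phi> g x"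
  then have y: "y \<in> q x"
    by (auto simp: orbit_def)
  then have x: "x \<in> q y"
    using orbit_sym assms by blast
  have sub: "q z \<subseteq> topspace X" if "z \<in> topspace X" for z
    using act_closed that by (auto simp: orbit_def)
  show "q x = q y"
    using x y sub assms orbit_trans by (meson subsetD subsetI subset_antisym)
qed

lemma q_act: "\<lbrakk>g \<in> carrier G; x \<in> topspace X\<rbrakk> \<Longrightarrow> q (\<phi> g x) = q x"
  using q_eq_iff act_closed by metis

lemma saturation:
  assumes "S \<subseteq> topspace X"
  shows "{x \<in> topspace X. q x \<in> q ` S} = (\<Union>g\<in>carrier G. \<phi> g ` S)"
proof (intro Set.set_eqI iffI)
  fix x assume "x \<in> {x \<in> topspace X. q x \<in> q ` S}"
  then obtain s where "s \<in> S" "q s = q x" "x \<in> topspace X" by force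
  then show "x \<in> (\<Union>g\<in>carrier G. \<phi> g ` S)"
    using q_eq_iff[of s x] assms by blast
next
  fix x assume "x \<in> (\<Union>g\<in>carrier G. \<phi> g ` S)"
  then show "x \<in> {x \<in> topspace X. q x \<in> q ` S}"
    using assms q_act act_closed by (auto simp: image_iff subset_iff)
qed

lemma open_map_q: "open_map X B q"
  unfolding open_map_def
proof (intro allI impI)
  fix U assume U: "openin X U"
  have "openin X (\<phi> g ` U)" if "g \<in> carrier G" for g
    using homeomorphic_action[OF that] U homeomorphic_imp_open_map open_map_def by blast
  then have "openin X {x \<in> topspace X. q x \<in> q ` U}"
    using saturation[OF openin_subset[OF U]] by auto
  moreover have "q ` U \<subseteq> topspace B"
    using topspace_B openin_subset[OF U] by auto
  ultimately show "openin B (q ` U)"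
    using quotient_map_q unfolding quotient_map_def by blast
qed

lemma Hausdorff_total: "Hausdorff_space X"
  unfolding Hausdorff_space_def
proof clarify
  fix x y assume xy: "x \<in> topspace X" "y \<in> topspace X" "x \<noteq> y"
  obtain U V where UV: "openin X U" "openin X V" "x \<in> U" "y \<in> V"
      "\<forall>g\<in>carrier G. \<phi> g x \<noteq> y \<longrightarrow> \<phi> g ` U \<inter> V = {}"
    using properly_discontinuous xy by meson
  have "\<one> \<in> carrier G"
    using group_G by (simp add: group.is_monoid)
  then have "\<phi> \<one> ` U \<inter> V = {}"
    using UV xy act_one by simp
  moreover have "\<phi> \<one> ` U = U"
    using act_one openin_subset[OF UV(1)] by force
  ultimately show "\<exists>U V. openin X U \<and> openin X V \<and> x \<in> U \<and> y \<in> V \<and> disjnt U V"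
    using UV unfolding disjnt_def by metis
qed

lemma Hausdorff_orbit_space: "Hausdorff_space B"
  unfolding Hausdorff_space_def
proof clarify
  fix a b assume ab: "a \<in> topspace B" "b \<in> topspace B" "a \<noteq> b"
  then obtain x y where xy: "x \<in> topspace X" "y \<in> topspace X" "a = q x" "b = q y"
    using topspace_B by auto
  obtain U V where UV: "openin X U" "openin X V" "x \<in> U" "y \<in> V"
      "\<forall>g\<in>carrier G. \<phi> g x \<noteq> y \<longrightarrow> \<phi> g ` U \<inter> V = {}"
    using properly_discontinuous xy by meson
  have "q ` U \<inter> q ` V = {}"
  proof (rule ccontr)
    assume "q ` U \<inter> q ` V \<noteq> {}"
    then obtain u v where uv: "u \<in> U" "v \<in> V" "q u = q v" by auto
    then obtain g where g: "g \<in> carrier G" "v = \<phi> g u"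
      using q_eq_iff UV openin_subset by (meson subsetD)
    then have "\<phi> g x = y"
      using UV(5) uv by blast
    then show False
      using q_act[OF g(1) xy(1)] xy ab by simp
  qed
  then show "\<exists>U V. openin B U \<and> openin B V \<and> a \<in> U \<and> b \<in> V \<and> disjnt U V"
    using UV xy open_map_q unfolding open_map_def disjnt_def
    by (intro exI[of _ "q ` U"] exI[of _ "q ` V"]) simp
qed

text \<open>Evenly covered neighbourhoods come from comparing a point with itself.\<close>

lemma small_open:
  assumes "x \<in> topspace X"
  obtains U where "openin X U" "x \<in> U"
    "\<And>g u. \<lbrakk>g \<in> carrier G; u \<in> U; \<phi> g u \<in> U\<rbrakk> \<Longrightarrow> g = \<one>"
proof -
  obtain U V where UV: "openin X U" "openin X V" "x \<in> U" "x \<in> V"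
      "\<forall>g\<in>carrier G. \<phi> g x \<noteq> x \<longrightarrow> \<phi> g ` U \<inter> V = {}"
    using properly_discontinuous assms by meson
  show thesis
  proof
    show "openin X (U \<inter> V)" "x \<in> U \<inter> V"
      using UV by auto
    show "g = \<one>" if "g \<in> carrier G" "u \<in> U \<inter> V" "\<phi> g u \<in> U \<inter> V" for g u
      using UV(5) that free assms by blast
  qed
qed

lemma local_section:
  assumes U: "openin X U" and small: "\<And>g u. \<lbrakk>g \<in> carrier G; u \<in> U; \<phi> g u \<in> U\<rbrakk> \<Longrightarrow> g = \<one>"
  obtains \<sigma> where "continuous_map (subtopology B (q ` U)) X \<sigma>"
    "\<And>u. u \<in> U \<Longrightarrow> \<sigma> (q u) = u"
proof -
  have US: "U \<subseteq> topspace X"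
    using U openin_subset by blast
  have inj: "inj_on q U"
  proof (rule inj_onI)
    fix u v assume uv: "u \<in> U" "v \<in> U" "q u = q v"
    then obtain g where g: "g \<in> carrier G" "v = \<phi> g u"
      using q_eq_iff[of u v] US by auto
    then have "g = \<one>"
      using small uv by simp
    then show "u = v"
      using g act_one uv US by auto
  qed
  have "homeomorphic_map (subtopology X U) (subtopology B (q ` U)) q"
  proof (rule bijective_open_imp_homeomorphic_map)
    show "continuous_map (subtopology X U) (subtopology B (q ` U)) q"
      using continuous_map_q US by (auto simp: continuous_map_in_subtopology continuous_map_from_subtopology)
    show "open_map (subtopology X U) (subtopology B (q ` U)) q"
      using open_map_q U unfolding open_map_def
      by (metis image_mono openin_open_subtopology openin_subset)
    show "q ` topspace (subtopology X U) = topspace (subtopology B (q ` U))"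
      using US topspace_B by (auto simp: topspace_subtopology)
    show "inj_on q (topspace (subtopology X U))"
      using inj by (simp add: topspace_subtopology inj_on_def)
  qed
  then obtain \<sigma> where "homeomorphic_maps (subtopology X U) (subtopology B (q ` U)) q \<sigma>"
    using homeomorphic_map_maps by blast
  then have "continuous_map (subtopology B (q ` U)) X \<sigma>" "\<And>u. u \<in> U \<Longrightarrow> \<sigma> (q u) = u"
    using US by (auto simp: homeomorphic_maps_def continuous_map_in_subtopology topspace_subtopology)
  then show thesis using that by blast
qed

subsection \<open>Lifting\<close>

text \<open>The coincidence set of two lifts is open, because within a small neighbourhood no nontrivial
  group element relates two points, and it is closed because the space is Hausdorff.\<close>

lemma unique_lift:
  assumes con: "connected_space Z"
    and f: "continuous_map Z X f" and f': "continuous_map Z X f'"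
    and eq: "\<And>z. z \<in> topspace Z \<Longrightarrow> q (f z) = q (f' z)"
    and z0: "z0 \<in> topspace Z" "f z0 = f' z0"
    and z: "z \<in> topspace Z"
  shows "f z = f' z"
proof -
  let ?E = "{z \<in> topspace Z. f z = f' z}"
  have fX: "f z \<in> topspace X" "f' z \<in> topspace X" if "z \<in> topspace Z" for z
    using f f' that by (auto simp: continuous_map_def)
  have "openin Z ?E"
  proof (subst openin_subopen, intro ballI)
    fix w assume w: "w \<in> ?E"
    then obtain U where U: "openin X U" "f w \<in> U"
       "\<And>g u. \<lbrakk>g \<in> carrier G; u \<in> U; \<phi> g u \<in> U\<rbrakk> \<Longrightarrow> g = \<one>"
      using small_open fX by (metis (no_types, lifting) mem_Collect_eq)
    let ?T = "{z \<in> topspace Z. f z \<in> U} \<inter> {z \<in> topspace Z. f' z \<in> U}"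
    have "openin Z ?T"
      using f f' U(1) by (intro openin_Int) (auto simp: continuous_map_def)
    moreover have "w \<in> ?T"
      using w U by auto
    moreover have "?T \<subseteq> ?E"
    proof
      fix v assume v: "v \<in> ?T"
      then obtain g where g: "g \<in> carrier G" "f' v = \<phi> g (f v)"
        using eq[of v] q_eq_iff fX by blast
      then have "g = \<one>"
        using U(3) v by auto
      then show "v \<in> ?E"
        using g v act_one fX by auto
    qed
    ultimately show "\<exists>T. openin Z T \<and> w \<in> T \<and> T \<subseteq> ?E" by blast
  qed
  moreover have "closedin Z ?E"
    using closedin_continuous_maps_eq[OF Hausdorff_total f f'] .
  ultimately have "?E = {} \<or> ?E = topspace Z"
    using con connected_space_clopen_in by blast
  then show ?thesis
    using z0 z by auto
qed

text \<open>The starting point of the lift is quantified over, so that lifts on two overlapping pieces can be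
  continued from either piece into the other.\<close>

definition lifts_on :: "'z topology \<Rightarrow> ('z \<Rightarrow> 'a set) \<Rightarrow> 'z set \<Rightarrow> bool"
  where "lifts_on Z f S \<longleftrightarrow> (\<forall>z0\<in>S. \<forall>x0\<in>topspace X. q x0 = f z0 \<longrightarrow>
     (\<exists>l. continuous_map (subtopology Z S) X l \<and> (\<forall>z\<in>S. q (l z) = f z) \<and> l z0 = x0))"

lemma lifts_on_empty: "lifts_on Z f {}"
  by (simp add: lifts_on_def)

text \<open>Continue a lift from \<open>S\<close> into \<open>T\<close> through a common point; on the connected intersection the two
  lifts then agree everywhere.\<close>

lemma lifts_on_Un_aux:
  assumes S: "closedin Z S" "lifts_on Z f S" and T: "closedin Z T" "lifts_on Z f T"
    and con: "connectedin Z (S \<inter> T)" and ne: "S \<inter> T \<noteq> {}"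
    and z0: "z0 \<in> S" and x0: "x0 \<in> topspace X" "q x0 = f z0"
  shows "\<exists>l. continuous_map (subtopology Z (S \<union> T)) X l \<and> (\<forall>z\<in>S \<union> T. q (l z) = f z) \<and> l z0 = x0"
proof -
  have sub: "S \<subseteq> topspace Z" "T \<subseteq> topspace Z"
    using S(1) T(1) closedin_subset by auto
  obtain l where l: "continuous_map (subtopology Z S) X l" "\<forall>z\<in>S. q (l z) = f z" "l z0 = x0"
    using S(2) z0 x0 unfolding lifts_on_def by blast
  obtain w where w: "w \<in> S" "w \<in> T" using ne by auto
  have "l w \<in> topspace X"
    using l(1) w sub by (auto simp: continuous_map_def topspace_subtopology)
  then obtain k where k: "continuous_map (subtopology Z T) X k" "\<forall>z\<in>T. q (k z) = f z" "k w = l w"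
    using T(2) w l(2) unfolding lifts_on_def by metis
  have agree: "l z = k z" if "z \<in> S \<inter> T" for z
  proof (rule unique_lift[where Z = "subtopology Z (S \<inter> T)" and ?z0.0 = w])
    show "connected_space (subtopology Z (S \<inter> T))"
      using con by (simp add: connectedin_def)
    show "continuous_map (subtopology Z (S \<inter> T)) X l" "continuous_map (subtopology Z (S \<inter> T)) X k"
      using l(1) k(1) by (auto intro: continuous_map_from_subtopology_mono)
  qed (use that w l k sub in \<open>auto simp: topspace_subtopology\<close>)
  let ?W = "subtopology Z (S \<union> T)"
  have "continuous_map ?W X (\<lambda>z. if z \<in> S then l z else k z)"
  proof (rule pasting_lemma_closed[where I = "UNIV :: bool set" and T = "\<lambda>b. if b then S else T"
        and f = "\<lambda>b. if b then l else k"])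
    show "closedin ?W (if i then S else T)" for i
      using S(1) T(1) by (cases i) (simp_all add: closedin_subset_topspace)
    show "continuous_map (subtopology ?W (if i then S else T)) X (if i then l else k)" for i
      using l(1) k(1) by (cases i) (simp_all add: subtopology_subtopology Int_absorb1)
    show "(if i then l else k) x = (if j then l else k) x"
      if "x \<in> topspace ?W \<inter> (if i then S else T) \<inter> (if j then S else T)" for i j x
      using that agree by (auto split: if_splits)
  qed (use sub in \<open>auto simp: topspace_subtopology\<close>)
  moreover have "\<forall>z\<in>S \<union> T. q (if z \<in> S then l z else k z) = f z"
    using l k by auto
  ultimately show ?thesis
    using z0 l(3) by (intro exI[of _ "\<lambda>z. if z \<in> S then l z else k z"]) auto
qed

lemma lifts_on_Un:
  assumes "closedin Z S" "lifts_on Z f S" "closedin Z T" "lifts_on Z f T"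
    and "connectedin Z (S \<inter> T)" "S \<inter> T \<noteq> {}"
  shows "lifts_on Z f (S \<union> T)"
  unfolding lifts_on_def
proof (intro ballI impI)
  fix z0 x0 assume z: "z0 \<in> S \<union> T" "x0 \<in> topspace X" "q x0 = f z0"
  consider "z0 \<in> S" | "z0 \<in> T" using z by auto
  then show "\<exists>l. continuous_map (subtopology Z (S \<union> T)) X l \<and> (\<forall>z\<in>S \<union> T. q (l z) = f z) \<and> l z0 = x0"
  proof cases
    case 1
    show ?thesis by (rule lifts_on_Un_aux[OF assms 1 z(2,3)])
  next
    case 2
    show ?thesis
      using lifts_on_Un_aux[OF assms(3,4,1,2) _ _ 2 z(2,3)] assms(5,6) by (simp add: Un_commute Int_commute)
  qed
qed

text \<open>The preimage of an evenly covered set works: compose with the local section, then translate by the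
  group element that corrects the starting value.\<close>

lemma lifts_on_local:
  assumes f: "continuous_map Z B f" and z: "z \<in> topspace Z"
  obtains W where "openin Z W" "z \<in> W" "\<And>S. S \<subseteq> W \<Longrightarrow> lifts_on Z f S"
proof -
  interpret group G by (rule group_G)
  have "f z \<in> topspace B"
    using f z by (auto simp: continuous_map_def)
  then obtain x where x: "x \<in> topspace X" "f z = q x"
    using topspace_B by auto
  obtain U where U: "openin X U" "x \<in> U"
     and small: "\<And>g u. \<lbrakk>g \<in> carrier G; u \<in> U; \<phi> g u \<in> U\<rbrakk> \<Longrightarrow> g = \<one>"
    using small_open x(1) by blast
  obtain \<sigma> where \<sigma>: "continuous_map (subtopology B (q ` U)) X \<sigma>" "\<And>u. u \<in> U \<Longrightarrow> \<sigma> (q u) = u"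
    using local_section[OF U(1)] small by (metis (no_types, lifting))
  have US: "U \<subseteq> topspace X"
    using U openin_subset by blast
  let ?W = "{z \<in> topspace Z. f z \<in> q ` U}"
  have "openin Z ?W"
    using f open_map_q U(1) by (auto simp: continuous_map_def open_map_def)
  moreover have "z \<in> ?W"
    using z x U by auto
  moreover have "lifts_on Z f S" if S: "S \<subseteq> ?W" for S
    unfolding lifts_on_def
  proof (intro ballI impI)
    fix z0 x0 assume z0: "z0 \<in> S" and x0: "x0 \<in> topspace X" "q x0 = f z0"
    then obtain u where u: "u \<in> U" "f z0 = q u" using S by auto
    then obtain g where g: "g \<in> carrier G" "x0 = \<phi> g u"
      using q_eq_iff[of u x0] x0 US by auto
    let ?l = "\<phi> g \<circ> (\<sigma> \<circ> f)"
    have "continuous_map (subtopology Z S) (subtopology B (q ` U)) f"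
      using f S by (auto simp: continuous_map_in_subtopology continuous_map_from_subtopology topspace_subtopology)
    then have "continuous_map (subtopology Z S) X ?l"
      using \<sigma>(1) continuous_action[OF g(1)] by (blast intro: continuous_map_compose)
    moreover have "\<forall>z\<in>S. q (?l z) = f z"
    proof
      fix z assume "z \<in> S"
      then obtain v where v: "v \<in> U" "f z = q v" using S by auto
      then show "q (?l z) = f z"
        using \<sigma>(2) q_act g(1) US by auto
    qed
    moreover have "?l z0 = x0"
      using u g \<sigma>(2) by simp
    ultimately show "\<exists>l. continuous_map (subtopology Z S) X l \<and> (\<forall>z\<in>S. q (l z) = f z) \<and> l z0 = x0"
      by blast
  qed
  ultimately show thesis using that by blast
qed

end


section \<open>Lifting maps of cubes\<close>

lemma continuous_on_coordinate [continuous_intros]: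
  "continuous_on S (\<lambda>x :: 'i \<Rightarrow> 'b::topological_space. x i)"
  by (rule continuous_on_subset[OF continuous_on_product_coordinates]) simp

lemma continuous_on_snd_coordinate [continuous_intros]:
  "continuous_on S (\<lambda>p :: 'c::topological_space \<times> ('i \<Rightarrow> 'b::topological_space). snd p i)"
  by (rule continuous_on_product_then_coordinatewise) (rule continuous_on_snd[OF continuous_on_id])

definition box_set :: "(nat \<Rightarrow> real) \<Rightarrow> (nat \<Rightarrow> real) \<Rightarrow> (nat \<Rightarrow> real) set"
  where "box_set lo hi = {x. \<forall>i. lo i \<le> x i \<and> x i \<le> hi i}"

definition unit_vec :: "nat \<Rightarrow> nat \<Rightarrow> real"
  where "unit_vec n = (\<lambda>i. if i < n then 1 else 0)"

lemma box_set_mono: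
  assumes "\<And>i. L i \<le> lo i" "\<And>i. hi i \<le> H i"
  shows "box_set lo hi \<subseteq> box_set L H"
  using assms unfolding box_set_def by (blast intro: order_trans)

lemma box_set_eq_PiE: "box_set lo hi = (\<Pi>\<^sub>E i\<in>UNIV. {lo i..hi i})"
  by (auto simp: box_set_def PiE_def)

lemma connected_box_set: "connected (box_set lo hi)"
proof -
  have "connectedin (product_topology (\<lambda>i. euclideanreal) UNIV) (box_set lo hi)"
    unfolding box_set_eq_PiE connectedin_PiE by simp
  then show ?thesis
    by (simp add: euclidean_product_topology connectedin_iff_connected)
qed

lemma closed_box_set: "closed (box_set lo hi)"
proof -
  have "box_set lo hi = (\<Inter>i. {x. lo i \<le> x i} \<inter> {x. x i \<le> hi i})"
    by (auto simp: box_set_def)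
  then show ?thesis
    by (auto intro!: closed_INT closed_Int closed_Collect_le continuous_intros)
qed

lemma Euclidean_space_eq: "Euclidean_space n = top_of_set {x. \<forall>i\<ge>n. x i = 0}"
  by (simp add: Euclidean_space_def euclidean_product_topology)

lemma cube_eq: "cube n = top_of_set (box_set (\<lambda>i. 0) (unit_vec n))"
proof -
  have "{x. \<forall>i\<ge>n. x i = 0} \<inter> {x. \<forall>i<n. 0 \<le> x i \<and> x i \<le> 1} = box_set (\<lambda>i. 0) (unit_vec n)"
  proof (intro Set.set_eqI iffI)
    fix x assume "x \<in> box_set (\<lambda>i. 0) (unit_vec n)"
    then have "0 \<le> x i \<and> x i \<le> (if i < n then 1 else 0)" for i
      by (simp add: box_set_def unit_vec_def)
    then show "x \<in> {x. \<forall>i\<ge>n. x i = 0} \<inter> {x. \<forall>i<n. 0 \<le> x i \<and> x i \<le> 1}"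
      by (auto) (metis antisym not_le)+
  qed (auto simp: box_set_def unit_vec_def)
  then show ?thesis
    by (simp add: cube_def Euclidean_space_eq subtopology_subtopology)
qed

lemma topspace_cube: "topspace (cube n) = {x. (\<forall>i<n. 0 \<le> x i \<and> x i \<le> 1) \<and> (\<forall>i\<ge>n. x i = 0)}"
  by (auto simp: cube_def topspace_Euclidean_space topspace_subtopology)

lemma open_contains_box:
  fixes W :: "(nat \<Rightarrow> real) set"
  assumes "open W" "z \<in> W"
  obtains e where "e > 0" "\<And>x. \<lbrakk>\<And>i. i < n \<Longrightarrow> \<bar>x i - z i\<bar> < e; \<And>i. i \<ge> n \<Longrightarrow> x i = z i\<rbrakk> \<Longrightarrow> x \<in> W"
proof -
  have "openin (product_topology (\<lambda>i. euclideanreal) UNIV) W"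
    using assms(1) by (simp add: euclidean_product_topology)
  then obtain J where J: "z \<in> (\<Pi>\<^sub>E i\<in>UNIV. J i)" "\<And>i. open (J i)" "(\<Pi>\<^sub>E i\<in>UNIV. J i) \<subseteq> W"
    using product_topology_open_contains_basis[OF _ assms(2)] by (metis open_openin)
  have "\<exists>e>0. \<forall>y. \<bar>y - z i\<bar> < e \<longrightarrow> y \<in> J i" for i
    using J(1) J(2)[of i] unfolding open_dist dist_real_def by (simp add: PiE_def Pi_def)
  then obtain e where e: "\<And>i. e i > 0" "\<And>i y. \<bar>y - z i\<bar> < e i \<Longrightarrow> y \<in> J i"
    by metis
  let ?e = "Min (insert 1 (e ` {..<n}))"
  show thesis
  proof
    show "?e > 0"
      using e(1) by simp
    show "x \<in> W" if x: "\<And>i. i < n \<Longrightarrow> \<bar>x i - z i\<bar> < ?e" "\<And>i. i \<ge> n \<Longrightarrow> x i = z i" for x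
    proof -
      have "x i \<in> J i" for i
      proof (cases "i < n")
        case True
        then have "?e \<le> e i" by (intro Min_le) auto
        then show ?thesis using x(1)[OF True] e(2)[of "x i" i] by linarith
      next
        case False
        then show ?thesis using x(2)[of i] e by simp
      qed
      then show ?thesis using J(3) by (auto simp: PiE_def)
    qed
  qed
qed

context free_discontinuous_action
begin

text \<open>Sweeping through the coordinates one after the other: if a map lifts over all boxes whose
  sides in direction \<open>\<ge> k\<close> are short, then compactness of an interval removes the constraint on
  direction \<open>k\<close>.\<close>

lemma lifts_on_box:
  assumes f: "continuous_map (top_of_set (box_set L H)) B f" (is "continuous_map ?Z _ _")
    and LH: "\<And>i. i \<ge> n \<Longrightarrow> L i = H i"
  shows "lifts_on ?Z f (box_set L H)"
proof -
  define inside where "inside lo hi \<longleftrightarrow> (\<forall>i. L i \<le> lo i \<and> hi i \<le> H i)" for lo hi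
  have closedin_sub: "closedin ?Z (box_set lo hi)" if "inside lo hi" for lo hi
  proof (rule closed_subset[OF _ closed_box_set])
    show "box_set lo hi \<subseteq> box_set L H"
      using that unfolding inside_def by (intro box_set_mono) auto
  qed
  have P: "\<forall>z\<in>box_set L H. \<exists>e>0. \<forall>lo hi. inside lo hi \<longrightarrow> (\<forall>i. k \<le> i \<and> i < n \<longrightarrow> z i - e < lo i \<and> hi i < z i + e)
            \<longrightarrow> lifts_on ?Z f (box_set lo hi)" if "k \<le> n" for k
    using that
  proof (induction k)
    case 0
    show ?case
    proof
      fix z assume z: "z \<in> box_set L H"
      obtain W where W: "openin ?Z W" "z \<in> W" "\<And>S. S \<subseteq> W \<Longrightarrow> lifts_on ?Z f S"
        using lifts_on_local[OF f, of z] z by auto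
      then obtain W' where W': "open W'" "W = box_set L H \<inter> W'"
        by (auto simp: openin_open)
      obtain e where e: "e > 0" "\<And>x. \<lbrakk>\<And>i. i < n \<Longrightarrow> \<bar>x i - z i\<bar> < e; \<And>i. i \<ge> n \<Longrightarrow> x i = z i\<rbrakk> \<Longrightarrow> x \<in> W'"
        using open_contains_box[OF W'(1), of z n] W(2) W'(2) by blast
      have "box_set lo hi \<subseteq> W" if io: "inside lo hi"
        and c: "\<forall>i. 0 \<le> i \<and> i < n \<longrightarrow> z i - e < lo i \<and> hi i < z i + e" for lo hi
      proof
        fix x assume x: "x \<in> box_set lo hi"
        then have xb: "x \<in> box_set L H"
          using io box_set_mono unfolding inside_def by blast
        have "x \<in> W'"
        proof (rule e(2))
          show "\<bar>x i - z i\<bar> < e" if "i < n" for i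
            using x c that unfolding box_set_def by (smt (verit) le0 mem_Collect_eq)
          show "x i = z i" if "i \<ge> n" for i
            using xb z LH[OF that] unfolding box_set_def by (smt (verit) mem_Collect_eq)
        qed
        then show "x \<in> W"
          using xb W'(2) by simp
      qed
      then show "\<exists>e>0. \<forall>lo hi. inside lo hi \<longrightarrow> (\<forall>i. 0 \<le> i \<and> i < n \<longrightarrow> z i - e < lo i \<and> hi i < z i + e)
            \<longrightarrow> lifts_on ?Z f (box_set lo hi)"
        using e(1) W(3) by (intro exI[of _ e]) simp
    qed
  next
    case (Suc k)
    show ?case
    proof
      fix z assume z: "z \<in> box_set L H"
      define Q where "Q u v \<longleftrightarrow> (\<exists>e>0. \<forall>lo hi. inside lo hi \<longrightarrow>
          (\<forall>i. Suc k \<le> i \<and> i < n \<longrightarrow> z i - e < lo i \<and> hi i < z i + e) \<longrightarrow>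
          u \<le> lo k \<longrightarrow> hi k \<le> v \<longrightarrow> lifts_on ?Z f (box_set lo hi))" for u v
      have "L k \<le> H k"
        using z by (auto simp: box_set_def intro: order_trans)
      then have "Q (L k) (H k)"
      proof (induction rule: Bolzano)
        case (trans a b c)
        obtain e1 where e1: "e1 > 0" "\<And>lo hi. \<lbrakk>inside lo hi;
           \<forall>i. Suc k \<le> i \<and> i < n \<longrightarrow> z i - e1 < lo i \<and> hi i < z i + e1; a \<le> lo k; hi k \<le> b\<rbrakk>
           \<Longrightarrow> lifts_on ?Z f (box_set lo hi)"
          using trans(1) unfolding Q_def by blast
        obtain e2 where e2: "e2 > 0" "\<And>lo hi. \<lbrakk>inside lo hi;
           \<forall>i. Suc k \<le> i \<and> i < n \<longrightarrow> z i - e2 < lo i \<and> hi i < z i + e2; b \<le> lo k; hi k \<le> c\<rbrakk>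
           \<Longrightarrow> lifts_on ?Z f (box_set lo hi)"
          using trans(2) unfolding Q_def by blast
        have "lifts_on ?Z f (box_set lo hi)"
          if io: "inside lo hi" and c: "\<forall>i. Suc k \<le> i \<and> i < n \<longrightarrow> z i - min e1 e2 < lo i \<and> hi i < z i + min e1 e2"
            and k: "a \<le> lo k" "hi k \<le> c" for lo hi
        proof -
          have c1: "\<forall>i. Suc k \<le> i \<and> i < n \<longrightarrow> z i - e1 < lo i \<and> hi i < z i + e1"
            and c2: "\<forall>i. Suc k \<le> i \<and> i < n \<longrightarrow> z i - e2 < lo i \<and> hi i < z i + e2"
            using c by force+
          consider "hi k \<le> b" | "b \<le> lo k" | "box_set lo hi = {}" | x where "lo k < b" "b < hi k" "x \<in> box_set lo hi"
            by (metis ex_in_conv linorder_not_le)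
          then show ?thesis
          proof cases
            case 1 then show ?thesis using e1(2)[OF io c1 k(1)] by blast
          next
            case 2 then show ?thesis using e2(2)[OF io c2] k(2) by blast
          next
            case 3 then show ?thesis by (simp add: lifts_on_empty)
          next
            case (4 x)
            let ?S = "box_set lo (hi(k := b))" and ?T = "box_set (lo(k := b)) hi"
            have in1: "inside lo (hi(k := b))"
              using io 4(2) unfolding inside_def by (auto intro: order_trans[OF less_imp_le])
            have in2: "inside (lo(k := b)) hi"
              using io 4(1) unfolding inside_def by (auto intro: order_trans[OF _ less_imp_le])
            have "lifts_on ?Z f ?S"
              by (rule e1(2)[OF in1]) (use c1 k in auto)
            moreover have "lifts_on ?Z f ?T"
              by (rule e2(2)[OF in2]) (use c2 k in auto)
            moreover have int: "?S \<inter> ?T = box_set (lo(k := b)) (hi(k := b))"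
              using 4 by (auto simp: box_set_def split: if_splits)
            moreover have "box_set (lo(k := b)) (hi(k := b)) \<subseteq> box_set L H"
              using in1 in2 unfolding inside_def by (intro box_set_mono) auto
            then have "connectedin ?Z (?S \<inter> ?T)"
              unfolding int by (simp add: connectedin_subtopology connected_box_set)
            moreover have "x(k := b) \<in> ?S \<inter> ?T"
              unfolding int using 4(3) by (auto simp: box_set_def)
            ultimately have "lifts_on ?Z f (?S \<union> ?T)"
              by (intro lifts_on_Un closedin_sub in1 in2) blast+
            moreover have "?S \<union> ?T = box_set lo hi"
            proof (rule antisym)
              show "?S \<union> ?T \<subseteq> box_set lo hi"
                using 4(1,2) by (intro Un_least box_set_mono) auto
              show "box_set lo hi \<subseteq> ?S \<union> ?T"
              proof
                fix y assume y: "y \<in> box_set lo hi"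
                show "y \<in> ?S \<union> ?T"
                proof (cases "y k \<le> b")
                  case True
                  then have "y \<in> ?S" using y by (simp add: box_set_def)
                  then show ?thesis by blast
                next
                  case False
                  then have "y \<in> ?T" using y by (simp add: box_set_def)
                  then show ?thesis by blast
                qed
              qed
            qed
            ultimately show ?thesis by simp
          qed
        qed
        then show ?case
          unfolding Q_def using e1(1) e2(1) by (intro exI[of _ "min e1 e2"]) (simp add: min_less_iff_conj)
      next
        case (local x)
        have "z(k := x) \<in> box_set L H"
          using z local by (auto simp: box_set_def)
        then obtain e where e: "e > 0" "\<And>lo hi. \<lbrakk>inside lo hi;
            \<forall>i. k \<le> i \<and> i < n \<longrightarrow> (z(k := x)) i - e < lo i \<and> hi i < (z(k := x)) i + e\<rbrakk>
            \<Longrightarrow> lifts_on ?Z f (box_set lo hi)"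
          using Suc.IH Suc.prems by (metis Suc_leD)
        have "Q a b" if ab: "a \<le> x" "x \<le> b" "b - a < e" for a b
          unfolding Q_def
        proof (intro exI[of _ e] conjI allI impI)
          fix lo hi assume io: "inside lo hi"
            and c: "\<forall>i. Suc k \<le> i \<and> i < n \<longrightarrow> z i - e < lo i \<and> hi i < z i + e"
            and k: "a \<le> lo k" "hi k \<le> b"
          show "lifts_on ?Z f (box_set lo hi)"
          proof (rule e(2)[OF io], intro allI impI)
            fix i assume i: "k \<le> i \<and> i < n"
            show "(z(k := x)) i - e < lo i \<and> hi i < (z(k := x)) i + e"
            proof (cases "i = k")
              case True
              then show ?thesis using ab k by auto
            next
              case False
              then show ?thesis using i c by auto
            qed
          qed
        qed (rule e(1))
        then show ?case
          using e(1) by blast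
      qed
      then show "\<exists>e>0. \<forall>lo hi. inside lo hi \<longrightarrow> (\<forall>i. Suc k \<le> i \<and> i < n \<longrightarrow> z i - e < lo i \<and> hi i < z i + e)
            \<longrightarrow> lifts_on ?Z f (box_set lo hi)"
        unfolding Q_def inside_def by blast
    qed
  qed
  show ?thesis
  proof (cases "box_set L H = {}")
    case False
    have "inside L H" by (simp add: inside_def)
    then show ?thesis
      using P[OF order_refl] False by (metis (no_types, lifting) equals0I leD)
  qed (simp add: lifts_on_empty)
qed

lemma lift_cube:
  assumes f: "continuous_map (cube n) B f" and z0: "z0 \<in> topspace (cube n)"
    and x0: "x0 \<in> topspace X" "q x0 = f z0"
  obtains l where "continuous_map (cube n) X l" "\<And>z. z \<in> topspace (cube n) \<Longrightarrow> q (l z) = f z" "l z0 = x0"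
proof -
  have "lifts_on (cube n) f (topspace (cube n))"
    using lifts_on_box[of "\<lambda>i. 0" "unit_vec n" f n] f unfolding cube_eq by (simp add: unit_vec_def)
  then obtain l where "continuous_map (subtopology (cube n) (topspace (cube n))) X l"
      "\<forall>z\<in>topspace (cube n). q (l z) = f z" "l z0 = x0"
    using z0 x0 unfolding lifts_on_def by meson
  then show thesis
    using that by (simp add: subtopology_topspace)
qed

end


section \<open>Homotopies relative to the boundary of a cube\<close>

lemma topspace_cube_box: "topspace (cube n) = box_set (\<lambda>i. 0) (unit_vec n)"
  by (simp add: cube_eq)

lemma prod_cube: "prod_topology (top_of_set {0..1::real}) (cube n) = top_of_set ({0..1} \<times> topspace (cube n))"
  unfolding cube_eq by simp

lemma connected_space_cube: "connected_space (cube n)"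
  using connected_box_set by (simp add: cube_eq connected_space_subtopology)

text \<open>Homotopies of maps of an \<open>n\<close>-cube become maps of an \<open>Suc n\<close>-cube and can thus be lifted.\<close>

lemma homeomorphic_prod_cube:
  "homeomorphic_maps (prod_topology (top_of_set {0..1::real}) (cube n)) (cube (Suc n))
     (\<lambda>(t, x). x(n := t)) (\<lambda>y. (y n, y(n := 0)))"
proof -
  have c1: "continuous_on S (\<lambda>p :: real \<times> (nat \<Rightarrow> real). (snd p)(n := fst p))" for S
  proof (rule continuous_on_coordinatewise_then_product)
    fix i show "continuous_on S (\<lambda>p :: real \<times> (nat \<Rightarrow> real). ((snd p)(n := fst p)) i)"
      by (cases "i = n") (auto intro!: continuous_intros)
  qed
  have c2: "continuous_on S (\<lambda>y :: nat \<Rightarrow> real. y(n := 0))" for S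
  proof (rule continuous_on_coordinatewise_then_product)
    fix i show "continuous_on S (\<lambda>y :: nat \<Rightarrow> real. (y(n := 0)) i)"
      by (cases "i = n") (auto intro!: continuous_intros)
  qed
  have "continuous_map (prod_topology (top_of_set {0..1::real}) (cube n)) (cube (Suc n)) (\<lambda>(t, x). x(n := t))"
    unfolding prod_cube cube_eq[of "Suc n"] case_prod_unfold
    using c1 by (auto simp: topspace_cube_box box_set_def unit_vec_def less_Suc_eq)
  moreover have "continuous_map (cube (Suc n)) (prod_topology (top_of_set {0..1::real}) (cube n)) (\<lambda>y. (y n, y(n := 0)))"
  proof -
    have "continuous_on (topspace (cube (Suc n))) (\<lambda>y. (y n, y(n := 0)))"
      by (intro continuous_intros c2)
    moreover have "(y n, y(n := 0)) \<in> {0..1} \<times> topspace (cube n)" if "y \<in> topspace (cube (Suc n))" for y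
    proof -
      have "0 \<le> y n" "y n \<le> 1"
        using that by (auto simp: topspace_cube)
      moreover have "y(n := 0) \<in> topspace (cube n)"
        using that by (simp add: topspace_cube)
      ultimately show ?thesis by simp
    qed
    ultimately have "continuous_map (top_of_set (topspace (cube (Suc n)))) (top_of_set ({0..1} \<times> topspace (cube n)))
        (\<lambda>y. (y n, y(n := 0)))"
      by (simp add: continuous_map_subtopology_eu Pi_def)
    then show ?thesis
      by (simp add: prod_cube cube_eq)
  qed
  moreover have "x(n := 0) = x" if "x \<in> topspace (cube n)" for x :: "nat \<Rightarrow> real"
    using that by (auto simp: topspace_cube)
  ultimately show ?thesis
    by (auto simp: homeomorphic_maps_def)
qed

text \<open>Expansion of the cube from its centre; at time \<open>1\<close> the outer shell of width \<open>1/4\<close> has been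
  pushed into the boundary.\<close>

definition cube_expand :: "nat \<Rightarrow> real \<Rightarrow> (nat \<Rightarrow> real) \<Rightarrow> nat \<Rightarrow> real"
  where "cube_expand n s x = (\<lambda>i. if i < n then max 0 (min 1 ((1 + s) * x i - s / 2)) else 0)"

text \<open>A bump function: \<open>0\<close> on the boundary and \<open>1\<close> inside that shell.\<close>

definition cube_bump :: "nat \<Rightarrow> (nat \<Rightarrow> real) \<Rightarrow> real"
  where "cube_bump n x = (\<Prod>i<n. min 1 (4 * min (x i) (1 - x i)))"

lemma cube_expand_in: "cube_expand n s x \<in> topspace (cube n)"
  by (auto simp: cube_expand_def topspace_cube)

lemma cube_expand_0: "x \<in> topspace (cube n) \<Longrightarrow> cube_expand n 0 x = x"
  by (auto simp: cube_expand_def topspace_cube)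

lemma continuous_cube_expand: "continuous_on S (\<lambda>p. cube_expand n (fst p) (snd p))"
proof (rule continuous_on_coordinatewise_then_product)
  fix i show "continuous_on S (\<lambda>p. cube_expand n (fst p) (snd p) i)"
    unfolding cube_expand_def by (cases "i < n") (auto intro!: continuous_intros)
qed

lemma cube_bump_range: "x \<in> topspace (cube n) \<Longrightarrow> cube_bump n x \<in> {0..1}"
  by (auto simp: cube_bump_def topspace_cube intro!: prod_nonneg prod_le_1)

lemma cube_bump_boundary: "x \<in> cube_boundary n \<Longrightarrow> cube_bump n x = 0"
  by (auto simp: cube_bump_def cube_boundary_def intro!: bexI)

text \<open>After the expansion two maps that agree on the boundary can differ only where the bump function
  is \<open>1\<close>.\<close>

lemma cube_shell:
  assumes "x \<in> topspace (cube n)"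
  shows "cube_expand n 1 x \<in> cube_boundary n \<or> cube_bump n x = 1"
proof (cases "\<forall>i<n. 1/4 \<le> x i \<and> x i \<le> 3/4")
  case True
  then have "min 1 (4 * min (x i) (1 - x i)) = 1" if "i < n" for i
    using that by (auto simp: min_def)
  then show ?thesis
    by (simp add: cube_bump_def)
next
  case False
  then obtain i where i: "i < n" "x i < 1/4 \<or> x i > 3/4" by fastforce
  then have "cube_expand n 1 x i = 0 \<or> cube_expand n 1 x i = 1"
    by (auto simp: cube_expand_def min_def max_def)
  then show ?thesis
    using i cube_expand_in unfolding cube_boundary_def by blast
qed

lemma homotopic_cube_expand:
  assumes f: "continuous_map (cube n) X f"
    and bd: "\<And>s x. \<lbrakk>s \<in> {0..1}; x \<in> cube_boundary n\<rbrakk> \<Longrightarrow> f (cube_expand n s x) = b x"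
  shows "homotopic_with (\<lambda>h. \<forall>x\<in>cube_boundary n. h x = b x) (cube n) X f (f \<circ> cube_expand n 1)"
proof (subst homotopic_with)
  let ?h = "\<lambda>p. f (cube_expand n (fst p) (snd p))"
  have "continuous_map (prod_topology (top_of_set {0..1}) (cube n)) (cube n) (\<lambda>p. cube_expand n (fst p) (snd p))"
    unfolding prod_cube using continuous_cube_expand cube_expand_in
    by (auto simp: cube_eq)
  then have "continuous_map (prod_topology (top_of_set {0..1}) (cube n)) X ?h"
    using continuous_map_compose[OF _ f] by (auto simp: o_def)
  moreover have "\<forall>x\<in>topspace (cube n). ?h (0, x) = f x"
    by (simp add: cube_expand_0)
  moreover have "\<forall>t\<in>{0..1}. \<forall>x\<in>cube_boundary n. ?h (t, x) = b x"
    by (simp add: bd)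
  ultimately show "\<exists>h. continuous_map (prod_topology (top_of_set {0..1::real}) (cube n)) X h \<and>
     (\<forall>x\<in>topspace (cube n). h (0, x) = f x) \<and> (\<forall>x\<in>topspace (cube n). h (1, x) = (f \<circ> cube_expand n 1) x) \<and>
     (\<forall>t\<in>{0..1}. \<forall>x\<in>cube_boundary n. h (t, x) = b x)"
    by (intro exI[of _ "?h"]) simp
qed (auto simp: cube_boundary_def)

text \<open>Let \<open>H\<close> contract the space. First expand the cube, so that \<open>f\<close> and \<open>g\<close> become equal on an outer shell.
  Then let every point \<open>x\<close> travel from \<open>f x\<close> along \<open>H\<close> to depth \<open>cube_bump n x\<close> and back to \<open>g x\<close>. At the
  turning point the two tracks meet: in the inner part both have reached the centre of the
  contraction, and in the shell \<open>f\<close> and \<open>g\<close> agree. The boundary travels to depth \<open>0\<close> and does not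
  move.\<close>

lemma homotopic_rel_boundary:
  assumes X: "contractible_space X"
    and f: "continuous_map (cube n) X f" and g: "continuous_map (cube n) X g"
    and bf: "\<And>s x. \<lbrakk>s \<in> {0..1}; x \<in> cube_boundary n\<rbrakk> \<Longrightarrow> f (cube_expand n s x) = b x"
    and bg: "\<And>s x. \<lbrakk>s \<in> {0..1}; x \<in> cube_boundary n\<rbrakk> \<Longrightarrow> g (cube_expand n s x) = b x"
  shows "homotopic_with (\<lambda>h. \<forall>x\<in>cube_boundary n. h x = b x) (cube n) X f g"
proof -
  let ?P = "\<lambda>h. \<forall>x\<in>cube_boundary n. h x = b x"
  obtain a where "homotopic_with (\<lambda>x. True) X X id (\<lambda>x. a)"
    using X unfolding contractible_space_def by blast
  then obtain H where H: "continuous_map (prod_topology (top_of_set {0..1::real}) X) X H"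
      "\<And>x. H (0, x) = x" "\<And>x. H (1, x) = a"
    unfolding homotopic_with_def by auto
  define f' where "f' = f \<circ> cube_expand n 1"
  define g' where "g' = g \<circ> cube_expand n 1"
  have ff: "homotopic_with ?P (cube n) X f f'" and gg: "homotopic_with ?P (cube n) X g g'"
    unfolding f'_def g'_def using f g bf bg by (blast intro: homotopic_cube_expand)+
  then have cf: "continuous_map (cube n) X f'" and cg: "continuous_map (cube n) X g'"
    and Pf: "?P f'" and Pg: "?P g'"
    using homotopic_with_imp_continuous_maps homotopic_with_imp_property by blast+
  have fg': "f' x = g' x" if "x \<in> topspace (cube n)" "cube_bump n x \<noteq> 1" for x
  proof -
    have y: "cube_expand n 1 x \<in> cube_boundary n"
      using cube_shell that by blast
    then have "cube_expand n 0 (cube_expand n 1 x) = cube_expand n 1 x"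
      by (simp add: cube_expand_0 cube_expand_in)
    then show ?thesis
      unfolding f'_def g'_def using bf[of 0, OF _ y] bg[of 0, OF _ y] by simp
  qed
  let ?Z = "prod_topology (top_of_set {0..1::real}) (cube n)"
  let ?u = "\<lambda>p :: real \<times> (nat \<Rightarrow> real). cube_bump n (snd p) * (2 * fst p)"
  let ?v = "\<lambda>p :: real \<times> (nat \<Rightarrow> real). cube_bump n (snd p) * (2 - 2 * fst p)"
  let ?K = "\<lambda>p. if fst p \<le> 1/2 then H (?u p, f' (snd p)) else H (?v p, g' (snd p))"
  have cb: "continuous_on S (\<lambda>p :: real \<times> (nat \<Rightarrow> real). cube_bump n (snd p))" for S
    unfolding cube_bump_def by (intro continuous_intros)
  have part: "continuous_map (subtopology ?Z T) X (\<lambda>p. H (w p, k (snd p)))"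
    if w: "continuous_on UNIV w" and wr: "\<And>p. p \<in> topspace ?Z \<Longrightarrow> p \<in> T \<Longrightarrow> w p \<in> {0..1}"
      and k: "continuous_map (cube n) X k" for T k and w :: "real \<times> (nat \<Rightarrow> real) \<Rightarrow> real"
  proof -
    have "continuous_map (subtopology ?Z T) (top_of_set {0..1}) w"
      using wr continuous_on_subset[OF w] unfolding prod_cube
      by (auto simp: subtopology_subtopology image_subset_iff)
    moreover have "continuous_map (subtopology ?Z T) X (\<lambda>p. k (snd p))"
      using continuous_map_compose[OF continuous_map_snd k]
      by (auto simp: o_def intro: continuous_map_from_subtopology)
    ultimately have "continuous_map (subtopology ?Z T) (prod_topology (top_of_set {0..1}) X) (\<lambda>p. (w p, k (snd p)))"
      by (simp add: continuous_map_pairedI)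
    then show ?thesis
      using continuous_map_compose[OF _ H(1)] by (auto simp: o_def)
  qed
  have br: "0 \<le> cube_bump n x" "cube_bump n x \<le> 1" if "x \<in> topspace (cube n)" for x
    using cube_bump_range[OF that] by auto
  have unit_prod: "0 \<le> r \<Longrightarrow> 0 \<le> r' \<Longrightarrow> r \<le> 1 \<Longrightarrow> r' \<le> 1 \<Longrightarrow> r * r' \<le> 1" for r r' :: real
    by (rule mult_le_one)
  have "continuous_map ?Z X ?K"
  proof (rule continuous_map_cases_le)
    show "continuous_map ?Z euclideanreal fst"
      unfolding prod_cube by (simp add: continuous_intros)
    show "continuous_map ?Z euclideanreal (\<lambda>p. 1/2)" by simp
    show "continuous_map (subtopology ?Z {x \<in> topspace ?Z. fst x \<le> 1/2}) X (\<lambda>p. H (?u p, f' (snd p)))"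
    proof (rule part)
      show "?u p \<in> {0..1}" if "p \<in> topspace ?Z" "p \<in> {x \<in> topspace ?Z. fst x \<le> 1/2}" for p
        using that br[of "snd p"] unit_prod[of "cube_bump n (snd p)" "2 * fst p"] by auto
    qed (use cf cb in \<open>auto intro!: continuous_intros\<close>)
    show "continuous_map (subtopology ?Z {x \<in> topspace ?Z. 1/2 \<le> fst x}) X (\<lambda>p. H (?v p, g' (snd p)))"
    proof (rule part)
      show "?v p \<in> {0..1}" if "p \<in> topspace ?Z" "p \<in> {x \<in> topspace ?Z. 1/2 \<le> fst x}" for p
        using that br[of "snd p"] unit_prod[of "cube_bump n (snd p)" "2 - 2 * fst p"] by auto
    qed (use cg cb in \<open>auto intro!: continuous_intros\<close>)
    show "H (?u p, f' (snd p)) = H (?v p, g' (snd p))" if "p \<in> topspace ?Z" "fst p = 1/2" for p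
    proof -
      have "2 * fst p = 1" "2 - 2 * fst p = 1" "snd p \<in> topspace (cube n)"
        using that by auto
      then show ?thesis
        using H(3) fg'[of "snd p"] by (cases "cube_bump n (snd p) = 1") simp_all
    qed
  qed
  moreover have "?K (t, x) = b x" if "x \<in> cube_boundary n" for t x
    using that by (simp add: cube_bump_boundary H(2) Pf Pg)
  moreover have P: "?P h \<longleftrightarrow> ?P k" if "\<And>x. x \<in> topspace (cube n) \<Longrightarrow> h x = k x" for h k
    using that by (simp add: cube_boundary_def)
  ultimately have "\<exists>h. continuous_map ?Z X h \<and> (\<forall>x\<in>topspace (cube n). h (0, x) = f' x) \<and>
      (\<forall>x\<in>topspace (cube n). h (1, x) = g' x) \<and> (\<forall>t\<in>{0..1}. ?P (\<lambda>x. h (t, x)))"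
    by (intro exI[of _ ?K]) (simp add: H(2))
  then have "homotopic_with ?P (cube n) X f' g'"
    using P by (subst homotopic_with) blast+
  then show ?thesis
    using ff gg homotopic_with_trans homotopic_with_symD by blast
qed


section \<open>Quotients of contractible spaces\<close>

(* Statements about the 1-cube are kept in the form cube 1 for rewriting. *)
declare One_nat_def [simp del]

lemma cube_expand_boundary:
  assumes "x \<in> cube_boundary n" "s \<in> {0..1}"
  shows "cube_expand n s x \<in> cube_boundary n"
proof -
  obtain i where i: "i < n" "x i = 0 \<or> x i = 1"
    using assms by (auto simp: cube_boundary_def)
  then have "cube_expand n s x i = 0 \<or> cube_expand n s x i = 1"
    using assms(2) by (auto simp: cube_expand_def min_def max_def)
  then show ?thesis
    using i(1) cube_expand_in unfolding cube_boundary_def by blast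
qed

lemma unit_vec_1: "unit_vec 1 = (\<lambda>i. 0)(0 := 1)"
  by (auto simp: unit_vec_def)

lemma cube_boundary_1: "cube_boundary 1 = {\<lambda>i. 0, unit_vec 1}"
proof (intro Set.set_eqI iffI)
  fix x assume x: "x \<in> cube_boundary 1"
  then have "x i = 0" if "i > 0" for i
    using that by (auto simp: cube_boundary_def topspace_cube)
  moreover have "x 0 = 0 \<or> x 0 = 1"
    using x by (auto simp: cube_boundary_def)
  ultimately have "x = (\<lambda>i. 0) \<or> x = unit_vec 1"
    unfolding unit_vec_1 fun_eq_iff by (metis fun_upd_apply gr0I)
  then show "x \<in> {\<lambda>i. 0, unit_vec 1}" by simp
qed (auto simp: cube_boundary_def topspace_cube unit_vec_def)

lemma cube_expand_boundary_1:
  assumes "x \<in> cube_boundary 1" "s \<in> {0..1}"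
  shows "cube_expand 1 s x = x"
  using assms unfolding cube_boundary_1 cube_expand_def unit_vec_def by (auto simp: fun_eq_iff)

lemma homotopic_n_loops_class:
  assumes "homotopic_n_loops n X x f f'"
  shows "{g. homotopic_n_loops n X x f g} = {g. homotopic_n_loops n X x f' g}"
  using assms unfolding homotopic_n_loops_def
  by (blast intro: homotopic_with_trans homotopic_with_symD)

lemma homotopic_n_loops_refl:
  "homotopic_n_loops n X x f f \<longleftrightarrow> f \<in> n_loops n X x"
  by (simp add: homotopic_n_loops_def n_loops_def)

lemma homotopic_n_loops_cong:
  assumes "homotopic_n_loops n X x f g"
    and "\<And>z. z \<in> topspace (cube n) \<Longrightarrow> f' z = f z" "\<And>z. z \<in> topspace (cube n) \<Longrightarrow> g' z = g z"
  shows "homotopic_n_loops n X x f' g'"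
proof -
  let ?P = "\<lambda>h. h ` cube_boundary n \<subseteq> {x}"
  have P: "?P h \<longleftrightarrow> ?P k" if "\<And>z. z \<in> topspace (cube n) \<Longrightarrow> h z = k z" for h k
    using that by (auto simp: cube_boundary_def image_subset_iff)
  obtain h where "continuous_map (prod_topology (top_of_set {0..1::real}) (cube n)) X h"
      "\<And>x. h (0, x) = f x" "\<And>x. h (1, x) = g x" "\<forall>t\<in>{0..1}. ?P (\<lambda>x. h (t, x))"
    using assms(1) unfolding homotopic_n_loops_def homotopic_with_def by blast
  then have "\<exists>h. continuous_map (prod_topology (top_of_set {0..1::real}) (cube n)) X h \<and>
      (\<forall>x\<in>topspace (cube n). h (0, x) = f' x) \<and>
      (\<forall>x\<in>topspace (cube n). h (1, x) = g' x) \<and> (\<forall>t\<in>{0..1}. ?P (\<lambda>x. h (t, x)))"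
    by (intro exI[of _ h]) (simp add: assms(2,3))
  then show ?thesis
    unfolding homotopic_n_loops_def using P by (subst homotopic_with) blast+
qed

lemma homotopic_n_loops_in:
  assumes "homotopic_n_loops n X x f f'" shows "f \<in> n_loops n X x" "f' \<in> n_loops n X x"
  using assms homotopic_with_imp_continuous_maps homotopic_with_imp_property
  unfolding homotopic_n_loops_def n_loops_def by blast+

context free_discontinuous_action
begin

lemma lift_prod_cube:
  assumes f: "continuous_map (prod_topology (top_of_set {0..1::real}) (cube n)) B f" (is "continuous_map ?Z B f")
    and z0: "z0 \<in> {0..1} \<times> topspace (cube n)" and x0: "x0 \<in> topspace X" "q x0 = f z0"
  obtains l where "continuous_map (prod_topology (top_of_set {0..1::real}) (cube n)) X l"
    "\<And>z. z \<in> {0..1} \<times> topspace (cube n) \<Longrightarrow> q (l z) = f z" "l z0 = x0"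
proof -
  have Z: "topspace ?Z = {0..1} \<times> topspace (cube n)" by simp
  let ?J = "\<lambda>(t, x). x(n := t)" and ?J' = "\<lambda>y. (y n, y(n := 0))"
  have J: "continuous_map ?Z (cube (Suc n)) ?J" and J': "continuous_map (cube (Suc n)) ?Z ?J'"
    and JJ: "\<And>z. z \<in> topspace ?Z \<Longrightarrow> ?J' (?J z) = z"
    using homeomorphic_prod_cube[of n] unfolding homeomorphic_maps_def by blast+
  have "?J z0 \<in> topspace (cube (Suc n))"
    using J z0 Z unfolding continuous_map_def by blast
  moreover have "q x0 = (f \<circ> ?J') (?J z0)"
    using x0 JJ z0 Z by simp
  ultimately obtain l where l: "continuous_map (cube (Suc n)) X l"
      "\<And>z. z \<in> topspace (cube (Suc n)) \<Longrightarrow> q (l z) = (f \<circ> ?J') z" "l (?J z0) = x0"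
    using lift_cube[OF continuous_map_compose[OF J' f]] x0(1) by blast
  show thesis
  proof
    show "continuous_map ?Z X (l \<circ> ?J)"
      by (rule continuous_map_compose[OF J l(1)])
    show "q ((l \<circ> ?J) z) = f z" if "z \<in> {0..1} \<times> topspace (cube n)" for z
    proof -
      have "?J z \<in> topspace (cube (Suc n))"
        using J that Z unfolding continuous_map_def by blast
      then show ?thesis
        using l(2) JJ[of z] that Z by simp
    qed
    show "(l \<circ> ?J) z0 = x0"
      using l(3) by simp
  qed
qed

lemma lift_of_constant:
  assumes "connected_space Z" "continuous_map Z X l" "\<And>z. z \<in> topspace Z \<Longrightarrow> q (l z) = b"
    and "z \<in> topspace Z" "z' \<in> topspace Z"
  shows "l z = l z'"
proof -
  have "continuous_map Z X (\<lambda>z. l z')"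
    using assms by (simp add: continuous_map_def Pi_iff)
  from unique_lift[OF assms(1,2) this _ assms(5) refl assms(4)] show ?thesis
    using assms(3,5) by simp
qed

text \<open>A lift of a constant is constant on each face. When \<open>n \<ge> 2\<close>, any face shares a point with another
  face that contains the origin, so all these constants coincide.\<close>

lemma lift_constant_on_boundary:
  assumes n: "2 \<le> n" and l: "continuous_map (cube n) X l"
    and b: "\<And>z. z \<in> cube_boundary n \<Longrightarrow> q (l z) = b" and x: "x \<in> cube_boundary n"
  shows "l x = l (\<lambda>i. 0)"
proof -
  define face where "face i c = box_set ((\<lambda>i. 0)(i := c)) ((unit_vec n)(i := c))" for i and c :: real
  have face: "face i c = {x \<in> topspace (cube n). x i = c}" if ic: "i < n" "c = 0 \<or> c = 1" for i c
  proof (intro Set.set_eqI iffI)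
    fix x assume "x \<in> face i c"
    then have x: "((\<lambda>i. 0)(i := c)) j \<le> x j" "x j \<le> ((unit_vec n)(i := c)) j" for j
      by (simp_all add: face_def box_set_def)
    have xi: "x i = c"
      using x[of i] by simp
    have "0 \<le> x j \<and> x j \<le> unit_vec n j" for j
      using x[of j] xi ic by (cases "j = i") (auto simp: unit_vec_def)
    then show "x \<in> {x \<in> topspace (cube n). x i = c}"
      using xi by (simp add: topspace_cube_box box_set_def)
  qed (simp add: face_def topspace_cube_box box_set_def)
  have const: "l y = l z" if ic: "i < n" "c = 0 \<or> c = 1" and yz: "y \<in> face i c" "z \<in> face i c" for i c y z
  proof -
    let ?F = "subtopology (cube n) (face i c)"
    have sub: "face i c \<subseteq> topspace (cube n)" and bd: "face i c \<subseteq> cube_boundary n"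
      using face[OF ic] ic by (auto simp: cube_boundary_def)
    then have F: "topspace ?F = face i c" by auto
    have "connectedin (cube n) (face i c)"
      using sub unfolding cube_eq
      by (simp add: connectedin_subtopology connectedin_iff_connected face_def connected_box_set)
    then have con: "connected_space ?F"
      by (simp add: connectedin_def)
    have "q (l w) = b" if "w \<in> topspace ?F" for w
      using that bd b unfolding F by blast
    from lift_of_constant[OF con continuous_map_from_subtopology[OF l] this] show ?thesis
      using yz unfolding F by blast
  qed
  obtain i where i: "i < n" "x i = 0 \<or> x i = 1" and xc: "x \<in> topspace (cube n)"
    using x by (auto simp: cube_boundary_def)
  define j where "j = (if i = 0 then 1 else 0 :: nat)"
  have j: "j < n" "j \<noteq> i" using n by (auto simp: j_def)
  let ?e = "(\<lambda>i. 0)(i := x i) :: nat \<Rightarrow> real"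
  have e: "?e \<in> topspace (cube n)" using i by (auto simp: topspace_cube)
  have "l x = l ?e"
    using const[of i "x i" x ?e] i xc e by (simp add: face)
  also have "\<dots> = l (\<lambda>i. 0)"
    using const[of j 0 ?e "\<lambda>i. 0"] j e by (simp add: face) (simp add: topspace_cube)
  finally show ?thesis .
qed

lemma higher_loops_null_homotopic:
  assumes X: "contractible_space X" and x0: "x0 \<in> topspace X" and n: "2 \<le> n"
    and f: "f \<in> n_loops n B (q x0)"
  shows "homotopic_n_loops n B (q x0) f (\<lambda>x. q x0)"
proof -
  have "0 < n" using n by simp
  then have z: "(\<lambda>i. 0) \<in> cube_boundary n" by (auto simp: cube_boundary_def topspace_cube)
  have fc: "continuous_map (cube n) B f" and fb: "\<And>z. z \<in> cube_boundary n \<Longrightarrow> f z = q x0"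
    using f by (auto simp: n_loops_def)
  have bc: "cube_boundary n \<subseteq> topspace (cube n)" by (auto simp: cube_boundary_def)
  obtain l where l: "continuous_map (cube n) X l" "\<And>z. z \<in> topspace (cube n) \<Longrightarrow> q (l z) = f z" "l (\<lambda>i. 0) = x0"
    using lift_cube[OF fc _ x0, of "\<lambda>i. 0"] z fb[OF z] bc by (metis subsetD)
  have lb: "l x = x0" if "x \<in> cube_boundary n" for x
    using lift_constant_on_boundary[OF n l(1) _ that, of "q x0"] l(2,3) fb bc by (metis subsetD)
  have "homotopic_with (\<lambda>h. \<forall>x\<in>cube_boundary n. h x = x0) (cube n) X l (\<lambda>x. x0)"
    using x0 lb cube_expand_boundary by (intro homotopic_rel_boundary[OF X l(1)]) auto
  then have "homotopic_n_loops n B (q x0) (q \<circ> l) (q \<circ> (\<lambda>x. x0))"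
    unfolding homotopic_n_loops_def
    by (rule homotopic_with_compose_continuous_map_left[OF _ continuous_map_q]) auto
  then show ?thesis
    by (rule homotopic_n_loops_cong) (simp_all add: l(2))
qed

text \<open>The identification of loops in the quotient with group elements, kept as a relation until
  independence of the homotopy class is established.\<close>

definition monodromy :: "'a \<Rightarrow> ((nat \<Rightarrow> real) \<Rightarrow> 'a set) \<Rightarrow> 'g \<Rightarrow> bool"
  where "monodromy x0 f g \<longleftrightarrow> g \<in> carrier G \<and>
    (\<exists>l. continuous_map (cube 1) X l \<and> (\<forall>z\<in>topspace (cube 1). q (l z) = f z) \<and>
         l (\<lambda>i. 0) = x0 \<and> l (unit_vec 1) = \<phi> g x0)"

lemma cube_1_ends: "(\<lambda>i. 0) \<in> topspace (cube 1)" "unit_vec 1 \<in> topspace (cube 1)"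
  by (auto simp: topspace_cube unit_vec_def)

lemma monodromy_loop:
  assumes "x0 \<in> topspace X" "monodromy x0 f g" shows "f \<in> n_loops 1 B (q x0)"
proof -
  obtain l where l: "continuous_map (cube 1) X l" "\<And>z. z \<in> topspace (cube 1) \<Longrightarrow> q (l z) = f z"
      "l (\<lambda>i. 0) = x0" "l (unit_vec 1) = \<phi> g x0" and g: "g \<in> carrier G"
    using assms(2) unfolding monodromy_def by blast
  have "continuous_map (cube 1) B f"
    by (rule continuous_map_eq[OF continuous_map_compose[OF l(1) continuous_map_q]]) (simp add: l(2))
  moreover have "f (\<lambda>i. 0) = q x0" "f (unit_vec 1) = q x0"
    using l(2)[OF cube_1_ends(1)] l(2)[OF cube_1_ends(2)] l(3,4) q_act[OF g assms(1)] by simp_all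
  ultimately show ?thesis
    by (simp add: n_loops_def cube_boundary_1)
qed

lemma monodromy_exists:
  assumes x0: "x0 \<in> topspace X" and f: "f \<in> n_loops 1 B (q x0)"
  obtains g where "monodromy x0 f g"
proof -
  have fc: "continuous_map (cube 1) B f" and fb: "f (\<lambda>i. 0) = q x0" "f (unit_vec 1) = q x0"
    using f by (auto simp: n_loops_def cube_boundary_1)
  obtain l where l: "continuous_map (cube 1) X l" "\<And>z. z \<in> topspace (cube 1) \<Longrightarrow> q (l z) = f z" "l (\<lambda>i. 0) = x0"
    using lift_cube[OF fc cube_1_ends(1) x0] fb by metis
  have "l (unit_vec 1) \<in> topspace X" "q (l (unit_vec 1)) = q x0"
    using l(1,2) fb cube_1_ends by (auto simp: continuous_map_def)
  then obtain g where "g \<in> carrier G" "l (unit_vec 1) = \<phi> g x0"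
    using q_eq_iff[OF x0] by metis
  then show thesis
    using that l unfolding monodromy_def by blast
qed

text \<open>Lift the homotopy. Its restrictions to the two end points of the loop lift constant paths and are
  constant, while its initial and final stages are the lifts of \<open>f\<close> and \<open>f'\<close>.\<close>

lemma monodromy_homotopic:
  assumes x0: "x0 \<in> topspace X" and hom: "homotopic_n_loops 1 B (q x0) f f'"
    and m: "monodromy x0 f g" and m': "monodromy x0 f' g'"
  shows "g = g'"
proof -
  let ?Z = "prod_topology (top_of_set {0..1::real}) (cube 1)"
  let ?o = "\<lambda>i. 0 :: real" and ?e = "unit_vec 1"
  obtain l where l: "continuous_map (cube 1) X l" "\<And>z. z \<in> topspace (cube 1) \<Longrightarrow> q (l z) = f z"
      "l ?o = x0" "l ?e = \<phi> g x0" and g: "g \<in> carrier G"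
    using m unfolding monodromy_def by blast
  obtain l' where l': "continuous_map (cube 1) X l'" "\<And>z. z \<in> topspace (cube 1) \<Longrightarrow> q (l' z) = f' z"
      "l' ?o = x0" "l' ?e = \<phi> g' x0" and g': "g' \<in> carrier G"
    using m' unfolding monodromy_def by blast
  obtain h where h: "continuous_map ?Z B h" "\<And>x. h (0, x) = f x" "\<And>x. h (1, x) = f' x"
      "\<And>t x. \<lbrakk>t \<in> {0..1}; x \<in> cube_boundary 1\<rbrakk> \<Longrightarrow> h (t, x) = q x0"
    using hom unfolding homotopic_n_loops_def homotopic_with_def by (auto simp: image_subset_iff)
  have "q x0 = h (0, ?o)"
    using h(4)[of 0 ?o] by (simp add: cube_boundary_1)
  then obtain k where k: "continuous_map ?Z X k" "\<And>z. z \<in> {0..1} \<times> topspace (cube 1) \<Longrightarrow> q (k z) = h z" "k (0, ?o) = x0"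
    using lift_prod_cube[OF h(1) _ x0, of "(0, ?o)"] cube_1_ends(1) by auto
  have vertical: "k (t, x) = k (t', x)" if x: "x \<in> cube_boundary 1" and t: "t \<in> {0..1}" "t' \<in> {0..1}" for x t t'
  proof -
    have xc: "x \<in> topspace (cube 1)" using x by (simp add: cube_boundary_def)
    have "continuous_map (top_of_set {0..1}) ?Z (\<lambda>t. (t, x))"
      using xc by (intro continuous_map_pairedI) auto
    then have "continuous_map (top_of_set {0..1}) X (k \<circ> (\<lambda>t. (t, x)))"
      using k(1) continuous_map_compose by blast
    moreover have "connected_space (top_of_set {0..1::real})"
      by (simp add: connected_space_subtopology)
    ultimately have "(k \<circ> (\<lambda>t. (t, x))) t = (k \<circ> (\<lambda>t. (t, x))) t'"
      using t k(2) h(4) x xc by (intro lift_of_constant[where Z = "top_of_set {0..1}" and l = "k \<circ> (\<lambda>t. (t, x))" and b = "q x0"]) auto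
    then show ?thesis by simp
  qed
  have horizontal: "k (t, x) = m x"
    if t: "t \<in> {0..1}" and m: "continuous_map (cube 1) X m" "m ?o = x0"
      "\<And>z. z \<in> topspace (cube 1) \<Longrightarrow> q (m z) = h (t, z)" and x: "x \<in> topspace (cube 1)" for t m x
  proof -
    have "continuous_map (cube 1) ?Z (\<lambda>x. (t, x))"
      using t by (intro continuous_map_pairedI) auto
    then have c: "continuous_map (cube 1) X (k \<circ> (\<lambda>x. (t, x)))"
      using k(1) continuous_map_compose by blast
    have "(k \<circ> (\<lambda>x. (t, x))) x = m x"
    proof (rule unique_lift[OF connected_space_cube c m(1) _ cube_1_ends(1) _ x])
      show "q ((k \<circ> Pair t) z) = q (m z)" if "z \<in> topspace (cube 1)" for z
        using that t k(2) m(3) by simp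
      show "(k \<circ> Pair t) ?o = m ?o"
        using vertical[of ?o t 0] t m(2) k(3) by (simp add: cube_boundary_1)
    qed
    then show ?thesis by simp
  qed
  have "\<phi> g x0 = k (0, ?e)"
    using horizontal[of 0 l ?e] l h(2) cube_1_ends by simp
  also have "\<dots> = k (1, ?e)"
    using vertical[of ?e 0 1] by (simp add: cube_boundary_1)
  also have "\<dots> = \<phi> g' x0"
    using horizontal[of 1 l' ?e] l' h(3) cube_1_ends by simp
  finally show ?thesis
    using act_cancel g g' x0 by blast
qed

text \<open>The two lifts have the same end points in a contractible space, so they are homotopic relative to
  them; project this homotopy.\<close>

lemma monodromy_inj:
  assumes X: "contractible_space X" and x0: "x0 \<in> topspace X"
    and m: "monodromy x0 f g" and m': "monodromy x0 f' g"
  shows "homotopic_n_loops 1 B (q x0) f f'"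
proof -
  let ?o = "\<lambda>i. 0 :: real" and ?e = "unit_vec 1"
  obtain l where l: "continuous_map (cube 1) X l" "\<And>z. z \<in> topspace (cube 1) \<Longrightarrow> q (l z) = f z"
      "l ?o = x0" "l ?e = \<phi> g x0" and g: "g \<in> carrier G"
    using m unfolding monodromy_def by blast
  obtain l' where l': "continuous_map (cube 1) X l'" "\<And>z. z \<in> topspace (cube 1) \<Longrightarrow> q (l' z) = f' z"
      "l' ?o = x0" "l' ?e = \<phi> g x0" and g': "g \<in> carrier G"
    using m' unfolding monodromy_def by blast
  have "homotopic_with (\<lambda>h. \<forall>x\<in>cube_boundary 1. h x = l x) (cube 1) X l l'"
  proof (rule homotopic_rel_boundary[OF X l(1) l'(1)])
    fix s :: real and x assume s: "s \<in> {0..1}" and x: "x \<in> cube_boundary 1"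
    show "l (cube_expand 1 s x) = l x"
      by (simp add: cube_expand_boundary_1[OF x s])
    show "l' (cube_expand 1 s x) = l x"
      unfolding cube_expand_boundary_1[OF x s] using x l(3,4) l'(3,4) by (auto simp: cube_boundary_1)
  qed
  then have "homotopic_n_loops 1 B (q x0) (q \<circ> l) (q \<circ> l')"
    unfolding homotopic_n_loops_def
  proof (rule homotopic_with_compose_continuous_map_left[OF _ continuous_map_q])
    fix j assume "\<forall>x\<in>cube_boundary 1. j x = l x"
    then show "(q \<circ> j) ` cube_boundary 1 \<subseteq> {q x0}"
      using l(3,4) q_act[OF g x0] by (auto simp: cube_boundary_1)
  qed
  then show ?thesis
    by (rule homotopic_n_loops_cong) (simp_all add: l(2) l'(2))
qed

lemma monodromy_surj:
  assumes X: "contractible_space X" and x0: "x0 \<in> topspace X" and g: "g \<in> carrier G"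
  obtains f where "monodromy x0 f g"
proof -
  have "path_component_of X x0 (\<phi> g x0)"
    using contractible_imp_path_connected_space[OF X] x0 act_closed[OF g x0]
    by (simp add: path_connected_space_iff_path_component)
  then obtain p where p: "continuous_map (top_of_set {0..1::real}) X p" "p 0 = x0" "p 1 = \<phi> g x0"
    unfolding path_component_of_def pathin_def by blast
  have "continuous_map (cube 1) (top_of_set {0..1}) (\<lambda>x. x 0)"
    unfolding cube_eq by (auto simp: box_set_def unit_vec_def intro!: continuous_intros dest!: spec[of _ 0])
  then have "continuous_map (cube 1) X (p \<circ> (\<lambda>x. x 0))"
    using p(1) continuous_map_compose by blast
  then have "monodromy x0 (q \<circ> (p \<circ> (\<lambda>x. x 0))) g"
    unfolding monodromy_def using g p(2,3)
    by (intro conjI exI[of _ "p \<circ> (\<lambda>x. x 0)"]) (auto simp: unit_vec_def)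
  then show thesis by (rule that)
qed

text \<open>The lift of \<open>f\<close> is continued by the \<open>g\<close>-translate of the lift of \<open>f'\<close>, which is why the product comes in
  this order.\<close>

lemma monodromy_concat:
  assumes x0: "x0 \<in> topspace X" and m: "monodromy x0 f g" and m': "monodromy x0 f' g'"
  shows "monodromy x0 (concat_n_loops f f') (g \<otimes> g')"
proof -
  interpret group G by (rule group_G)
  let ?o = "\<lambda>i. 0 :: real" and ?e = "unit_vec 1"
  obtain l where l: "continuous_map (cube 1) X l" "\<And>z. z \<in> topspace (cube 1) \<Longrightarrow> q (l z) = f z"
      "l ?o = x0" "l ?e = \<phi> g x0" and g: "g \<in> carrier G"
    using m unfolding monodromy_def by blast
  obtain l' where l': "continuous_map (cube 1) X l'" "\<And>z. z \<in> topspace (cube 1) \<Longrightarrow> q (l' z) = f' z"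
      "l' ?o = x0" "l' ?e = \<phi> g' x0" and g': "g' \<in> carrier G"
    using m' unfolding monodromy_def by blast
  let ?a = "\<lambda>x :: nat \<Rightarrow> real. x(0 := 2 * x 0)" and ?b = "\<lambda>x :: nat \<Rightarrow> real. x(0 := 2 * x 0 - 1)"
  let ?L = "\<lambda>x. if x 0 \<le> 1/2 then l (?a x) else \<phi> g (l' (?b x))"
  have ab: "continuous_on S ?a" "continuous_on S ?b" for S
  proof -
    show "continuous_on S ?a"
    proof (rule continuous_on_coordinatewise_then_product)
      fix i show "continuous_on S (\<lambda>x. ?a x i)"
        by (cases "i = 0") (auto intro!: continuous_intros)
    qed
    show "continuous_on S ?b"
    proof (rule continuous_on_coordinatewise_then_product)
      fix i show "continuous_on S (\<lambda>x. ?b x i)"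
        by (cases "i = 0") (auto intro!: continuous_intros)
    qed
  qed
  have a_in: "?a x \<in> topspace (cube 1)" if "x \<in> topspace (cube 1)" "x 0 \<le> 1/2" for x
    using that by (auto simp: topspace_cube)
  have b_in: "?b x \<in> topspace (cube 1)" if "x \<in> topspace (cube 1)" "x 0 \<ge> 1/2" for x
    using that by (auto simp: topspace_cube)
  have part: "continuous_map (subtopology (cube 1) T) X (m \<circ> c)"
    if "continuous_on UNIV c" "\<And>x. x \<in> topspace (cube 1) \<Longrightarrow> x \<in> T \<Longrightarrow> c x \<in> topspace (cube 1)"
      "continuous_map (cube 1) X m" for T c m
  proof (rule continuous_map_compose[OF _ that(3)])
    show "continuous_map (subtopology (cube 1) T) (cube 1) c"
      using that(2) continuous_on_subset[OF that(1)]
      by (auto simp: cube_eq subtopology_subtopology image_subset_iff)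
  qed
  have "continuous_map (cube 1) X ?L"
  proof (rule continuous_map_cases_le)
    show "continuous_map (cube 1) euclideanreal (\<lambda>x. x 0)"
      unfolding cube_eq by (simp add: continuous_intros)
    show "continuous_map (subtopology (cube 1) {x \<in> topspace (cube 1). x 0 \<le> 1/2}) X (\<lambda>x. l (?a x))"
      by (rule part[unfolded o_def, OF ab(1) _ l(1)]) (use a_in in auto)
    show "continuous_map (subtopology (cube 1) {x \<in> topspace (cube 1). 1/2 \<le> x 0}) X (\<lambda>x. \<phi> g (l' (?b x)))"
      by (rule part[unfolded o_def, OF ab(2) _ continuous_map_compose[OF l'(1) continuous_action[OF g], unfolded o_def]])
        (use b_in in auto)
    show "l (?a x) = \<phi> g (l' (?b x))" if x: "x \<in> topspace (cube 1)" "x 0 = 1/2" for x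
    proof -
      have "x i = 0" if "i \<noteq> 0" for i
        using x that by (simp add: topspace_cube)
      then have "?a x = ?e" "?b x = ?o"
        using x(2) by (auto simp: unit_vec_def)
      then show ?thesis
        using l(4) l'(3) by simp
    qed
  qed simp
  moreover have "q (?L x) = concat_n_loops f f' x" if x: "x \<in> topspace (cube 1)" for x
  proof (cases "x 0 \<le> 1/2")
    case True
    then show ?thesis
      using l(2) a_in[OF x] by (simp add: concat_n_loops_def)
  next
    case False
    then have "?b x \<in> topspace (cube 1)" using b_in[OF x] by simp
    moreover from this have "l' (?b x) \<in> topspace X"
      using l'(1) unfolding continuous_map_def by blast
    ultimately show ?thesis
      using False l'(2) q_act[OF g] by (simp add: concat_n_loops_def)
  qed
  moreover have "?L ?o = x0"
    using l(3) by (simp add: fun_upd_idem)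
  moreover have "?L ?e = \<phi> (g \<otimes> g') x0"
  proof -
    have "?b ?e = ?e" by (auto simp: unit_vec_def)
    then show ?thesis
      using l'(4) composition_rule[OF x0 g g'] by (simp add: unit_vec_def[of 1])
  qed
  ultimately show ?thesis
    unfolding monodromy_def using g g' by blast
qed

proposition fundamental_group_orbit_space:
  assumes X: "contractible_space X" and x0: "x0 \<in> topspace X"
  shows "homotopy_group 1 B (q x0) \<cong> G"
proof -
  let ?H = "homotopy_group 1 B (q x0)"
  let ?cl = "\<lambda>f. {f'. homotopic_n_loops 1 B (q x0) f f'}"
  define \<Psi> where "\<Psi> A = (SOME g. \<exists>f\<in>A. monodromy x0 f g)" for A
  have \<Psi>: "\<Psi> (?cl f) = g" if "monodromy x0 f g" for f g
    unfolding \<Psi>_def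
  proof (rule some_equality)
    show "\<exists>f'\<in>?cl f. monodromy x0 f' g"
      using that monodromy_loop[OF x0 that]
      by (intro bexI[of _ f]) (simp_all add: homotopic_n_loops_refl)
    show "g' = g" if g': "\<exists>f'\<in>?cl f. monodromy x0 f' g'" for g'
    proof -
      obtain f' where "homotopic_n_loops 1 B (q x0) f f'" "monodromy x0 f' g'"
        using g' by auto
      then show ?thesis
        using monodromy_homotopic[OF x0 _ \<open>monodromy x0 f g\<close>] by simp
    qed
  qed
  have carrierE: "\<exists>f g. A = ?cl f \<and> monodromy x0 f g" if A: "A \<in> carrier ?H" for A
  proof -
    obtain f where "f \<in> n_loops 1 B (q x0)" "A = ?cl f"
      using A by (auto simp: homotopy_group_def)
    then show ?thesis
      using monodromy_exists[OF x0] by metis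
  qed
  have carrierI: "?cl f \<in> carrier ?H" if "monodromy x0 f g" for f g
    using monodromy_loop[OF x0 that] by (auto simp: homotopy_group_def)
  have mult: "?cl f \<otimes>\<^bsub>?H\<^esub> ?cl f' = ?cl (concat_n_loops f f')"
    if m: "monodromy x0 f g" and m': "monodromy x0 f' g'" for f f' g g'
  proof -
    have same: "monodromy x0 f1 g1" if "f1 \<in> ?cl f2" "monodromy x0 f2 g1" for f1 f2 g1
    proof -
      have "f1 \<in> n_loops 1 B (q x0)"
        using that(1) homotopic_n_loops_in(2) by auto
      then obtain g2 where "monodromy x0 f1 g2"
        using monodromy_exists[OF x0] by blast
      moreover from this have "g1 = g2"
        using monodromy_homotopic[OF x0 _ that(2)] that(1) by simp
      ultimately show ?thesis by simp
    qed
    have cl: "?cl (concat_n_loops f1 f2) = ?cl (concat_n_loops f f')" if "f1 \<in> ?cl f" "f2 \<in> ?cl f'" for f1 f2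
    proof (rule homotopic_n_loops_class)
      show "homotopic_n_loops 1 B (q x0) (concat_n_loops f1 f2) (concat_n_loops f f')"
        using monodromy_inj[OF X x0] monodromy_concat[OF x0 same[OF that(1) m] same[OF that(2) m']]
          monodromy_concat[OF x0 m m'] by simp
    qed
    have ff: "f \<in> ?cl f" "f' \<in> ?cl f'"
      using monodromy_loop[OF x0 m] monodromy_loop[OF x0 m'] by (simp_all add: homotopic_n_loops_refl)
    have "?cl f \<otimes>\<^bsub>?H\<^esub> ?cl f' = (\<Union>f1\<in>?cl f. \<Union>f2\<in>?cl f'. ?cl (concat_n_loops f1 f2))"
      by (auto simp: homotopy_group_def)
    also have "\<dots> = ?cl (concat_n_loops f f')"
      using cl ff by (metis (no_types, lifting) SUP_eq_const empty_iff)
    finally show ?thesis .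
  qed
  have "\<Psi> \<in> hom ?H G"
  proof (rule homI)
    show "\<Psi> A \<in> carrier G" if "A \<in> carrier ?H" for A
      using carrierE[OF that] \<Psi> by (auto simp: monodromy_def)
    show "\<Psi> (A \<otimes>\<^bsub>?H\<^esub> A') = \<Psi> A \<otimes> \<Psi> A'" if A: "A \<in> carrier ?H" "A' \<in> carrier ?H" for A A'
    proof -
      obtain f g where f: "A = ?cl f" "monodromy x0 f g"
        using carrierE[OF A(1)] by blast
      obtain f' g' where f': "A' = ?cl f'" "monodromy x0 f' g'"
        using carrierE[OF A(2)] by blast
      show ?thesis
        unfolding f(1) f'(1) mult[OF f(2) f'(2)] \<Psi>[OF f(2)] \<Psi>[OF f'(2)]
        by (rule \<Psi>[OF monodromy_concat[OF x0 f(2) f'(2)]])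
    qed
  qed
  moreover have "bij_betw \<Psi> (carrier ?H) (carrier G)"
  proof (rule bij_betw_imageI)
    show "inj_on \<Psi> (carrier ?H)"
    proof (rule inj_onI)
      fix A A' assume A: "A \<in> carrier ?H" "A' \<in> carrier ?H" "\<Psi> A = \<Psi> A'"
      obtain f g where f: "A = ?cl f" "monodromy x0 f g"
        using carrierE[OF A(1)] by blast
      obtain f' g' where f': "A' = ?cl f'" "monodromy x0 f' g'"
        using carrierE[OF A(2)] by blast
      have "g = g'"
        using A(3) unfolding f(1) f'(1) \<Psi>[OF f(2)] \<Psi>[OF f'(2)] .
      then show "A = A'"
        unfolding f(1) f'(1) using monodromy_inj[OF X x0 f(2)] f'(2)
        by (intro homotopic_n_loops_class) simp
    qed
    show "\<Psi> ` carrier ?H = carrier G"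
    proof (intro antisym subsetI)
      fix g assume "g \<in> \<Psi> ` carrier ?H"
      then show "g \<in> carrier G"
        using \<open>\<Psi> \<in> hom ?H G\<close> by (auto simp: hom_def)
    next
      fix g assume "g \<in> carrier G"
      then obtain f where "monodromy x0 f g"
        using monodromy_surj[OF X x0] by blast
      then show "g \<in> \<Psi> ` carrier ?H"
        using \<Psi>[of f g] carrierI[of f g] by (intro image_eqI[of g \<Psi> "?cl f"]) simp_all
    qed
  qed
  ultimately show ?thesis
    unfolding is_iso_def iso_def by blast
qed

theorem Eilenberg_MacLane_orbit_space:
  assumes X: "contractible_space X" and ne: "topspace X \<noteq> {}"
  shows "Eilenberg_MacLane_space G 1 B"
  unfolding Eilenberg_MacLane_space_def
proof (intro conjI ballI allI impI)
  show "topspace B \<noteq> {}"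
    using ne topspace_B by simp
  show "path_connected_space B"
    using path_connected_space_quotient_map_image[OF quotient_map_q] contractible_imp_path_connected_space[OF X] by blast
  fix b assume "b \<in> topspace B"
  then obtain x0 where x0: "x0 \<in> topspace X" "b = q x0"
    using topspace_B by auto
  show "homotopy_group 1 B b \<cong> G"
    using fundamental_group_orbit_space[OF X] x0 by simp
  fix k :: nat assume "1 \<le> k \<and> k \<noteq> 1"
  then have k: "2 \<le> k" by simp
  have const: "(\<lambda>x. b) \<in> n_loops k B b"
    using \<open>b \<in> topspace B\<close> by (auto simp: n_loops_def)
  have cl: "{g. homotopic_n_loops k B b f g} = {g. homotopic_n_loops k B b (\<lambda>x. b) g}"
    if "f \<in> n_loops k B b" for f
  proof (rule homotopic_n_loops_class)
    show "homotopic_n_loops k B b f (\<lambda>x. b)"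
      using higher_loops_null_homotopic[OF X x0(1) k] that unfolding x0(2) by simp
  qed
  have "carrier (homotopy_group k B b) = (\<lambda>f. {g. homotopic_n_loops k B b f g}) ` n_loops k B b"
    by (auto simp: homotopy_group_def)
  also have "\<dots> = (\<lambda>f. {g. homotopic_n_loops k B b (\<lambda>x. b) g}) ` n_loops k B b"
    by (rule image_cong[OF refl cl])
  also have "\<dots> = {{g. homotopic_n_loops k B b (\<lambda>x. b) g}}"
    using const by (subst image_constant) simp_all
  finally show "carrier (homotopy_group k B b) = {\<one>\<^bsub>homotopy_group k B b\<^esub>}"
    by (simp add: homotopy_group_def)
qed

end

declare One_nat_def [simp]


section \<open>Locally finite simplicial complexes\<close>

definition support :: "('v \<Rightarrow> real) \<Rightarrow> 'v set"
  where "support \<alpha> = {v. \<alpha> v \<noteq> 0}"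

definition simplicial_points :: "'v set set \<Rightarrow> ('v \<Rightarrow> real) set"
  where "simplicial_points K = (\<Union>s\<in>K. closed_simplex s)"

lemma support_closed_simplex:
  assumes "\<alpha> \<in> closed_simplex s"
  shows "support \<alpha> \<subseteq> s" "support \<alpha> \<noteq> {}"
proof -
  show "support \<alpha> \<subseteq> s"
    using assms by (auto simp: support_def closed_simplex_def)
  have "(\<Sum>v\<in>s. \<alpha> v) \<noteq> 0"
    using assms by (simp add: closed_simplex_def)
  then show "support \<alpha> \<noteq> {}"
    by (metis (mono_tags, lifting) empty_iff mem_Collect_eq sum.neutral support_def)
qed

lemma closed_simplex_iff:
  assumes "finite s"
  shows "\<alpha> \<in> closed_simplex s \<longleftrightarrow> (\<forall>v. 0 \<le> \<alpha> v) \<and> support \<alpha> \<subseteq> s \<and> sum \<alpha> (support \<alpha>) = 1"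
proof -
  have "sum \<alpha> s = sum \<alpha> (support \<alpha>)" if "support \<alpha> \<subseteq> s"
    using assms that by (intro sum.mono_neutral_right) (auto simp: support_def)
  moreover have "support \<alpha> \<subseteq> s \<longleftrightarrow> (\<forall>v. v \<notin> s \<longrightarrow> \<alpha> v = 0)"
    by (auto simp: support_def)
  ultimately show ?thesis
    unfolding closed_simplex_def by auto
qed

lemma open_simplex_iff:
  assumes "finite s"
  shows "\<alpha> \<in> open_simplex s \<longleftrightarrow> (\<forall>v. 0 \<le> \<alpha> v) \<and> support \<alpha> = s \<and> sum \<alpha> (support \<alpha>) = 1"
  unfolding open_simplex_def using closed_simplex_iff[OF assms]
  by (auto simp: support_def less_le subset_iff)

lemma closed_closed_simplex:
  assumes "finite s" shows "closed (closed_simplex s)"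
proof -
  have "closed_simplex s = (\<Inter>v. {\<alpha>. 0 \<le> \<alpha> v}) \<inter> (\<Inter>v\<in>-s. {\<alpha>. \<alpha> v = 0}) \<inter> {\<alpha>. (\<Sum>v\<in>s. \<alpha> v) = 1}"
    by (auto simp: closed_simplex_def)
  then show ?thesis
    by (auto intro!: closed_INT closed_Int closed_Collect_le closed_Collect_eq continuous_intros)
qed

locale locally_finite_complex =
  fixes K :: "'v set set"
  assumes complex: "abstract_simplicial_complex K"
    and locally_finite: "finite {s \<in> K. v \<in> s}"
begin

lemma simplex_finite: "s \<in> K \<Longrightarrow> finite s"
  using complex by (simp add: abstract_simplicial_complex_def)

lemma simplex_nonempty: "s \<in> K \<Longrightarrow> s \<noteq> {}"
  using complex by (simp add: abstract_simplicial_complex_def)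

lemma simplex_face: "\<lbrakk>s \<in> K; t \<subseteq> s; t \<noteq> {}\<rbrakk> \<Longrightarrow> t \<in> K"
  using complex unfolding abstract_simplicial_complex_def by blast

lemma simplicial_points_iff:
  "\<alpha> \<in> simplicial_points K \<longleftrightarrow> (\<forall>v. 0 \<le> \<alpha> v) \<and> support \<alpha> \<in> K \<and> sum \<alpha> (support \<alpha>) = 1"
proof
  assume "\<alpha> \<in> simplicial_points K"
  then obtain s where s: "s \<in> K" "\<alpha> \<in> closed_simplex s"
    by (auto simp: simplicial_points_def)
  then show "(\<forall>v. 0 \<le> \<alpha> v) \<and> support \<alpha> \<in> K \<and> sum \<alpha> (support \<alpha>) = 1"
    using closed_simplex_iff[OF simplex_finite[OF s(1)]] support_closed_simplex simplex_face by metis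
next
  assume "(\<forall>v. 0 \<le> \<alpha> v) \<and> support \<alpha> \<in> K \<and> sum \<alpha> (support \<alpha>) = 1"
  then show "\<alpha> \<in> simplicial_points K"
    using closed_simplex_iff simplex_finite unfolding simplicial_points_def by blast
qed

lemma simplicial_pointsD:
  assumes "\<alpha> \<in> simplicial_points K"
  shows "0 \<le> \<alpha> v" "support \<alpha> \<in> K" "sum \<alpha> (support \<alpha>) = 1" "finite (support \<alpha>)" "support \<alpha> \<noteq> {}"
  using assms simplex_finite simplex_nonempty by (auto simp: simplicial_points_iff)

lemma open_simplex_simplicial_points:
  "s \<in> K \<Longrightarrow> \<alpha> \<in> open_simplex s \<longleftrightarrow> \<alpha> \<in> simplicial_points K \<and> support \<alpha> = s"
  using open_simplex_iff[OF simplex_finite] by (auto simp: simplicial_points_iff)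

lemma in_open_simplex_support: "\<alpha> \<in> simplicial_points K \<Longrightarrow> \<alpha> \<in> open_simplex (support \<alpha>)"
  using open_simplex_simplicial_points simplicial_pointsD(2) by blast

text \<open>The vertex itself is included whenever it belongs to the complex.\<close>

definition neighbours :: "'v \<Rightarrow> 'v set"
  where "neighbours v = \<Union>{s \<in> K. v \<in> s}"

lemma finite_neighbours: "finite (neighbours v)"
  unfolding neighbours_def using locally_finite simplex_finite by (intro finite_Union) auto

lemma support_neighbours:
  assumes "\<alpha> \<in> simplicial_points K" "\<alpha> v \<noteq> 0" shows "support \<alpha> \<subseteq> neighbours v"
  using simplicial_pointsD(2)[OF assms(1)] assms(2) by (auto simp: neighbours_def support_def)

text \<open>Local finiteness makes the weak topology the topology of pointwise convergence of
  barycentric coordinates: the points at which one coordinate \<open>v\<close> is positive lie in the finitely many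
  simplices around \<open>v\<close>.\<close>

lemma realization_eq: "realization K = top_of_set (simplicial_points K)"
  unfolding topology_eq
proof (intro allI iffI)
  fix U assume "openin (realization K) U"
  then have sub: "U \<subseteq> simplicial_points K"
    and op: "\<And>s. s \<in> K \<Longrightarrow> \<exists>O'. open O' \<and> U \<inter> closed_simplex s = closed_simplex s \<inter> O'"
    by (auto simp: openin_realization simplicial_points_def openin_open)
  obtain W where W: "\<And>s. s \<in> K \<Longrightarrow> open (W s)" "\<And>s. s \<in> K \<Longrightarrow> U \<inter> closed_simplex s = closed_simplex s \<inter> W s"
    using op by metis
  show "openin (top_of_set (simplicial_points K)) U"
  proof (subst openin_subopen, intro ballI)
    fix \<alpha> assume \<alpha>: "\<alpha> \<in> U"
    then have ap: "\<alpha> \<in> simplicial_points K" using sub by auto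
    then obtain v where v: "\<alpha> v > 0"
      using simplicial_pointsD[OF ap] by (metis (mono_tags, lifting) ex_in_conv less_le mem_Collect_eq support_def)
    define N where "N s = (if \<alpha> \<in> closed_simplex s then W s else - closed_simplex s)" for s
    have N: "open (N s)" "\<alpha> \<in> N s" if "s \<in> K" for s
      using W[OF that] \<alpha> closed_closed_simplex[OF simplex_finite[OF that]] by (auto simp: N_def)
    let ?T = "simplicial_points K \<inter> ({\<gamma>. \<gamma> v > 0} \<inter> (\<Inter>s\<in>{s \<in> K. v \<in> s}. N s))"
    have "open ({\<gamma> :: 'v \<Rightarrow> real. \<gamma> v > 0} \<inter> (\<Inter>s\<in>{s \<in> K. v \<in> s}. N s))"
      using locally_finite N by (intro open_Int open_INT open_Collect_less continuous_intros) auto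
    then have "openin (top_of_set (simplicial_points K)) ?T"
      by (auto simp: openin_open)
    moreover have "\<alpha> \<in> ?T"
      using ap v N by auto
    moreover have "?T \<subseteq> U"
    proof
      fix \<gamma> assume g: "\<gamma> \<in> ?T"
      let ?s = "support \<gamma>"
      have s: "?s \<in> K" "v \<in> ?s" "\<gamma> \<in> closed_simplex ?s"
        using g simplicial_pointsD[of \<gamma>] by (auto simp: support_def simplicial_points_iff closed_simplex_iff)
      then have "\<gamma> \<in> N ?s" using g by auto
      then show "\<gamma> \<in> U"
        using s W(2)[OF s(1)] by (auto simp: N_def split: if_splits)
    qed
    ultimately show "\<exists>T. openin (top_of_set (simplicial_points K)) T \<and> \<alpha> \<in> T \<and> T \<subseteq> U" by blast
  qed
next
  fix U assume "openin (top_of_set (simplicial_points K)) U"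
  then obtain W where W: "open W" "U = simplicial_points K \<inter> W"
    by (auto simp: openin_open)
  have "U \<inter> closed_simplex s = closed_simplex s \<inter> W" if "s \<in> K" for s
    using that W(2) by (auto simp: simplicial_points_def)
  then show "openin (realization K) U"
    unfolding openin_realization using W by (auto simp: simplicial_points_def openin_open)
qed

lemma topspace_realization_eq: "topspace (realization K) = simplicial_points K"
  by (simp add: realization_eq)

lemma Hausdorff_realization: "Hausdorff_space (realization K)"
proof -
  have "Hausdorff_space (product_topology (\<lambda>v :: 'v. euclideanreal) UNIV)"
    by (simp add: Hausdorff_space_product_topology)
  then show ?thesis
    unfolding realization_eq by (simp add: euclidean_product_topology Hausdorff_space_subtopology)
qed

end

section \<open>Discs and simplices\<close>

lemma continuous_on_Max_finite:
  fixes f :: "'i \<Rightarrow> 'a::topological_space \<Rightarrow> real"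
  assumes "finite I" "I \<noteq> {}" "\<And>i. i \<in> I \<Longrightarrow> continuous_on S (f i)"
  shows "continuous_on S (\<lambda>x. Max ((\<lambda>i. f i x) ` I))"
  using assms
proof (induction I rule: finite_ne_induct)
  case (insert i I)
  then have "continuous_on S (\<lambda>x. max (f i x) (Max ((\<lambda>i. f i x) ` I)))"
    by (intro continuous_on_max) auto
  moreover have "Max ((\<lambda>i. f i x) ` insert i I) = max (f i x) (Max ((\<lambda>i. f i x) ` I))" for x
    using insert by simp
  ultimately show ?case by simp
qed simp

definition coordinate_space :: "nat \<Rightarrow> (nat \<Rightarrow> real) set"
  where "coordinate_space n = {x. \<forall>i\<ge>n. x i = 0}"

text \<open>A gauge is a continuous nonnegative homogeneous function vanishing at the origin only, here
  normalized so as to dominate the coordinates.\<close>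

definition gauge_on :: "nat \<Rightarrow> ((nat \<Rightarrow> real) \<Rightarrow> real) \<Rightarrow> bool"
  where "gauge_on n p \<longleftrightarrow> continuous_on UNIV p \<and>
    (\<forall>x\<in>coordinate_space n. \<forall>i. \<bar>x i\<bar> \<le> p x) \<and>
    (\<forall>x\<in>coordinate_space n. \<forall>c\<ge>0. p (\<lambda>i. c * x i) = c * p x)"

text \<open>Rescaling along rays, which carries the unit ball of \<open>p\<close> onto the unit ball of \<open>q\<close>.\<close>

definition rescale :: "((nat \<Rightarrow> real) \<Rightarrow> real) \<Rightarrow> ((nat \<Rightarrow> real) \<Rightarrow> real) \<Rightarrow> (nat \<Rightarrow> real) \<Rightarrow> nat \<Rightarrow> real"
  where "rescale p q x = (\<lambda>i. p x / q x * x i)"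

lemma gauge_nonneg: "gauge_on n p \<Longrightarrow> x \<in> coordinate_space n \<Longrightarrow> 0 \<le> p x"
  unfolding gauge_on_def by (meson abs_ge_zero order_trans)

lemma gauge_scale: "gauge_on n p \<Longrightarrow> x \<in> coordinate_space n \<Longrightarrow> 0 \<le> c \<Longrightarrow> p (\<lambda>i. c * x i) = c * p x"
  unfolding gauge_on_def by blast

lemma gauge_zero:
  assumes "gauge_on n p" shows "p (\<lambda>i. 0) = 0"
proof -
  have z: "(\<lambda>i. 0) \<in> coordinate_space n" by (simp add: coordinate_space_def)
  have "p (\<lambda>i. 0 * (0 :: real)) = 0 * p (\<lambda>i. 0)"
    by (rule gauge_scale[OF assms z order_refl])
  then show ?thesis by simp
qed

lemma gauge_eq_0:
  assumes "gauge_on n p" "x \<in> coordinate_space n"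
  shows "p x = 0 \<longleftrightarrow> x = (\<lambda>i. 0)"
proof
  assume "p x = 0"
  then have "\<bar>x i\<bar> \<le> 0" for i
    using assms unfolding gauge_on_def by metis
  then show "x = (\<lambda>i. 0)" by auto
qed (use gauge_zero[OF assms(1)] in simp)

lemma rescale_in: "x \<in> coordinate_space n \<Longrightarrow> rescale p q x \<in> coordinate_space n"
  by (simp add: rescale_def coordinate_space_def)

lemma gauge_rescale:
  assumes p: "gauge_on n p" and q: "gauge_on n q" and x: "x \<in> coordinate_space n"
  shows "q (rescale p q x) = p x"
proof -
  have "0 \<le> p x / q x"
    using gauge_nonneg p q x by simp
  then have "q (rescale p q x) = p x / q x * q x"
    using q x unfolding gauge_on_def rescale_def by blast
  then show ?thesis
    using gauge_eq_0[OF q x] gauge_zero[OF p] by auto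
qed

lemma rescale_rescale:
  assumes p: "gauge_on n p" and q: "gauge_on n q" and x: "x \<in> coordinate_space n"
  shows "rescale q p (rescale p q x) = x"
proof (cases "x = (\<lambda>i. 0)")
  case False
  then have nz: "p x \<noteq> 0" "q x \<noteq> 0"
    using gauge_eq_0 p q x by blast+
  have "0 \<le> p x / q x"
    using gauge_nonneg p q x by simp
  then have "p (rescale p q x) = p x / q x * p x"
    using p x unfolding gauge_on_def rescale_def by blast
  then show ?thesis
    using nz gauge_rescale[OF p q x] by (auto simp: rescale_def[of q] rescale_def[of p q] field_simps)
qed (simp add: rescale_def)

text \<open>Only the origin needs an argument: as \<open>q\<close> dominates the coordinates, those of the image are bounded
  by \<open>p\<close>, which tends to \<open>0\<close>.\<close>

lemma continuous_rescale:
  assumes p: "gauge_on n p" and q: "gauge_on n q"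
  shows "continuous_on (coordinate_space n) (rescale p q)"
proof (rule continuous_on_coordinatewise_then_product)
  fix i
  have pc: "continuous_on S p" and qc: "continuous_on S q" for S
    using p q continuous_on_subset unfolding gauge_on_def by blast+
  have "continuous (at x within coordinate_space n) (\<lambda>x. rescale p q x i)" if x: "x \<in> coordinate_space n" for x
  proof (cases "q x = 0")
    case False
    have "isCont p x" "isCont q x"
      using pc[of UNIV] qc[of UNIV] by (auto simp: continuous_on_eq_continuous_at)
    moreover have "isCont (\<lambda>x :: nat \<Rightarrow> real. x i) x"
      using continuous_on_coordinate[of UNIV i] by (metis UNIV_I continuous_on_eq_continuous_at open_UNIV)
    ultimately have "isCont (\<lambda>x. rescale p q x i) x"
      unfolding rescale_def using False by (intro continuous_intros) auto
    then show ?thesis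
      by (rule continuous_at_imp_continuous_at_within)
  next
    case True
    then have x0: "x = (\<lambda>i. 0)"
      using gauge_eq_0[OF q x] by simp
    have bound: "norm (rescale p q y i) \<le> p y" if y: "y \<in> coordinate_space n" for y
    proof -
      have "\<bar>y i\<bar> \<le> q y" "0 \<le> p y" "0 \<le> q y"
        using q y gauge_nonneg[OF p y] gauge_nonneg[OF q y] unfolding gauge_on_def by auto
      then have "p y / q y * \<bar>y i\<bar> \<le> p y"
        by (cases "q y = 0") (auto simp: field_simps mult_left_mono)
      then show ?thesis
        using \<open>0 \<le> p y\<close> \<open>0 \<le> q y\<close> by (simp add: rescale_def abs_mult)
    qed
    have "(p \<longlongrightarrow> p x) (at x within coordinate_space n)"
      using pc[of UNIV] by (meson UNIV_I continuous_on_def subset_UNIV tendsto_within_subset)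
    then have "(p \<longlongrightarrow> 0) (at x within coordinate_space n)"
      using gauge_zero[OF p] x0 by simp
    moreover have "\<forall>\<^sub>F y in at x within coordinate_space n. norm (rescale p q y i) \<le> p y"
      unfolding eventually_at_filter using bound by (intro always_eventually) blast
    ultimately have "((\<lambda>y. rescale p q y i) \<longlongrightarrow> 0) (at x within coordinate_space n)"
      by (rule Lim_null_comparison[rotated])
    then show ?thesis
      by (simp add: continuous_within x0 rescale_def)
  qed
  then show "continuous_on (coordinate_space n) (\<lambda>x. rescale p q x i)"
    by (simp add: continuous_on_eq_continuous_within)
qed

definition norm_gauge :: "nat \<Rightarrow> (nat \<Rightarrow> real) \<Rightarrow> real"
  where "norm_gauge n x = sqrt (\<Sum>i<n. x i ^ 2)"

lemma gauge_norm_gauge: "gauge_on n (norm_gauge n)"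
  unfolding gauge_on_def
proof (intro conjI ballI allI impI)
  show "continuous_on UNIV (norm_gauge n)"
    unfolding norm_gauge_def by (intro continuous_intros)
  fix x assume x: "x \<in> coordinate_space n"
  show "\<bar>x i\<bar> \<le> norm_gauge n x" for i
  proof (cases "i < n")
    case True
    then have "x i ^ 2 \<le> (\<Sum>i<n. x i ^ 2)"
      by (intro member_le_sum) auto
    then show ?thesis
      unfolding norm_gauge_def by (metis real_sqrt_abs real_sqrt_le_iff)
  next
    case False
    then show ?thesis
      using x by (simp add: coordinate_space_def norm_gauge_def sum_nonneg)
  qed
  fix c :: real assume "0 \<le> c"
  then show "norm_gauge n (\<lambda>i. c * x i) = c * norm_gauge n x"
    by (simp add: norm_gauge_def power_mult_distrib real_sqrt_mult flip: sum_distrib_left)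
qed

lemma closed_disc_eq: "closed_disc n = top_of_set {x \<in> coordinate_space n. norm_gauge n x \<le> 1}"
proof -
  have "{x. \<forall>i\<ge>n. x i = 0} \<inter> {x. (\<Sum>i<n. x i ^ 2) \<le> 1} = {x \<in> coordinate_space n. norm_gauge n x \<le> (1::real)}"
    by (auto simp: coordinate_space_def norm_gauge_def)
  then show ?thesis
    by (simp add: closed_disc_def Euclidean_space_eq subtopology_subtopology)
qed

lemma open_disc_eq: "open_disc n = top_of_set {x \<in> coordinate_space n. norm_gauge n x < 1}"
proof -
  have "{x. \<forall>i\<ge>n. x i = 0} \<inter> {x. (\<Sum>i<n. x i ^ 2) < 1} = {x \<in> coordinate_space n. norm_gauge n x < (1::real)}"
    by (auto simp: coordinate_space_def norm_gauge_def)
  then show ?thesis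
    by (simp add: open_disc_def Euclidean_space_eq subtopology_subtopology)
qed

text \<open>The barycentre of a simplex is put at the origin; \<open>centred\<close> gives the excess of the
  barycentric coordinates over \<open>1 / Suc n\<close> in terms of the first \<open>n\<close> of them.\<close>

definition centred :: "('v \<Rightarrow> nat) \<Rightarrow> nat \<Rightarrow> (nat \<Rightarrow> real) \<Rightarrow> 'v \<Rightarrow> real"
  where "centred d n y v = (if d v < n then y (d v) else - (\<Sum>j<n. y j))"

definition simplex_gauge :: "('v \<Rightarrow> nat) \<Rightarrow> 'v set \<Rightarrow> nat \<Rightarrow> (nat \<Rightarrow> real) \<Rightarrow> real"
  where "simplex_gauge d s n y = Max ((\<lambda>v. - (real (Suc n) * centred d n y v)) ` s)"

lemma sum_centred:
  assumes d: "bij_betw d s {..<Suc n}"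
  shows "(\<Sum>v\<in>s. centred d n y v) = 0"
proof -
  have "(\<Sum>v\<in>s. centred d n y v) = (\<Sum>i<Suc n. if i < n then y i else - (\<Sum>j<n. y j))"
    unfolding centred_def using sum.reindex_bij_betw[OF d, of "\<lambda>i. if i < n then y i else - (\<Sum>j<n. y j)"] by simp
  then show ?thesis by simp
qed

text \<open>The gauge bounds the centred coordinates from below. As they sum to \<open>0\<close>, this also bounds each of them
  from above.\<close>

lemma gauge_simplex_gauge:
  assumes d: "bij_betw d s {..<Suc n}"
  shows "gauge_on n (simplex_gauge d s n)"
proof -
  have fin: "finite s" "s \<noteq> {}" and card: "card s = Suc n"
    using d bij_betw_finite bij_betw_same_card[OF d] by (auto simp: bij_betw_def)
  have ge: "- (real (Suc n) * centred d n y v) \<le> simplex_gauge d s n y" if "v \<in> s" for y v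
    unfolding simplex_gauge_def using fin that by (intro Max_ge) auto
  have nonneg: "0 \<le> simplex_gauge d s n y" for y
  proof (rule ccontr)
    assume neg: "\<not> ?thesis"
    have "0 < centred d n y v" if "v \<in> s" for v
    proof -
      have "- (real (Suc n) * centred d n y v) < 0"
        using ge[OF that, of y] neg by linarith
      then show ?thesis by (simp add: zero_less_mult_iff)
    qed
    then have "0 < (\<Sum>v\<in>s. centred d n y v)"
      using fin by (intro sum_pos) auto
    then show False
      using sum_centred[OF d] by simp
  qed
  show ?thesis
    unfolding gauge_on_def
  proof (intro conjI ballI allI impI)
    have "continuous_on UNIV (\<lambda>y. centred d n y v)" for v
      unfolding centred_def by (cases "d v < n") (auto intro!: continuous_intros)
    then show "continuous_on UNIV (simplex_gauge d s n)"
      unfolding simplex_gauge_def using fin by (intro continuous_on_Max_finite continuous_intros) auto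
    fix x assume x: "x \<in> coordinate_space n"
    let ?m = "simplex_gauge d s n x"
    show "\<bar>x i\<bar> \<le> ?m" for i
    proof (cases "i < n")
      case True
      then have "i \<in> d ` s"
        using d by (auto simp: bij_betw_def)
      then obtain v where v: "v \<in> s" "d v = i" by auto
      then have xi: "x i = centred d n x v"
        using True by (simp add: centred_def)
      have low: "- ?m \<le> real (Suc n) * centred d n x w" if "w \<in> s" for w
        using ge[OF that, of x] by linarith
      have rest: "(\<Sum>w\<in>s - {v}. real (Suc n) * centred d n x w) = - (real (Suc n) * x i)"
        using sum_centred[OF d, of x] fin v(1) xi
        by (simp add: sum.remove[of s v] flip: sum_distrib_left) (simp add: add_eq_0_iff2)
      have "real (Suc n) * x i \<le> real n * ?m"
      proof -
        have "(\<Sum>w\<in>s - {v}. - ?m) \<le> (\<Sum>w\<in>s - {v}. real (Suc n) * centred d n x w)"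
          using low by (intro sum_mono) auto
        moreover have "card (s - {v}) = n"
          using fin v card by simp
        ultimately show ?thesis
          using rest by simp
      qed
      also have "\<dots> \<le> real (Suc n) * ?m"
        using nonneg[of x] by (intro mult_right_mono) auto
      finally have "x i \<le> ?m" by simp
      moreover have "- (real (Suc n) * x i) \<le> real (Suc n) * ?m"
      proof -
        have "- (real (Suc n) * x i) \<le> ?m" using ge[OF v(1), of x] xi by simp
        also have "\<dots> \<le> real (Suc n) * ?m"
          using nonneg[of x] by (simp add: algebra_simps)
        finally show ?thesis .
      qed
      then have "real (Suc n) * (- x i) \<le> real (Suc n) * ?m" by simp
      then have "- x i \<le> ?m" by (simp only: mult_le_cancel_left_pos of_nat_0_less_iff zero_less_Suc)
      ultimately show ?thesis by linarith
    next
      case False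
      then show ?thesis using x nonneg[of x] by (simp add: coordinate_space_def)
    qed
    fix c :: real assume c: "0 \<le> c"
    have "centred d n (\<lambda>i. c * x i) v = c * centred d n x v" for v
      by (simp add: centred_def sum_distrib_left)
    then have "simplex_gauge d s n (\<lambda>i. c * x i) = Max ((\<lambda>t. c * t) ` (\<lambda>v. - (real (Suc n) * centred d n x v)) ` s)"
      unfolding simplex_gauge_def image_image by (simp add: algebra_simps)
    also have "\<dots> = c * ?m"
      unfolding simplex_gauge_def using fin c
      by (intro mono_Max_commute[symmetric]) (auto simp: mono_def mult_left_mono)
    finally show "simplex_gauge d s n (\<lambda>i. c * x i) = c * ?m" .
  qed
qed

lemma disc_boundary_eq: "disc_boundary n = {x \<in> coordinate_space n. norm_gauge n x = 1}"
  by (auto simp: disc_boundary_def closed_disc_eq open_disc_eq)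

text \<open>The simplex and the disc are unit balls of two gauges, so they correspond under rescaling.\<close>

proposition simplex_disc:
  assumes fin: "finite s" and card: "card s = Suc n"
  obtains \<Phi> where "continuous_map (closed_disc n) (top_of_set (closed_simplex s)) \<Phi>"
    "homeomorphic_map (open_disc n) (top_of_set (open_simplex s)) \<Phi>"
    "\<Phi> ` disc_boundary n \<subseteq> closed_simplex s - open_simplex s"
proof -
  obtain d where "bij_betw d s {0..<card s}"
    using ex_bij_betw_finite_nat[OF fin] by blast
  then have d: "bij_betw d s {..<Suc n}"
    by (simp add: card lessThan_atLeast0)
  define e where "e = inv_into s d"
  have ed: "e (d v) = v" if "v \<in> s" for v
    using that d by (simp add: e_def bij_betw_inv_into_left)
  have de: "d (e i) = i" "e i \<in> s" if "i < Suc n" for i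
    using that d unfolding e_def by (auto simp: bij_betw_inv_into_right bij_betw_def intro!: inv_into_into)
  have dn: "d v < Suc n" if "v \<in> s" for v
    using that d by (auto simp: bij_betw_def)
  define m where "m = simplex_gauge d s n"
  define N where "N = norm_gauge n"
  have m: "gauge_on n m" and N: "gauge_on n N"
    using gauge_simplex_gauge[OF d] gauge_norm_gauge by (auto simp: m_def N_def)
  define A where "A y = (\<lambda>v. if v \<in> s then 1 / real (Suc n) + centred d n y v else 0)" for y
  define A' where "A' \<alpha> = (\<lambda>i. if i < n then \<alpha> (e i) - 1 / real (Suc n) else 0)" for \<alpha> :: "'a \<Rightarrow> real"
  have ne: "s \<noteq> {}" using card by auto
  have sumA: "(\<Sum>v\<in>s. A y v) = 1" for y
  proof -
    have "(\<Sum>v\<in>s. A y v) = (\<Sum>v\<in>s. 1 / real (Suc n)) + (\<Sum>v\<in>s. centred d n y v)"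
      by (simp add: A_def sum.distrib)
    then show ?thesis
      using sum_centred[OF d] card by simp
  qed
  have scale: "- (real (Suc n) * c) \<le> 1 \<longleftrightarrow> 0 \<le> 1 / real (Suc n) + c"
    "- (real (Suc n) * c) < 1 \<longleftrightarrow> 0 < 1 / real (Suc n) + c" for c
    by (simp_all add: field_simps del: of_nat_Suc) linarith+
  have closed_iff: "A y \<in> closed_simplex s \<longleftrightarrow> m y \<le> 1" for y
  proof -
    have "m y \<le> 1 \<longleftrightarrow> (\<forall>v\<in>s. 0 \<le> A y v)"
      unfolding m_def simplex_gauge_def using fin ne scale(1) by (simp add: A_def del: of_nat_Suc)
    then show ?thesis
      using sumA by (auto simp: closed_simplex_def) (auto simp: A_def)
  qed
  have open_iff: "A y \<in> open_simplex s \<longleftrightarrow> m y < 1" for y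
  proof -
    have "m y < 1 \<longleftrightarrow> (\<forall>v\<in>s. 0 < A y v)"
      unfolding m_def simplex_gauge_def using fin ne scale(2) by (simp add: A_def del: of_nat_Suc)
    then show ?thesis
      using closed_iff[of y] unfolding open_simplex_def by fastforce
  qed
  have A'A: "A' (A y) = y" if "y \<in> coordinate_space n" for y
    using that de by (auto simp: A_def A'_def centred_def coordinate_space_def)
  have AA': "A (A' \<alpha>) = \<alpha>" if \<alpha>: "\<alpha> \<in> closed_simplex s" for \<alpha>
  proof
    fix v
    have sm: "(\<Sum>i<n. \<alpha> (e i)) + \<alpha> (e n) = 1"
    proof -
      have "bij_betw e {..<Suc n} s"
        unfolding e_def by (rule bij_betw_inv_into[OF d])
      then have "(\<Sum>i<Suc n. \<alpha> (e i)) = (\<Sum>v\<in>s. \<alpha> v)"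
        by (rule sum.reindex_bij_betw)
      then show ?thesis using \<alpha> by (simp add: closed_simplex_def)
    qed
    consider "v \<notin> s" | "v \<in> s" "d v < n" | "v \<in> s" "d v = n"
      using dn[of v] by fastforce
    then show "A (A' \<alpha>) v = \<alpha> v"
    proof cases
      case 1 then show ?thesis using \<alpha> by (simp add: A_def closed_simplex_def)
    next
      case 2 then show ?thesis using ed by (simp add: A_def A'_def centred_def)
    next
      case 3
      then have "A (A' \<alpha>) v = 1 / real (Suc n) - (\<Sum>i<n. \<alpha> (e i) - 1 / real (Suc n))"
        by (simp add: A_def A'_def centred_def)
      also have "\<dots> = 1 / real (Suc n) + real n / real (Suc n) - (\<Sum>i<n. \<alpha> (e i))"
        by (simp add: sum_subtractf)
      also have "1 / real (Suc n) + real n / real (Suc n) = 1"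
        by (simp add: field_simps)
      finally show ?thesis using sm ed 3 by force
    qed
  qed
  have A'_in: "A' \<alpha> \<in> coordinate_space n" for \<alpha>
    by (simp add: A'_def coordinate_space_def)
  have cA: "continuous_on S A" for S
    unfolding A_def
  proof (rule continuous_on_coordinatewise_then_product)
    fix v show "continuous_on S (\<lambda>y. if v \<in> s then 1 / real (Suc n) + centred d n y v else 0)"
      unfolding centred_def by (cases "v \<in> s"; cases "d v < n") (auto intro!: continuous_intros)
  qed
  have cA': "continuous_on S A'" for S
    unfolding A'_def
  proof (rule continuous_on_coordinatewise_then_product)
    fix i show "continuous_on S (\<lambda>\<alpha>. if i < n then \<alpha> (e i) - 1 / real (Suc n) else 0)"
      by (cases "i < n") (auto intro!: continuous_intros)
  qed
  define \<Phi> where "\<Phi> x = A (rescale N m x)" for x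
  define \<Psi> where "\<Psi> \<alpha> = rescale m N (A' \<alpha>)" for \<alpha>
  have c\<Phi>: "continuous_on (coordinate_space n) \<Phi>"
    unfolding \<Phi>_def using continuous_on_compose2[OF cA[of UNIV] continuous_rescale[OF N m]] by simp
  have c\<Psi>: "continuous_on UNIV \<Psi>"
    unfolding \<Psi>_def using continuous_on_compose2[OF continuous_rescale[OF m N] cA'[of UNIV]] A'_in by blast
  have \<Phi>_closed: "\<Phi> x \<in> closed_simplex s \<longleftrightarrow> N x \<le> 1" and \<Phi>_open: "\<Phi> x \<in> open_simplex s \<longleftrightarrow> N x < 1"
    if "x \<in> coordinate_space n" for x
    unfolding \<Phi>_def closed_iff open_iff using gauge_rescale[OF N m that] by simp_all
  have \<Psi>\<Phi>: "\<Psi> (\<Phi> x) = x" if "x \<in> coordinate_space n" for x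
    unfolding \<Phi>_def \<Psi>_def using A'A rescale_in rescale_rescale[OF N m] that by metis
  have \<Phi>\<Psi>: "\<Phi> (\<Psi> \<alpha>) = \<alpha>" if "\<alpha> \<in> closed_simplex s" for \<alpha>
    unfolding \<Phi>_def \<Psi>_def using AA'[OF that] rescale_rescale[OF m N A'_in] by simp
  have \<Psi>_in: "\<Psi> \<alpha> \<in> coordinate_space n" for \<alpha>
    unfolding \<Psi>_def by (rule rescale_in[OF A'_in])
  show thesis
  proof
    show "continuous_map (closed_disc n) (top_of_set (closed_simplex s)) \<Phi>"
      unfolding closed_disc_eq N_def[symmetric]
      using \<Phi>_closed continuous_on_subset[OF c\<Phi>] by (auto simp: continuous_map_subtopology_eu)
    have "homeomorphic_maps (open_disc n) (top_of_set (open_simplex s)) \<Phi> \<Psi>"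
      unfolding homeomorphic_maps_def open_disc_eq N_def[symmetric]
    proof (intro conjI ballI)
      show "continuous_map (top_of_set {x \<in> coordinate_space n. N x < 1}) (top_of_set (open_simplex s)) \<Phi>"
        using \<Phi>_open continuous_on_subset[OF c\<Phi>] by (auto simp: continuous_map_subtopology_eu)
      have "\<Psi> \<alpha> \<in> {x \<in> coordinate_space n. N x < 1}" if \<alpha>: "\<alpha> \<in> open_simplex s" for \<alpha>
      proof -
        have "\<Phi> (\<Psi> \<alpha>) = \<alpha>"
          using \<Phi>\<Psi> \<alpha> by (simp add: open_simplex_def)
        then show ?thesis
          using \<Phi>_open[OF \<Psi>_in, of \<alpha>] \<Psi>_in[of \<alpha>] \<alpha> by simp
      qed
      then show "continuous_map (top_of_set (open_simplex s)) (top_of_set {x \<in> coordinate_space n. N x < 1}) \<Psi>"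
        using continuous_on_subset[OF c\<Psi>] by (auto simp: continuous_map_subtopology_eu)
    qed (use \<Psi>\<Phi> \<Phi>\<Psi> in \<open>auto simp: open_simplex_def\<close>)
    then show "homeomorphic_map (open_disc n) (top_of_set (open_simplex s)) \<Phi>"
      using homeomorphic_map_maps by blast
    show "\<Phi> ` disc_boundary n \<subseteq> closed_simplex s - open_simplex s"
      unfolding disc_boundary_eq N_def[symmetric] using \<Phi>_closed \<Phi>_open by auto
  qed
qed

context locally_finite_complex
begin

lemma closed_simplex_cells:
  assumes "s \<in> K" shows "closed_simplex s = \<Union>(open_simplex ` {t. t \<subseteq> s \<and> t \<noteq> {}})"
proof (intro Set.set_eqI iffI)
  fix \<alpha> assume "\<alpha> \<in> closed_simplex s"
  then show "\<alpha> \<in> \<Union>(open_simplex ` {t. t \<subseteq> s \<and> t \<noteq> {}})"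
    using support_closed_simplex[of \<alpha> s] assms in_open_simplex_support[of \<alpha>] by (auto simp: simplicial_points_def)
next
  fix \<alpha> assume "\<alpha> \<in> \<Union>(open_simplex ` {t. t \<subseteq> s \<and> t \<noteq> {}})"
  then obtain t where t: "t \<subseteq> s" "t \<noteq> {}" "\<alpha> \<in> open_simplex t" by auto
  then show "\<alpha> \<in> closed_simplex s"
    using open_simplex_iff[of t \<alpha>] closed_simplex_iff[of s \<alpha>] simplex_finite[OF assms] finite_subset by auto
qed

lemma open_simplex_boundary:
  assumes "s \<in> K"
  shows "closed_simplex s - open_simplex s \<subseteq> \<Union>(open_simplex ` {t. t \<subset> s \<and> t \<noteq> {}})"
  unfolding closed_simplex_cells[OF assms] by auto

lemma open_simplex_nonempty:
  assumes "s \<in> K" shows "open_simplex s \<noteq> {}"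
proof -
  have fin: "finite s" "s \<noteq> {}" using simplex_finite simplex_nonempty assms by auto
  then have "(\<lambda>v. if v \<in> s then 1 / real (card s) else 0) \<in> open_simplex s"
    by (auto simp: open_simplex_def closed_simplex_def card_gt_0_iff)
  then show ?thesis by auto
qed

lemma open_simplex_disjoint:
  assumes "s \<in> K" "t \<in> K" "\<alpha> \<in> open_simplex s" "\<alpha> \<in> open_simplex t" shows "s = t"
  using assms open_simplex_simplicial_points by metis

lemma Union_open_simplex: "\<Union>(open_simplex ` K) = simplicial_points K"
proof (intro Set.set_eqI iffI)
  fix \<alpha> assume "\<alpha> \<in> \<Union>(open_simplex ` K)"
  then show "\<alpha> \<in> simplicial_points K" using open_simplex_simplicial_points by auto
next
  fix \<alpha> assume "\<alpha> \<in> simplicial_points K"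
  then show "\<alpha> \<in> \<Union>(open_simplex ` K)"
    using in_open_simplex_support simplicial_pointsD(2) by blast
qed

lemma closed_simplex_subset: "s \<in> K \<Longrightarrow> closed_simplex s \<subseteq> simplicial_points K"
  by (auto simp: simplicial_points_def)

lemma open_simplex_subset: "s \<in> K \<Longrightarrow> open_simplex s \<subseteq> simplicial_points K"
  using open_simplex_simplicial_points by auto

lemma simplex_characteristic_map:
  assumes s: "s \<in> K"
  obtains \<Phi> where "characteristic_map (realization K) (card s - 1) (open_simplex s) \<Phi>"
    "\<Phi> ` topspace (closed_disc (card s - 1)) \<subseteq> closed_simplex s"
    "\<Phi> ` disc_boundary (card s - 1) \<subseteq> \<Union>(open_simplex ` {t. t \<subset> s \<and> t \<noteq> {}})"
proof -
  have fin: "finite s" and card: "card s = Suc (card s - 1)"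
    using simplex_finite[OF s] simplex_nonempty[OF s] by (auto simp: card_gt_0_iff)
  obtain \<Phi> where \<Phi>: "continuous_map (closed_disc (card s - 1)) (top_of_set (closed_simplex s)) \<Phi>"
    "homeomorphic_map (open_disc (card s - 1)) (top_of_set (open_simplex s)) \<Phi>"
    "\<Phi> ` disc_boundary (card s - 1) \<subseteq> closed_simplex s - open_simplex s"
    using simplex_disc[OF fin card] by blast
  show thesis
  proof
    have "continuous_map (closed_disc (card s - 1)) (realization K) \<Phi>"
      using \<Phi>(1) closed_simplex_subset[OF s] unfolding realization_eq
      by (auto simp: continuous_map_in_subtopology)
    moreover have "subtopology (realization K) (open_simplex s) = top_of_set (open_simplex s)"
      unfolding realization_eq using open_simplex_subset[OF s] by (simp add: subtopology_subtopology Int_absorb1)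
    ultimately show "characteristic_map (realization K) (card s - 1) (open_simplex s) \<Phi>"
      unfolding characteristic_map_def using \<Phi>(2) by simp
    show "\<Phi> ` topspace (closed_disc (card s - 1)) \<subseteq> closed_simplex s"
      using \<Phi>(1) by (auto simp: continuous_map_in_subtopology)
    show "\<Phi> ` disc_boundary (card s - 1) \<subseteq> \<Union>(open_simplex ` {t. t \<subset> s \<and> t \<noteq> {}})"
      using \<Phi>(3) open_simplex_boundary[OF s] by blast
  qed
qed

lemma closedin_realization:
  assumes "A \<subseteq> simplicial_points K" "\<And>s. s \<in> K \<Longrightarrow> closedin (top_of_set (closed_simplex s)) (A \<inter> closed_simplex s)"
  shows "closedin (realization K) A"
proof -
  have "openin (top_of_set (closed_simplex s)) ((simplicial_points K - A) \<inter> closed_simplex s)" if s: "s \<in> K" for s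
  proof -
    have "(simplicial_points K - A) \<inter> closed_simplex s = closed_simplex s - A \<inter> closed_simplex s"
      using closed_simplex_subset[OF s] by auto
    then show ?thesis
      using assms(2)[OF s] by (simp add: openin_diff)
  qed
  then have "openin (realization K) (simplicial_points K - A)"
    unfolding openin_realization by (auto simp: simplicial_points_def)
  then show ?thesis
    using assms(1) by (simp add: closedin_def topspace_realization_eq)
qed

text \<open>For the coherence condition it suffices that a closed simplex is a finite union of cells and that
  every cell lies in its closure; the closures need not be identified.\<close>

proposition CW_complex_realization: "CW_complex (realization K) (open_simplex ` K)"
  unfolding CW_complex_def
proof (intro conjI allI impI)
  let ?X = "realization K"
  show "Hausdorff_space ?X" by (rule Hausdorff_realization)
  show "\<Union>(open_simplex ` K) = topspace ?X"
    by (simp add: Union_open_simplex topspace_realization_eq)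
  show "pairwise disjnt (open_simplex ` K)"
    using open_simplex_disjoint by (auto simp: pairwise_def disjnt_iff)
  show "\<exists>dim. \<forall>e\<in>open_simplex ` K. \<exists>\<Phi>. characteristic_map ?X (dim e) e \<Phi> \<and>
       (\<exists>F. finite F \<and> F \<subseteq> {e' \<in> open_simplex ` K. dim e' < dim e} \<and> \<Phi> ` disc_boundary (dim e) \<subseteq> \<Union>F)"
  proof -
    define dim where "dim e = card (support (SOME \<alpha>. \<alpha> \<in> e)) - 1" for e :: "('v \<Rightarrow> real) set"
    have dim: "dim (open_simplex s) = card s - 1" if "s \<in> K" for s
      unfolding dim_def using open_simplex_nonempty[OF that] open_simplex_simplicial_points[OF that] some_in_eq by metis
    have "\<exists>\<Phi>. characteristic_map ?X (dim (open_simplex s)) (open_simplex s) \<Phi> \<and>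
       (\<exists>F. finite F \<and> F \<subseteq> {e' \<in> open_simplex ` K. dim e' < dim (open_simplex s)} \<and>
         \<Phi> ` disc_boundary (dim (open_simplex s)) \<subseteq> \<Union>F)" if s: "s \<in> K" for s
    proof -
      let ?F = "open_simplex ` {t. t \<subset> s \<and> t \<noteq> {}}"
      have "finite {t. t \<subset> s \<and> t \<noteq> {}}"
        using simplex_finite[OF s] by (auto intro: finite_subset[of _ "Pow s"])
      then have "finite ?F" by simp
      moreover have "?F \<subseteq> {e' \<in> open_simplex ` K. dim e' < dim (open_simplex s)}"
      proof
        fix x assume "x \<in> ?F"
        then obtain t where t: "t \<subset> s" "t \<noteq> {}" "x = open_simplex t" by auto
        then have tK: "t \<in> K" using simplex_face[OF s, of t] by auto
        have "card t < card s" "card t > 0"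
          using t simplex_finite[OF s] simplex_finite[OF tK] by (auto simp: psubset_card_mono card_gt_0_iff)
        then show "x \<in> {e' \<in> open_simplex ` K. dim e' < dim (open_simplex s)}"
          using tK t(3) dim[OF tK] dim[OF s] by auto
      qed
      moreover obtain \<Phi> where "characteristic_map ?X (card s - 1) (open_simplex s) \<Phi>"
          "\<Phi> ` topspace (closed_disc (card s - 1)) \<subseteq> closed_simplex s"
          "\<Phi> ` disc_boundary (card s - 1) \<subseteq> \<Union>?F"
        by (rule simplex_characteristic_map[OF s])
      ultimately show ?thesis
        unfolding dim[OF s] by (intro exI[of _ \<Phi>] conjI exI[of _ ?F])
    qed
    then show ?thesis by (intro exI[of _ dim]) blast
  qed
  fix A assume A: "A \<subseteq> topspace ?X"
  show "closedin ?X A \<longleftrightarrow> (\<forall>e\<in>open_simplex ` K. closedin ?X (A \<inter> ?X closure_of e))"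
  proof
    assume R: "\<forall>e\<in>open_simplex ` K. closedin ?X (A \<inter> ?X closure_of e)"
    show "closedin ?X A"
    proof (rule closedin_realization)
      show "A \<subseteq> simplicial_points K" using A by (simp add: topspace_realization_eq)
      fix s assume s: "s \<in> K"
      let ?T = "{t. t \<subseteq> s \<and> t \<noteq> {}}"
      have T: "finite ?T" "?T \<subseteq> K"
        using simplex_finite[OF s] simplex_face[OF s] by (auto intro: finite_subset[of _ "Pow s"])
      have "open_simplex t \<subseteq> ?X closure_of (open_simplex t)" if "t \<in> ?T" for t
      proof (rule closure_of_subset)
        show "open_simplex t \<subseteq> topspace ?X"
          using open_simplex_subset T(2) that unfolding topspace_realization_eq by blast
      qed
      then have eq: "A \<inter> closed_simplex s = closed_simplex s \<inter> (\<Union>t\<in>?T. A \<inter> ?X closure_of (open_simplex t))"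
        unfolding closed_simplex_cells[OF s] by blast
      have "closedin ?X (\<Union>t\<in>?T. A \<inter> ?X closure_of (open_simplex t))"
      proof (rule closedin_Union)
        show "finite ((\<lambda>t. A \<inter> ?X closure_of (open_simplex t)) ` ?T)"
          using T(1) by simp
        show "closedin ?X S" if "S \<in> (\<lambda>t. A \<inter> ?X closure_of (open_simplex t)) ` ?T" for S
          using that R T(2) by blast
      qed
      then have "closedin (subtopology ?X (closed_simplex s)) (A \<inter> closed_simplex s)"
        unfolding eq by (subst Int_commute) (rule closedin_subtopology[THEN iffD2], blast)
      then show "closedin (top_of_set (closed_simplex s)) (A \<inter> closed_simplex s)"
        unfolding realization_eq using closed_simplex_subset[OF s] by (simp add: subtopology_subtopology Int_absorb1)
    qed
  next
    assume "closedin ?X A"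
    then show "\<forall>e\<in>open_simplex ` K. closedin ?X (A \<inter> ?X closure_of e)"
      by (intro ballI closedin_Int closedin_closure_of)
  qed
qed

end


section \<open>Prism homotopies\<close>

lemma continuous_on_locally:
  assumes "\<And>x. x \<in> S \<Longrightarrow> \<exists>W. open W \<and> x \<in> W \<and> continuous_on (S \<inter> W) f"
  shows "continuous_on S f"
  unfolding continuous_on_def
proof
  fix x assume x: "x \<in> S"
  then obtain W where W: "open W" "x \<in> W" "continuous_on (S \<inter> W) f"
    using assms by blast
  then have "(f \<longlongrightarrow> f x) (at x within S \<inter> W)"
    using x by (simp add: continuous_on_def)
  moreover have "at x within S \<inter> W = at x within S"
    by (rule at_within_nhd[OF W(2,1)]) auto
  ultimately show "(f \<longlongrightarrow> f x) (at x within S)" by simp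
qed

locale ordered_complex = locally_finite_complex K for K :: "'v set set" +
  fixes le :: "'v \<Rightarrow> 'v \<Rightarrow> bool"
  assumes le_refl: "\<lbrakk>s \<in> K; u \<in> s\<rbrakk> \<Longrightarrow> le u u"
    and le_antisym: "\<lbrakk>s \<in> K; u \<in> s; v \<in> s; le u v; le v u\<rbrakk> \<Longrightarrow> u = v"
    and le_trans: "\<lbrakk>s \<in> K; u \<in> s; v \<in> s; w \<in> s; le u v; le v w\<rbrakk> \<Longrightarrow> le u w"
    and le_total: "\<lbrakk>s \<in> K; u \<in> s; v \<in> s\<rbrakk> \<Longrightarrow> le u v \<or> le v u"
begin

text \<open>Summing over all neighbours and not only over the support keeps the index set independent of \<open>\<alpha>\<close>, which
  makes the sum continuous. For \<open>v\<close> in the support of a point of the complex the two sums agree.\<close>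

definition lower_mass :: "('v \<Rightarrow> real) \<Rightarrow> 'v \<Rightarrow> real"
  where "lower_mass \<alpha> v = (\<Sum>w \<in> neighbours v \<inter> {w. le w v}. \<alpha> w)"

text \<open>Lay out the unit mass of \<open>\<alpha>\<close> along \<open>[0, 1]\<close> in increasing order of the vertices of its support, which
  form a chain. The vertex \<open>v\<close> occupies an interval of length \<open>\<alpha> v\<close>, and this is the length of the part
  of it below \<open>t\<close>.\<close>

definition low_part :: "real \<Rightarrow> ('v \<Rightarrow> real) \<Rightarrow> 'v \<Rightarrow> real"
  where "low_part t \<alpha> v = min t (lower_mass \<alpha> v) - min t (lower_mass \<alpha> v - \<alpha> v)"

text \<open>The mass below level \<open>t\<close> is pushed forward by \<open>p\<close> and the mass above it by \<open>q\<close>. As \<open>t\<close> grows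
  this traces the vertical line over \<open>\<alpha>\<close> in the triangulated prism over a chain, mapped affinely.\<close>

definition prism_map :: "('v \<Rightarrow> 'v) \<Rightarrow> ('v \<Rightarrow> 'v) \<Rightarrow> real \<Rightarrow> ('v \<Rightarrow> real) \<Rightarrow> 'v \<Rightarrow> real"
  where "prism_map p q t \<alpha> u =
    (\<Sum>v | v \<in> support \<alpha> \<and> p v = u. low_part t \<alpha> v) +
    (\<Sum>v | v \<in> support \<alpha> \<and> q v = u. \<alpha> v - low_part t \<alpha> v)"

text \<open>The vertices of \<open>A\<close> carry mass below the current level and those of \<open>B\<close> carry mass above it. The
  condition says that the images span a simplex, for every way in which a chain can be divided.\<close>

definition prism_compatible :: "('v \<Rightarrow> 'v) \<Rightarrow> ('v \<Rightarrow> 'v) \<Rightarrow> bool"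
  where "prism_compatible p q \<longleftrightarrow>
    (\<forall>s\<in>K. \<forall>A B. A \<subseteq> s \<and> B \<subseteq> s \<and> A \<union> B \<noteq> {} \<and> (\<forall>a\<in>A. \<forall>b\<in>B. le a b) \<longrightarrow> p ` A \<union> q ` B \<in> K)"

lemma lower_mass_support:
  assumes \<alpha>: "\<alpha> \<in> simplicial_points K" and v: "v \<in> support \<alpha>"
  shows "lower_mass \<alpha> v = (\<Sum>w \<in> support \<alpha> \<inter> {w. le w v}. \<alpha> w)"
proof -
  have "support \<alpha> \<subseteq> neighbours v"
    using support_neighbours[OF \<alpha>] v by (simp add: support_def)
  then show ?thesis
    unfolding lower_mass_def using finite_neighbours[of v]
    by (intro sum.mono_neutral_right) (auto simp: support_def)
qed

lemma lower_mass_bounds: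
  assumes \<alpha>: "\<alpha> \<in> simplicial_points K" and v: "v \<in> support \<alpha>"
  shows "\<alpha> v \<le> lower_mass \<alpha> v" "lower_mass \<alpha> v \<le> 1"
proof -
  note P = simplicial_pointsD[OF \<alpha>]
  have vv: "v \<in> support \<alpha> \<inter> {w. le w v}"
    using v le_refl P(2) by auto
  show "\<alpha> v \<le> lower_mass \<alpha> v"
    unfolding lower_mass_support[OF \<alpha> v] using vv P by (intro member_le_sum) auto
  have "lower_mass \<alpha> v \<le> sum \<alpha> (support \<alpha>)"
    unfolding lower_mass_support[OF \<alpha> v] using P by (intro sum_mono2) auto
  then show "lower_mass \<alpha> v \<le> 1" using P(3) by simp
qed

lemma low_part_outside: "v \<notin> support \<alpha> \<Longrightarrow> low_part t \<alpha> v = 0"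
  by (simp add: low_part_def support_def)

lemma low_part_bounds:
  assumes \<alpha>: "\<alpha> \<in> simplicial_points K"
  shows "0 \<le> low_part t \<alpha> v" "low_part t \<alpha> v \<le> \<alpha> v"
  using simplicial_pointsD(1)[OF \<alpha>, of v] by (auto simp: low_part_def min_def)

lemma low_part_0:
  assumes \<alpha>: "\<alpha> \<in> simplicial_points K" shows "low_part 0 \<alpha> v = 0"
proof (cases "v \<in> support \<alpha>")
  case True
  then show ?thesis
    using lower_mass_bounds[OF \<alpha> True] simplicial_pointsD(1)[OF \<alpha>, of v] by (auto simp: low_part_def min_def)
qed (rule low_part_outside)

lemma low_part_1:
  assumes \<alpha>: "\<alpha> \<in> simplicial_points K" shows "low_part 1 \<alpha> v = \<alpha> v"
proof (cases "v \<in> support \<alpha>")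
  case True
  then show ?thesis
    using lower_mass_bounds[OF \<alpha> True] simplicial_pointsD(1)[OF \<alpha>, of v] by (auto simp: low_part_def min_def)
next
  case False
  then show ?thesis using low_part_outside[OF False] by (simp add: support_def)
qed

text \<open>If \<open>b\<close> came strictly before \<open>a\<close>, its interval would end before that of \<open>a\<close> begins, while the level
  \<open>t\<close> lies strictly beyond the start of the latter and before the end of the former.\<close>

lemma low_part_separates:
  assumes \<alpha>: "\<alpha> \<in> simplicial_points K" and a: "a \<in> support \<alpha>" and b: "b \<in> support \<alpha>"
    and pos: "0 < low_part t \<alpha> a" and less: "low_part t \<alpha> b < \<alpha> b"
  shows "le a b"
proof (rule ccontr)
  assume nle: "\<not> le a b"
  note P = simplicial_pointsD[OF \<alpha>]
  have ba: "le b a"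
    using le_total[OF P(2) a b] nle by blast
  have "support \<alpha> \<inter> {w. le w b} \<subseteq> support \<alpha> \<inter> {w. le w a} - {a}"
    using le_trans[OF P(2) _ b a _ ba] nle by auto
  then have "lower_mass \<alpha> b \<le> sum \<alpha> (support \<alpha> \<inter> {w. le w a} - {a})"
    unfolding lower_mass_support[OF \<alpha> b] using P by (intro sum_mono2) auto
  also have "\<dots> = lower_mass \<alpha> a - \<alpha> a"
    unfolding lower_mass_support[OF \<alpha> a] using P a le_refl[OF P(2) a] by (subst sum_diff1) auto
  finally have "lower_mass \<alpha> b \<le> lower_mass \<alpha> a - \<alpha> a" .
  moreover have "lower_mass \<alpha> a - \<alpha> a < t"
    using pos P(1)[of a] by (auto simp: low_part_def min_def split: if_splits)
  moreover have "t < lower_mass \<alpha> b"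
    using less P(1)[of b] by (auto simp: low_part_def min_def split: if_splits)
  ultimately show False by linarith
qed

lemma prism_map_in:
  assumes pq: "prism_compatible p q" and \<alpha>: "\<alpha> \<in> simplicial_points K"
  shows "prism_map p q t \<alpha> \<in> simplicial_points K"
proof -
  note P = simplicial_pointsD[OF \<alpha>] and L = low_part_bounds[OF \<alpha>]
  let ?S = "support \<alpha>"
  define A where "A = {v \<in> ?S. 0 < low_part t \<alpha> v}"
  define B where "B = {v \<in> ?S. low_part t \<alpha> v < \<alpha> v}"
  have AB: "A \<union> B = ?S"
  proof -
    have "0 < low_part t \<alpha> v \<or> low_part t \<alpha> v < \<alpha> v" if "v \<in> ?S" for v
      using that P(1)[of v] L[of t v] by (auto simp: support_def)
    then show ?thesis by (auto simp: A_def B_def)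
  qed
  let ?T = "p ` A \<union> q ` B" and ?T' = "p ` ?S \<union> q ` ?S"
  have T: "?T \<in> K"
  proof -
    have "\<forall>a\<in>A. \<forall>b\<in>B. le a b"
      using low_part_separates[OF \<alpha>] by (auto simp: A_def B_def)
    then show ?thesis
      using pq P(2,5) AB unfolding prism_compatible_def by (metis Un_upper1 Un_upper2)
  qed
  have zero: "prism_map p q t \<alpha> u = 0" if "u \<notin> ?T" for u
  proof -
    have "low_part t \<alpha> v = 0" if "v \<in> ?S" "p v = u" for v
    proof -
      have "v \<notin> A" using \<open>u \<notin> ?T\<close> that by auto
      then show ?thesis using that L[of t v] by (auto simp: A_def)
    qed
    moreover have "\<alpha> v - low_part t \<alpha> v = 0" if "v \<in> ?S" "q v = u" for v
    proof -
      have "v \<notin> B" using \<open>u \<notin> ?T\<close> that by auto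
      then show ?thesis using that L[of t v] by (auto simp: B_def)
    qed
    ultimately show ?thesis by (simp add: prism_map_def)
  qed
  have "sum (prism_map p q t \<alpha>) ?T' = (\<Sum>v\<in>?S. low_part t \<alpha> v) + (\<Sum>v\<in>?S. \<alpha> v - low_part t \<alpha> v)"
    unfolding prism_map_def sum.distrib using P(4) by (subst (1 2) sum.group) auto
  also have "\<dots> = 1"
    using P(3) by (simp add: sum_subtractf)
  finally have "sum (prism_map p q t \<alpha>) ?T' = 1" .
  moreover have "sum (prism_map p q t \<alpha>) ?T = sum (prism_map p q t \<alpha>) ?T'"
    using P(4) zero by (intro sum.mono_neutral_left) (auto simp: A_def B_def)
  moreover have "0 \<le> prism_map p q t \<alpha> u" for u
    unfolding prism_map_def using L by (intro add_nonneg_nonneg sum_nonneg) simp_all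
  ultimately have "prism_map p q t \<alpha> \<in> closed_simplex ?T"
    using zero by (simp add: closed_simplex_def)
  then show ?thesis
    using T by (auto simp: simplicial_points_def)
qed

lemma prism_map_0: "\<alpha> \<in> simplicial_points K \<Longrightarrow> prism_map p q 0 \<alpha> = realization_map q \<alpha>"
  by (simp add: prism_map_def realization_map_def low_part_0 support_def fun_eq_iff)

lemma prism_map_1: "\<alpha> \<in> simplicial_points K \<Longrightarrow> prism_map p q 1 \<alpha> = realization_map p \<alpha>"
  by (simp add: prism_map_def realization_map_def low_part_1 support_def fun_eq_iff)

lemma prism_map_fixed:
  assumes "\<And>v. v \<in> support \<alpha> \<Longrightarrow> p v = v" "\<And>v. v \<in> support \<alpha> \<Longrightarrow> q v = v"
  shows "prism_map p q t \<alpha> = \<alpha>"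
proof
  fix u
  have "{v. v \<in> support \<alpha> \<and> p v = u} = (if u \<in> support \<alpha> then {u} else {})"
    "{v. v \<in> support \<alpha> \<and> q v = u} = (if u \<in> support \<alpha> then {u} else {})"
    using assms by auto
  then show "prism_map p q t \<alpha> u = \<alpha> u"
    by (auto simp: prism_map_def support_def)
qed

lemma realization_map_fixed:
  assumes "\<And>v. v \<in> support \<alpha> \<Longrightarrow> f v = v" shows "realization_map f \<alpha> = \<alpha>"
proof
  fix u
  have "{v. \<alpha> v \<noteq> 0 \<and> f v = u} = (if u \<in> support \<alpha> then {u} else {})"
    using assms by (auto simp: support_def)
  then show "realization_map f \<alpha> u = \<alpha> u"
    by (auto simp: realization_map_def support_def)
qed

lemma open_star_coordinate: "open {p :: 'c::topological_space \<times> ('v \<Rightarrow> real). 0 < snd p v}"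
  by (intro open_Collect_less continuous_intros)

lemma positive_vertex:
  assumes "\<alpha> \<in> simplicial_points K" obtains v where "0 < \<alpha> v"
  using simplicial_pointsD[OF assms] by (metis (mono_tags, lifting) ex_in_conv less_le mem_Collect_eq support_def)

text \<open>On the open star of a vertex all supports lie in one finite set, so there the coordinates are finite
  sums of continuous functions.\<close>

lemma continuous_prism_map:
  "continuous_on ({0..1} \<times> simplicial_points K) (\<lambda>z. prism_map p q (fst z) (snd z))"
proof (rule continuous_on_locally)
  fix z assume "z \<in> {0..1::real} \<times> simplicial_points K"
  then have "snd z \<in> simplicial_points K" by auto
  then obtain v0 where v0: "0 < snd z v0"
    by (rule positive_vertex)
  let ?W = "{z :: real \<times> ('v \<Rightarrow> real). 0 < snd z v0}" and ?N = "neighbours v0"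
  have low: "continuous_on S (\<lambda>z. low_part (fst z) (snd z) v)" for S v
    unfolding low_part_def lower_mass_def by (intro continuous_intros)
  have "continuous_on (({0..1} \<times> simplicial_points K) \<inter> ?W) (\<lambda>z. prism_map p q (fst z) (snd z))"
  proof (rule continuous_on_coordinatewise_then_product)
    fix u
    have eq: "prism_map p q (fst z) (snd z) u =
        (\<Sum>v | v \<in> ?N \<and> p v = u. low_part (fst z) (snd z) v) +
        (\<Sum>v | v \<in> ?N \<and> q v = u. snd z v - low_part (fst z) (snd z) v)"
      if z: "z \<in> ({0..1} \<times> simplicial_points K) \<inter> ?W" for z
    proof -
      have S: "support (snd z) \<subseteq> ?N"
        using z support_neighbours[of "snd z" v0] by auto
      have "(\<Sum>v | v \<in> support (snd z) \<and> p v = u. low_part (fst z) (snd z) v) =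
          (\<Sum>v | v \<in> ?N \<and> p v = u. low_part (fst z) (snd z) v)"
        using S finite_neighbours[of v0] low_part_outside by (intro sum.mono_neutral_left) auto
      moreover have "(\<Sum>v | v \<in> support (snd z) \<and> q v = u. snd z v - low_part (fst z) (snd z) v) =
          (\<Sum>v | v \<in> ?N \<and> q v = u. snd z v - low_part (fst z) (snd z) v)"
        using S finite_neighbours[of v0] low_part_outside
        by (intro sum.mono_neutral_left) (auto simp: support_def)
      ultimately show ?thesis by (simp add: prism_map_def)
    qed
    show "continuous_on (({0..1} \<times> simplicial_points K) \<inter> ?W) (\<lambda>z. prism_map p q (fst z) (snd z) u)"
      by (subst continuous_on_cong[OF refl eq]) (assumption, intro continuous_intros low)
  qed
  then show "\<exists>W. open W \<and> z \<in> W \<and> continuous_on (({0..1} \<times> simplicial_points K) \<inter> W) (\<lambda>z. prism_map p q (fst z) (snd z))"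
    using v0 open_star_coordinate by blast
qed

text \<open>The last clause makes an infinite succession of homotopies stationary near each point.\<close>

definition prism_homotopy :: "('v \<Rightarrow> 'v) \<Rightarrow> ('v \<Rightarrow> 'v) \<Rightarrow> (real \<times> ('v \<Rightarrow> real) \<Rightarrow> 'v \<Rightarrow> real) \<Rightarrow> bool"
  where "prism_homotopy p q h \<longleftrightarrow>
    continuous_on ({0..1} \<times> simplicial_points K) h \<and> h ` ({0..1} \<times> simplicial_points K) \<subseteq> simplicial_points K \<and>
    (\<forall>\<alpha>\<in>simplicial_points K. h (0, \<alpha>) = realization_map p \<alpha> \<and> h (1, \<alpha>) = realization_map q \<alpha> \<and>
      ((\<forall>v\<in>support \<alpha>. p v = v \<and> q v = v) \<longrightarrow> (\<forall>t\<in>{0..1}. h (t, \<alpha>) = \<alpha>)))"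

lemma prism_homotopy_exists:
  assumes "prism_compatible p q \<or> prism_compatible q p"
  obtains h where "prism_homotopy p q h"
proof -
  consider "prism_compatible q p" | "prism_compatible p q" using assms by blast
  then show thesis
  proof cases
    case 1
    have "prism_homotopy p q (\<lambda>z. prism_map q p (fst z) (snd z))"
      unfolding prism_homotopy_def
      using continuous_prism_map prism_map_in[OF 1] prism_map_0 prism_map_1 prism_map_fixed by auto
    then show ?thesis by (rule that)
  next
    case 2
    have "continuous_on ({0..1} \<times> simplicial_points K) ((\<lambda>z. prism_map p q (fst z) (snd z)) \<circ> (\<lambda>z. (1 - fst z, snd z)))"
      by (intro continuous_on_compose continuous_intros continuous_on_subset[OF continuous_prism_map]) auto
    then have "prism_homotopy p q (\<lambda>z. prism_map p q (1 - fst z) (snd z))"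
      unfolding prism_homotopy_def o_def
      using prism_map_in[OF 2] prism_map_0 prism_map_1 prism_map_fixed by auto
    then show ?thesis by (rule that)
  qed
qed

text \<open>The homotopies between \<open>c n\<close> and \<open>c (Suc n)\<close> are run during consecutive time intervals that accumulate
  at \<open>1\<close>. Near a given point all but finitely many of them are stationary, so the limit is continuous
  and ends with the identity.\<close>

proposition contractible_realization:
  fixes c :: "nat \<Rightarrow> 'v \<Rightarrow> 'v"
  assumes step: "\<And>n. prism_compatible (c n) (c (Suc n)) \<or> prism_compatible (c (Suc n)) (c n)"
    and const: "\<And>v. v \<in> \<Union>K \<Longrightarrow> c 0 v = v0"
    and eventually_id: "\<And>v. v \<in> \<Union>K \<Longrightarrow> \<exists>N. \<forall>n\<ge>N. c n v = v"
  shows "contractible_space (realization K)"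
proof -
  let ?I = "{0..1::real}" and ?X = "simplicial_points K"
  have "\<exists>h. prism_homotopy (c n) (c (Suc n)) h" for n
    using prism_homotopy_exists[OF step[of n]] by blast
  then obtain h where "\<And>n. prism_homotopy (c n) (c (Suc n)) (h n)"
    by metis
  then have hc: "\<And>n. continuous_on (?I \<times> ?X) (h n)" and hX: "\<And>n. h n ` (?I \<times> ?X) \<subseteq> ?X"
    and h0: "\<And>n \<alpha>. \<alpha> \<in> ?X \<Longrightarrow> h n (0, \<alpha>) = realization_map (c n) \<alpha>"
    and h1: "\<And>n \<alpha>. \<alpha> \<in> ?X \<Longrightarrow> h n (1, \<alpha>) = realization_map (c (Suc n)) \<alpha>"
    and hfix: "\<And>n \<alpha> t. \<lbrakk>\<alpha> \<in> ?X; t \<in> ?I; \<And>v. v \<in> support \<alpha> \<Longrightarrow> c n v = v \<and> c (Suc n) v = v\<rbrakk> \<Longrightarrow> h n (t, \<alpha>) = \<alpha>"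
    unfolding prism_homotopy_def by blast+
  (* The n-th homotopy takes place between the times T n and T (Suc n). *)
  define T where "T n = real n / real (Suc n)" for n
  have T: "0 \<le> T n" "T n < 1" "T n < T (Suc n)" for n
    by (simp_all add: T_def field_simps)
  define \<tau> where "\<tau> n t = max 0 (min 1 ((t - T n) / (T (Suc n) - T n)))" for n t
  have \<tau>_in: "\<tau> n t \<in> ?I" for n t by (simp add: \<tau>_def)
  have \<tau>0: "\<tau> n (T n) = 0" for n by (simp add: \<tau>_def)
  have \<tau>1: "\<tau> n t = 1" if "T (Suc n) \<le> t" for n t
    using that T(3)[of n] by (simp add: \<tau>_def)
  (* g n performs the first n homotopies and then stays put. *)
  define g where "g = rec_nat (\<lambda>z. realization_map (c 0) (snd z))
     (\<lambda>n gn z. if fst z \<le> T n then gn z else h n (\<tau> n (fst z), snd z))"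
  have g0: "g 0 z = realization_map (c 0) (snd z)" for z
    by (simp add: g_def)
  have gS: "g (Suc n) z = (if fst z \<le> T n then g n z else h n (\<tau> n (fst z), snd z))" for n z
    by (simp add: g_def)
  have c0: "realization_map (c 0) \<alpha> = (\<lambda>w. if w = v0 then 1 else 0)" if \<alpha>: "\<alpha> \<in> ?X" for \<alpha>
  proof
    fix w
    have "c 0 v = v0" if "\<alpha> v \<noteq> 0" for v
    proof (rule const)
      show "v \<in> \<Union>K"
        using simplicial_pointsD(2)[OF \<alpha>] that by (intro UnionI) (auto simp: support_def)
    qed
    then have "{v. \<alpha> v \<noteq> 0 \<and> c 0 v = w} = (if w = v0 then support \<alpha> else {})"
      by (auto simp: support_def)
    then show "realization_map (c 0) \<alpha> w = (if w = v0 then 1 else 0)"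
      using simplicial_pointsD(3)[OF \<alpha>] by (simp add: realization_map_def)
  qed
  have g_late: "g n (t, \<alpha>) = realization_map (c n) \<alpha>" if "T n \<le> t" "\<alpha> \<in> ?X" for n t \<alpha>
  proof (cases n)
    case (Suc k)
    then show ?thesis
      using that T(3)[of k] \<tau>1[of k t] h1[OF that(2), of k] by (simp add: gS)
  qed (simp add: g0)
  have g_zero: "g n (0, \<alpha>) = realization_map (c 0) \<alpha>" for n \<alpha>
    by (induction n) (simp_all add: g0 gS T(1))
  have gX: "g n z \<in> ?X" if "z \<in> ?I \<times> ?X" for n z
  proof (induction n)
    case 0
    have z: "snd z \<in> ?X" "(0, snd z) \<in> ?I \<times> ?X"
      using that by auto
    then have "h 0 (0, snd z) \<in> ?X"
      using hX[of 0] by blast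
    then show ?case
      using h0[OF z(1), of 0] by (simp add: g0)
  next
    case (Suc n)
    have "(\<tau> n (fst z), snd z) \<in> ?I \<times> ?X"
      using \<tau>_in that by auto
    then show ?case
      using Suc hX[of n] by (auto simp: gS image_subset_iff)
  qed
  have gc: "continuous_on (?I \<times> ?X) (g n)" for n
  proof (induction n)
    case 0
    have "continuous_on (?I \<times> ?X) (\<lambda>z. (\<lambda>w. if w = v0 then 1 else 0) :: 'v \<Rightarrow> real)" by simp
    then show ?case
      by (rule continuous_on_eq) (auto simp: g0 c0)
  next
    case (Suc n)
    have \<tau>c: "continuous_on S (\<lambda>z :: real \<times> ('v \<Rightarrow> real). (\<tau> n (fst z), snd z))" for S
      unfolding \<tau>_def using T(3)[of n] by (intro continuous_intros) auto
    have "continuous_on (?I \<times> ?X) (\<lambda>z. if fst z \<le> T n then g n z else h n (\<tau> n (fst z), snd z))"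
    proof (rule continuous_on_cases_le)
      show "continuous_on {z \<in> ?I \<times> ?X. fst z \<le> T n} (g n)"
        by (rule continuous_on_subset[OF Suc]) auto
      show "continuous_on {z \<in> ?I \<times> ?X. T n \<le> fst z} (\<lambda>z. h n (\<tau> n (fst z), snd z))"
        by (rule continuous_on_compose2[OF hc \<tau>c]) (use \<tau>_in in auto)
      show "g n z = h n (\<tau> n (fst z), snd z)" if "z \<in> ?I \<times> ?X" "fst z = T n" for z
      proof -
        define \<alpha> where "\<alpha> = snd z"
        have z: "z = (T n, \<alpha>)" "\<alpha> \<in> ?X"
          using that by (auto simp: \<alpha>_def prod_eq_iff)
        show ?thesis
          using g_late[OF order_refl z(2), of n] h0[OF z(2), of n] by (simp add: z(1) \<tau>0)
      qed
    qed (intro continuous_intros)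
    then show ?case
      by (rule continuous_on_eq) (simp add: gS)
  qed
  have g_stable: "g m z = g n z"
    if nm: "n \<le> m" and z: "z \<in> ?I \<times> ?X" and fx: "\<And>k v. \<lbrakk>n \<le> k; v \<in> support (snd z)\<rbrakk> \<Longrightarrow> c k v = v" for n m z
    using nm
  proof (induction m rule: dec_induct)
    case (step m)
    show ?case
    proof (cases "fst z \<le> T m")
      case True
      then show ?thesis using step.IH by (simp add: gS)
    next
      case False
      have sz: "snd z \<in> ?X" using z by auto
      have "h m (\<tau> m (fst z), snd z) = snd z"
        using fx step.hyps by (intro hfix[OF sz \<tau>_in]) simp
      moreover have "g m z = snd z"
        using g_late[of m "fst z", OF _ sz] False realization_map_fixed[of "snd z" "c m"] fx step.hyps by simp
      ultimately show ?thesis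
        using False step.IH by (simp add: gS)
    qed
  qed simp
  have stable_at: "\<exists>N. \<forall>n\<ge>N. \<forall>v\<in>S. c n v = v" if fin: "finite S" and S: "S \<subseteq> \<Union>K" for S
  proof -
    obtain N where N: "\<And>v n. \<lbrakk>v \<in> S; N v \<le> n\<rbrakk> \<Longrightarrow> c n v = v"
      using eventually_id S by (metis subsetD)
    have "\<forall>n\<ge>Max (insert 0 (N ` S)). \<forall>v\<in>S. c n v = v"
      using N fin by auto
    then show ?thesis by blast
  qed
  define N where "N \<alpha> = (SOME N. \<forall>n\<ge>N. \<forall>v\<in>support \<alpha>. c n v = v)" for \<alpha>
  have N: "c n v = v" if "\<alpha> \<in> ?X" "N \<alpha> \<le> n" "v \<in> support \<alpha>" for \<alpha> n v
  proof -
    have "\<exists>N. \<forall>n\<ge>N. \<forall>v\<in>support \<alpha>. c n v = v"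
      using stable_at simplicial_pointsD(2,4)[OF that(1)] by blast
    then have "\<forall>n\<ge>N \<alpha>. \<forall>v\<in>support \<alpha>. c n v = v"
      unfolding N_def by (rule someI_ex)
    then show ?thesis using that by blast
  qed
  (* By stability any sufficiently large stage computes the same value. *)
  define H where "H z = g (N (snd z)) z" for z
  have HX: "H z \<in> ?X" if "z \<in> ?I \<times> ?X" for z
    unfolding H_def by (rule gX[OF that])
  have "continuous_on (?I \<times> ?X) H"
  proof (rule continuous_on_locally)
    fix z assume "z \<in> ?I \<times> ?X"
    then have "snd z \<in> ?X" by auto
    then obtain v where v: "0 < snd z v"
      by (rule positive_vertex)
    have "neighbours v \<subseteq> \<Union>K" by (auto simp: neighbours_def)
    then obtain M where M: "\<And>n w. \<lbrakk>M \<le> n; w \<in> neighbours v\<rbrakk> \<Longrightarrow> c n w = w"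
      using stable_at[OF finite_neighbours] by metis
    let ?W = "{z :: real \<times> ('v \<Rightarrow> real). 0 < snd z v}"
    have "H y = g M y" if y: "y \<in> ?I \<times> ?X \<inter> ?W" for y
    proof -
      have yI: "y \<in> ?I \<times> ?X" and S: "support (snd y) \<subseteq> neighbours v"
        using y support_neighbours[of "snd y" v] by auto
      have "g (max M (N (snd y))) y = g M y"
        by (rule g_stable[OF _ yI]) (use M S in auto)
      moreover have "g (max M (N (snd y))) y = g (N (snd y)) y"
        by (rule g_stable[OF _ yI]) (use N yI in auto)
      ultimately show ?thesis by (simp add: H_def)
    qed
    then have "continuous_on (?I \<times> ?X \<inter> ?W) H"
      by (subst continuous_on_cong[OF refl]) (assumption, rule continuous_on_subset[OF gc Int_lower1])
    then show "\<exists>W. open W \<and> z \<in> W \<and> continuous_on (?I \<times> ?X \<inter> W) H"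
      using v open_star_coordinate by blast
  qed
  moreover have "H (0, \<alpha>) = (\<lambda>w. if w = v0 then 1 else 0)" if "\<alpha> \<in> ?X" for \<alpha>
    using g_zero c0[OF that] by (simp add: H_def)
  moreover have "H (1, \<alpha>) = \<alpha>" if "\<alpha> \<in> ?X" for \<alpha>
    using g_late[of "N \<alpha>" 1 \<alpha>] T(2)[of "N \<alpha>"] that realization_map_fixed[of \<alpha> "c (N \<alpha>)"] N[OF that]
    by (simp add: H_def)
  ultimately have "homotopic_with (\<lambda>x. True) (realization K) (realization K) (\<lambda>\<alpha>. \<lambda>w. if w = v0 then 1 else 0) id"
    using HX by (subst homotopic_with) (auto simp: realization_eq image_subset_iff intro!: exI[of _ H])
  then show ?thesis
    unfolding contractible_space_def using homotopic_with_symD by blast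
qed

end


section \<open>The lattice order of a Garside group\<close>

lemma (in monoid) monoid_prod_closed: "set xs \<subseteq> carrier G \<Longrightarrow> monoid_prod G xs \<in> carrier G"
  by (induction xs) (auto simp: monoid_prod_def)

lemma (in monoid) monoid_prod_append:
  "\<lbrakk>set xs \<subseteq> carrier G; set ys \<subseteq> carrier G\<rbrakk> \<Longrightarrow> monoid_prod G (xs @ ys) = monoid_prod G xs \<otimes> monoid_prod G ys"
proof (induction xs)
  case Nil
  then show ?case using monoid_prod_closed[of ys] by (simp add: monoid_prod_def)
next
  case (Cons x xs)
  then show ?case
    using monoid_prod_closed[of xs] monoid_prod_closed[of ys] by (simp add: monoid_prod_def m_assoc)
qed

text \<open>A nontrivial factorization of \<open>\<one>\<close> could be repeated arbitrarily often, against the finiteness of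
  the norm of \<open>\<one>\<close>.\<close>

lemma (in atomic_monoid) left_unit_trivial:
  assumes a: "a \<in> carrier M" and b: "b \<in> carrier M" and ab: "a \<otimes> b = \<one>"
  shows "a = \<one>"
proof (rule ccontr)
  assume "a \<noteq> \<one>"
  let ?I = "indivisibles M"
  have IM: "?I \<subseteq> carrier M"
    by (auto simp: indivisibles_def)
  obtain xs ys where xs: "set xs \<subseteq> ?I" "monoid_prod M xs = a" and ys: "set ys \<subseteq> ?I" "monoid_prod M ys = b"
    using generated_by_indivisibles a b unfolding monoid_generates_def by metis
  define zs where "zs = xs @ ys"
  have zs: "set zs \<subseteq> ?I" "monoid_prod M zs = \<one>"
    using xs ys ab IM monoid_prod_append[of xs ys] by (auto simp: zs_def)
  have "xs \<noteq> []"
    using xs(2) \<open>a \<noteq> \<one>\<close> by (auto simp: monoid_prod_def)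
  then have len: "1 \<le> length zs"
    by (cases xs) (auto simp: zs_def)
  have rep: "set (concat (replicate n zs)) \<subseteq> ?I \<and> monoid_prod M (concat (replicate n zs)) = \<one> \<and>
      n \<le> length (concat (replicate n zs))" for n
  proof (induction n)
    case 0
    then show ?case by (simp add: monoid_prod_def)
  next
    case (Suc n)
    then show ?case
      using zs len IM monoid_prod_append[of zs "concat (replicate n zs)"] by (auto simp: subset_iff)
  qed
  have "enat n \<le> monoid_norm M \<one>" for n
  proof -
    have "enat (length (concat (replicate n zs))) \<le> monoid_norm M \<one>"
      unfolding monoid_norm_def using rep[of n] by (intro SUP_upper) auto
    moreover have "enat n \<le> enat (length (concat (replicate n zs)))"
      using rep[of n] by simp
    ultimately show ?thesis by (rule order_trans[rotated])
  qed
  moreover obtain k where "monoid_norm M \<one> = enat k"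
    using finite_norm[OF one_closed] by (auto simp: less_infinityE)
  ultimately show False
    by (metis enat_ord_simps(1) not_less_eq_eq order_refl)
qed

context garside_group
begin

abbreviation "Pos \<equiv> G\<lparr>carrier := P\<rparr>"

abbreviation "\<D> \<equiv> simple_divisors G P \<Delta>"

lemma P_carrier: "p \<in> P \<Longrightarrow> p \<in> carrier G"
  using subset by blast

lemma P_inv_trivial:
  assumes "a \<in> P" "inv a \<in> P" shows "a = \<one>"
proof -
  interpret M: garside_monoid Pos \<Delta> by (rule garside)
  show ?thesis
    using M.left_unit_trivial[of a "inv a"] assms P_carrier by simp
qed

lemma Delta_P: "\<Delta> \<in> P"
  using garside_monoid.garside_element[OF garside] by simp

lemma Delta_carrier: "\<Delta> \<in> carrier G"
  using Delta_P P_carrier by blast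

lemma simple_iff_left: "\<mu> \<in> \<D> \<longleftrightarrow> \<mu> \<in> P \<and> (\<exists>c\<in>P. \<Delta> = \<mu> \<otimes> c)"
  by (simp add: simple_divisors_def left_divisors_def left_divides_def)

lemma simple_iff_right: "\<mu> \<in> \<D> \<longleftrightarrow> \<mu> \<in> P \<and> (\<exists>c\<in>P. \<Delta> = c \<otimes> \<mu>)"
  using garside_monoid.divisors_eq[OF garside]
  by (simp add: simple_divisors_def right_divisors_def right_divides_def)

lemma finite_simple: "finite \<D>"
  using garside_monoid.finite_divisors[OF garside] by (simp add: simple_divisors_def)

lemma simple_generate [consumes 1, case_names one mult]:
  assumes p: "p \<in> P" and one: "Q \<one>"
    and mult: "\<And>\<mu> r. \<lbrakk>\<mu> \<in> \<D>; r \<in> P; Q r\<rbrakk> \<Longrightarrow> Q (\<mu> \<otimes> r)"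
  shows "Q p"
proof -
  obtain xs where xs: "set xs \<subseteq> \<D>" "monoid_prod Pos xs = p"
    using garside_monoid.divisors_generate[OF garside] p unfolding monoid_generates_def simple_divisors_def by auto
  have "monoid_prod Pos xs \<in> P \<and> Q (monoid_prod Pos xs)"
    using xs(1)
  proof (induction xs)
    case Nil
    then show ?case using one by (simp add: monoid_prod_def)
  next
    case (Cons \<mu> xs)
    then have "\<mu> \<in> P" by (simp add: simple_iff_left)
    with Cons show ?case
      using mult by (simp add: monoid_prod_def)
  qed
  then show ?thesis using xs(2) by simp
qed

text \<open>The complement \<open>c\<close> of a simple divisor in \<open>\<Delta>\<close> is again simple, hence divides \<open>\<Delta>\<close> on the other side as
  well; regroup \<open>\<mu> c d\<close>, respectively \<open>d c \<mu>\<close>.\<close>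

lemma simple_Delta:
  assumes "\<mu> \<in> \<D>"
  shows "\<exists>\<nu>\<in>P. \<mu> \<otimes> \<Delta> = \<Delta> \<otimes> \<nu>" "\<exists>\<nu>\<in>P. \<Delta> \<otimes> \<mu> = \<nu> \<otimes> \<Delta>"
proof -
  have \<mu>: "\<mu> \<in> P" using assms simple_iff_left by blast
  obtain c where c: "c \<in> P" "\<Delta> = \<mu> \<otimes> c" using assms simple_iff_left by blast
  then have "c \<in> \<D>" using simple_iff_right \<mu> by blast
  then obtain d where d: "d \<in> P" "\<Delta> = c \<otimes> d" using simple_iff_left by blast
  have "\<mu> \<otimes> \<Delta> = \<mu> \<otimes> (c \<otimes> d)" using d(2) by simp
  also have "\<dots> = \<Delta> \<otimes> d"
    using c d(1) \<mu> P_carrier by (simp add: m_assoc)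
  finally show "\<exists>\<nu>\<in>P. \<mu> \<otimes> \<Delta> = \<Delta> \<otimes> \<nu>" using d(1) by blast
  obtain c where c: "c \<in> P" "\<Delta> = c \<otimes> \<mu>" using assms simple_iff_right by blast
  then have "c \<in> \<D>" using simple_iff_left \<mu> by blast
  then obtain d where d: "d \<in> P" "\<Delta> = d \<otimes> c" using simple_iff_right by blast
  have "\<Delta> \<otimes> \<mu> = d \<otimes> (c \<otimes> \<mu>)"
    using c(1) d \<mu> P_carrier by (simp add: m_assoc)
  also have "\<dots> = d \<otimes> \<Delta>" using c(2) by simp
  finally show "\<exists>\<nu>\<in>P. \<Delta> \<otimes> \<mu> = \<nu> \<otimes> \<Delta>" using d(1) by blast
qed

text \<open>Conjugation by \<open>\<Delta>\<close> preserves the monoid, because it does so on the generating simple divisors. This makes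
  right multiplication by \<open>\<Delta>\<close> an automorphism of the order.\<close>

lemma P_Delta:
  assumes "p \<in> P"
  shows "inv \<Delta> \<otimes> p \<otimes> \<Delta> \<in> P \<and> \<Delta> \<otimes> p \<otimes> inv \<Delta> \<in> P"
  using assms
proof (induction p rule: simple_generate)
  case one
  then show ?case using Delta_carrier by simp
next
  case (mult \<mu> r)
  note D = Delta_carrier
  have \<mu>: "\<mu> \<in> P" using mult(1) simple_iff_left by blast
  obtain \<nu> where \<nu>: "\<nu> \<in> P" "\<mu> \<otimes> \<Delta> = \<Delta> \<otimes> \<nu>" using simple_Delta(1)[OF mult(1)] by blast
  obtain \<xi> where \<xi>: "\<xi> \<in> P" "\<Delta> \<otimes> \<mu> = \<xi> \<otimes> \<Delta>" using simple_Delta(2)[OF mult(1)] by blast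
  note c = D \<mu>[THEN P_carrier] \<nu>(1)[THEN P_carrier] \<xi>(1)[THEN P_carrier] mult(2)[THEN P_carrier]
  have "inv \<Delta> \<otimes> \<mu> \<otimes> \<Delta> = \<nu>" "\<Delta> \<otimes> \<mu> \<otimes> inv \<Delta> = \<xi>"
    using \<nu>(2) \<xi>(2) c by (simp_all add: m_assoc inv_solve_left' inv_solve_right)
  moreover have "inv \<Delta> \<otimes> (\<mu> \<otimes> r) \<otimes> \<Delta> = (inv \<Delta> \<otimes> \<mu> \<otimes> \<Delta>) \<otimes> (inv \<Delta> \<otimes> r \<otimes> \<Delta>)"
    "\<Delta> \<otimes> (\<mu> \<otimes> r) \<otimes> inv \<Delta> = (\<Delta> \<otimes> \<mu> \<otimes> inv \<Delta>) \<otimes> (\<Delta> \<otimes> r \<otimes> inv \<Delta>)"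
    using c by (simp_all add: m_assoc) (simp_all add: m_assoc[symmetric])
  ultimately show ?case
    using mult(3) \<nu>(1) \<xi>(1) by simp
qed

definition le :: "'a \<Rightarrow> 'a \<Rightarrow> bool"
  where "le g h \<longleftrightarrow> g \<in> carrier G \<and> h \<in> carrier G \<and> inv g \<otimes> h \<in> P"

lemma le_carrier: "le g h \<Longrightarrow> g \<in> carrier G" "le g h \<Longrightarrow> h \<in> carrier G"
  by (auto simp: le_def)

lemma le_refl: "g \<in> carrier G \<Longrightarrow> le g g"
  by (simp add: le_def)

lemma le_trans:
  assumes "le g h" "le h k" shows "le g k"
proof -
  have c: "g \<in> carrier G" "h \<in> carrier G" "k \<in> carrier G"
    using assms le_carrier by blast+
  have "(inv g \<otimes> h) \<otimes> (inv h \<otimes> k) \<in> P"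
    using assms by (simp add: le_def)
  moreover have "(inv g \<otimes> h) \<otimes> (inv h \<otimes> k) = inv g \<otimes> k"
    using c by (simp add: m_assoc) (simp add: m_assoc[symmetric])
  ultimately show ?thesis using c by (simp add: le_def)
qed

lemma le_antisym:
  assumes "le g h" "le h g" shows "g = h"
proof -
  have c: "g \<in> carrier G" "h \<in> carrier G"
    using assms le_carrier by blast+
  have "inv (inv g \<otimes> h) = inv h \<otimes> g"
    using c by (simp add: inv_mult_group)
  then have "inv g \<otimes> h = \<one>"
    using assms P_inv_trivial by (simp add: le_def)
  then show ?thesis
    using c by (metis inv_equality inv_inv inv_closed)
qed

lemma le_mult_left:
  assumes "k \<in> carrier G" "g \<in> carrier G" "h \<in> carrier G"
  shows "le (k \<otimes> g) (k \<otimes> h) \<longleftrightarrow> le g h"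
proof -
  have "inv (k \<otimes> g) \<otimes> (k \<otimes> h) = inv g \<otimes> h"
    using assms by (simp add: inv_mult_group m_assoc) (simp add: m_assoc[symmetric])
  then show ?thesis using assms by (simp add: le_def)
qed

lemma le_mult_P: "g \<in> carrier G \<Longrightarrow> p \<in> P \<Longrightarrow> le g (g \<otimes> p)"
  using P_carrier[of p] by (simp add: le_def m_assoc[symmetric])

lemma le_Delta:
  assumes "g \<in> carrier G" "h \<in> carrier G"
  shows "le (g \<otimes> \<Delta>) (h \<otimes> \<Delta>) \<longleftrightarrow> le g h"
proof -
  note D = Delta_carrier
  have eq: "inv (g \<otimes> \<Delta>) \<otimes> (h \<otimes> \<Delta>) = inv \<Delta> \<otimes> (inv g \<otimes> h) \<otimes> \<Delta>"
    using assms D by (simp add: inv_mult_group m_assoc)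
  have conj: "\<Delta> \<otimes> (inv \<Delta> \<otimes> (inv g \<otimes> h) \<otimes> \<Delta>) \<otimes> inv \<Delta> = inv g \<otimes> h"
    using assms D by (simp add: m_assoc) (simp add: m_assoc[symmetric])
  have "inv \<Delta> \<otimes> (inv g \<otimes> h) \<otimes> \<Delta> \<in> P \<longleftrightarrow> inv g \<otimes> h \<in> P"
    using P_Delta conj by metis
  then show ?thesis using assms D eq by (simp add: le_def)
qed

lemma le_Delta_pow:
  assumes "g \<in> carrier G" "h \<in> carrier G"
  shows "le (g \<otimes> \<Delta> [^] (n::nat)) (h \<otimes> \<Delta> [^] n) \<longleftrightarrow> le g h"
  using assms Delta_carrier by (induction n) (simp_all add: le_Delta flip: m_assoc)

lemma le_Delta_pow_mono:
  assumes "g \<in> carrier G" "m \<le> n" shows "le (g \<otimes> \<Delta> [^] m) (g \<otimes> \<Delta> [^] (n::nat))"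
  using assms(2)
proof (induction n rule: dec_induct)
  case base
  then show ?case using assms Delta_carrier by (simp add: le_refl)
next
  case (step n)
  have "le (g \<otimes> \<Delta> [^] n) (g \<otimes> \<Delta> [^] n \<otimes> \<Delta>)"
    using assms Delta_carrier Delta_P by (intro le_mult_P) auto
  then show ?case
    using step.IH le_trans assms Delta_carrier by (simp add: m_assoc)
qed

lemma Delta_pow_mono: "m \<le> n \<Longrightarrow> le (\<Delta> [^] m) (\<Delta> [^] (n::nat))"
  using le_Delta_pow_mono[of \<one> m n] Delta_carrier by simp

lemma inv_Delta_pow_mono:
  assumes "m \<le> n" shows "le (inv (\<Delta> [^] (n::nat))) (inv (\<Delta> [^] m))"
proof -
  have "le (inv (\<Delta> [^] n) \<otimes> \<Delta> [^] (0::nat)) (inv (\<Delta> [^] n) \<otimes> \<Delta> [^] (n - m))"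
    using Delta_carrier by (intro le_Delta_pow_mono) auto
  moreover have "inv (\<Delta> [^] n) \<otimes> \<Delta> [^] (n - m) = inv (\<Delta> [^] m)"
  proof -
    have "\<Delta> [^] (n - m) \<otimes> \<Delta> [^] m = \<Delta> [^] n"
      using assms Delta_carrier by (simp add: nat_pow_mult)
    then have "\<Delta> [^] (n - m) = \<Delta> [^] n \<otimes> inv (\<Delta> [^] m)"
      using Delta_carrier by (simp add: inv_solve_right)
    then show ?thesis using Delta_carrier by (simp add: m_assoc[symmetric])
  qed
  ultimately show ?thesis using Delta_carrier by simp
qed

text \<open>Each simple divisor is at most \<open>\<Delta>\<close>, so a product of \<open>n\<close> of them is at most \<open>\<Delta>\<close> to the \<open>n\<close>.\<close>

lemma P_bounded:
  assumes "p \<in> P" shows "\<exists>n::nat. le p (\<Delta> [^] n)"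
  using assms
proof (induction p rule: simple_generate)
  case one
  show ?case by (rule exI[of _ 0]) (simp add: le_refl)
next
  case (mult \<mu> r)
  have \<mu>: "\<mu> \<in> P" using mult(1) simple_iff_left by blast
  obtain c where c: "c \<in> P" "\<Delta> = \<mu> \<otimes> c" using mult(1) simple_iff_left by blast
  obtain n where n: "le r (\<Delta> [^] (n::nat))" using mult(3) by blast
  have "le (\<mu> \<otimes> r) (\<mu> \<otimes> \<Delta> [^] n)"
    using n \<mu> mult(2) P_carrier Delta_carrier by (simp add: le_mult_left)
  moreover have "le \<mu> \<Delta>"
    using le_mult_P[OF P_carrier[OF \<mu>] c(1)] c(2) by simp
  then have "le (\<mu> \<otimes> \<Delta> [^] n) (\<Delta> \<otimes> \<Delta> [^] n)"
    using \<mu> P_carrier Delta_carrier by (simp add: le_Delta_pow)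
  ultimately have "le (\<mu> \<otimes> r) (\<Delta> [^] Suc n)"
    using le_trans nat_pow_Suc2[OF Delta_carrier] by simp
  then show ?case by blast
qed

lemma bounded:
  assumes g: "g \<in> carrier G"
  obtains N :: nat where "\<And>n. N \<le> n \<Longrightarrow> le (inv (\<Delta> [^] n)) g" "\<And>n. N \<le> n \<Longrightarrow> le g (\<Delta> [^] n)"
proof -
  note D = Delta_carrier
  obtain a b where ab: "a \<in> P" "b \<in> P" "g = a \<otimes> inv b"
    using g fractions by auto
  note c = ab(1,2)[THEN P_carrier]
  obtain i :: nat where i: "le a (\<Delta> [^] i)" using P_bounded ab(1) by blast
  obtain j :: nat where j: "le b (\<Delta> [^] j)" using P_bounded ab(2) by blast
  have "le g a"
    using c ab by (simp add: le_def inv_mult_group m_assoc)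
  then have up: "le g (\<Delta> [^] n)" if "i + j \<le> n" for n
    using i le_trans Delta_pow_mono[of i n] that by (meson add_leD1)
  have "le (inv (\<Delta> [^] j)) (a \<otimes> inv (\<Delta> [^] j))"
  proof -
    have "le (inv (\<Delta> [^] j) \<otimes> \<Delta> [^] j) (a \<otimes> inv (\<Delta> [^] j) \<otimes> \<Delta> [^] j)"
      using c D ab(1) by (simp add: m_assoc le_def)
    then show ?thesis using c D by (subst (asm) le_Delta_pow) auto
  qed
  moreover have "le (a \<otimes> inv (\<Delta> [^] j)) g"
  proof -
    have "le (inv (\<Delta> [^] j)) (inv b)"
    proof -
      have "le (inv (\<Delta> [^] j) \<otimes> \<Delta> [^] j) (inv b \<otimes> \<Delta> [^] j)"
        using j c D by (simp add: le_def)
      then show ?thesis using c D by (subst (asm) le_Delta_pow) auto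
    qed
    then show ?thesis using ab(3) c D by (simp add: le_mult_left)
  qed
  ultimately have "le (inv (\<Delta> [^] j)) g" by (rule le_trans)
  then have lo: "le (inv (\<Delta> [^] n)) g" if "i + j \<le> n" for n
    using le_trans inv_Delta_pow_mono[of j n] that by (meson add_leD2)
  show thesis by (rule that[of "i + j"]) (use up lo in auto)
qed

text \<open>Translate by a common lower bound \<open>k\<close> into the monoid, where a left lcm is available. All upper bounds
  of \<open>g\<close> and \<open>h\<close> lie above \<open>k\<close>, so the lcm is least among them too.\<close>

lemma join_exists:
  assumes g: "g \<in> carrier G" and h: "h \<in> carrier G"
  shows "\<exists>s. le g s \<and> le h s \<and> (\<forall>u. le g u \<and> le h u \<longrightarrow> le s u)"
proof -
  obtain N1 where N1: "\<And>n. N1 \<le> n \<Longrightarrow> le (inv (\<Delta> [^] (n::nat))) g" using bounded[OF g] by metis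
  obtain N2 where N2: "\<And>n. N2 \<le> n \<Longrightarrow> le (inv (\<Delta> [^] (n::nat))) h" using bounded[OF h] by metis
  define k where "k = inv (\<Delta> [^] (N1 + N2))"
  have k: "le k g" "le k h" "k \<in> carrier G"
    using N1[of "N1 + N2"] N2[of "N1 + N2"] Delta_carrier by (auto simp: k_def)
  let ?a = "inv k \<otimes> g" and ?b = "inv k \<otimes> h"
  have ab: "?a \<in> P" "?b \<in> P" using k by (auto simp: le_def)
  obtain m where m: "is_lcm Pos (left_divides Pos) ?a ?b m"
    using garside_monoid.lcm_left[OF garside, of ?a ?b] ab by auto
  have mP: "m \<in> P" and div: "\<exists>c\<in>P. m = ?a \<otimes> c" "\<exists>c\<in>P. m = ?b \<otimes> c"
    and least: "\<And>n. \<lbrakk>n \<in> P; \<exists>c\<in>P. n = ?a \<otimes> c; \<exists>c\<in>P. n = ?b \<otimes> c\<rbrakk> \<Longrightarrow> \<exists>c\<in>P. n = m \<otimes> c"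
    using m by (auto simp: is_lcm_def left_divides_def)
  have mc: "m \<in> carrier G" using mP P_carrier by blast
  let ?s = "k \<otimes> m"
  have up: "le x ?s" if x: "x \<in> carrier G" and fac: "\<exists>c\<in>P. m = (inv k \<otimes> x) \<otimes> c" for x
  proof -
    obtain c where c: "c \<in> P" "m = (inv k \<otimes> x) \<otimes> c" using fac by blast
    then have "?s = x \<otimes> c"
      using k(3) x P_carrier[OF c(1)] by (simp add: m_assoc[symmetric])
    then show ?thesis using le_mult_P[OF x c(1)] by simp
  qed
  moreover have "le ?s u" if u: "le g u" "le h u" for u
  proof -
    have uc: "u \<in> carrier G" using u le_carrier by blast
    have fac: "\<exists>c\<in>P. inv k \<otimes> u = (inv k \<otimes> x) \<otimes> c" if "le x u" for x
      using that k(3) uc unfolding le_def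
      by (intro bexI[of _ "inv x \<otimes> u"]) (auto simp: m_assoc inv_solve_left, simp add: m_assoc[symmetric])
    have "inv k \<otimes> u \<in> P" using le_trans[OF k(1) u(1)] by (simp add: le_def)
    then obtain c where c: "c \<in> P" "inv k \<otimes> u = m \<otimes> c"
      using least fac[OF u(1)] fac[OF u(2)] by blast
    have "u = k \<otimes> (inv k \<otimes> u)"
      using k(3) uc by (simp add: m_assoc[symmetric])
    also have "\<dots> = ?s \<otimes> c"
      unfolding c(2) using k(3) mc P_carrier[OF c(1)] by (simp add: m_assoc)
    finally show ?thesis
      using le_mult_P[of ?s c] k(3) mc c(1) by simp
  qed
  ultimately show ?thesis
    using g h div by blast
qed

text \<open>From a common upper bound \<open>k\<close> one looks downwards: lower bounds of \<open>g\<close> and \<open>h\<close> correspond to common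
  right multiples of \<open>inv g \<otimes> k\<close> and \<open>inv h \<otimes> k\<close>. Using right lcms here, and not left gcds, covers all
  lower bounds and not only those in one fixed translate of the monoid.\<close>

lemma meet_exists:
  assumes g: "g \<in> carrier G" and h: "h \<in> carrier G"
  shows "\<exists>s. le s g \<and> le s h \<and> (\<forall>l. le l g \<and> le l h \<longrightarrow> le l s)"
proof -
  obtain N1 where N1: "\<And>n. N1 \<le> n \<Longrightarrow> le g (\<Delta> [^] (n::nat))" using bounded[OF g] by metis
  obtain N2 where N2: "\<And>n. N2 \<le> n \<Longrightarrow> le h (\<Delta> [^] (n::nat))" using bounded[OF h] by metis
  define k where "k = \<Delta> [^] (N1 + N2)"
  have k: "le g k" "le h k" "k \<in> carrier G"
    using N1[of "N1 + N2"] N2[of "N1 + N2"] Delta_carrier by (auto simp: k_def)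
  let ?a = "inv g \<otimes> k" and ?b = "inv h \<otimes> k"
  have ab: "?a \<in> P" "?b \<in> P" using k by (auto simp: le_def)
  obtain m where m: "is_lcm Pos (right_divides Pos) ?a ?b m"
    using garside_monoid.lcm_right[OF garside, of ?a ?b] ab by auto
  have mP: "m \<in> P" and div: "\<exists>c\<in>P. m = c \<otimes> ?a" "\<exists>c\<in>P. m = c \<otimes> ?b"
    and least: "\<And>n. \<lbrakk>n \<in> P; \<exists>c\<in>P. n = c \<otimes> ?a; \<exists>c\<in>P. n = c \<otimes> ?b\<rbrakk> \<Longrightarrow> \<exists>c\<in>P. n = c \<otimes> m"
    using m by (auto simp: is_lcm_def right_divides_def)
  have mc: "m \<in> carrier G" using mP P_carrier by blast
  let ?s = "k \<otimes> inv m"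
  have down: "le ?s x" if x: "x \<in> carrier G" and fac: "\<exists>c\<in>P. m = c \<otimes> (inv x \<otimes> k)" for x
  proof -
    obtain c where c: "c \<in> P" "m = c \<otimes> (inv x \<otimes> k)" using fac by blast
    note cc = P_carrier[OF c(1)]
    have "inv ?s \<otimes> x = m \<otimes> (inv k \<otimes> x)"
      using k(3) mc x by (simp add: inv_mult_group m_assoc)
    also have "\<dots> = c"
      unfolding c(2) using cc k(3) x by (simp add: m_assoc) (simp add: m_assoc[symmetric])
    finally show ?thesis using c(1) k(3) mc x by (simp add: le_def)
  qed
  moreover have "le l ?s" if l: "le l g" "le l h" for l
  proof -
    have lc: "l \<in> carrier G" using l le_carrier by blast
    have fac: "\<exists>c\<in>P. inv l \<otimes> k = c \<otimes> (inv x \<otimes> k)" if "le l x" for x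
      using that k(3) lc unfolding le_def
      by (intro bexI[of _ "inv l \<otimes> x"]) (auto simp: m_assoc, simp add: m_assoc[symmetric])
    have "inv l \<otimes> k \<in> P" using le_trans[OF l(1) k(1)] by (simp add: le_def)
    then obtain c where c: "c \<in> P" "inv l \<otimes> k = c \<otimes> m"
      using least fac[OF l(1)] fac[OF l(2)] by blast
    have "inv l \<otimes> ?s = (inv l \<otimes> k) \<otimes> inv m"
      using lc k(3) mc by (simp add: m_assoc)
    also have "\<dots> = c"
      unfolding c(2) using P_carrier[OF c(1)] mc by (simp add: m_assoc)
    finally show ?thesis using c(1) lc k(3) mc by (simp add: le_def)
  qed
  ultimately show ?thesis
    using g h div by blast
qed

definition join :: "'a \<Rightarrow> 'a \<Rightarrow> 'a"
  where "join g h = (SOME s. le g s \<and> le h s \<and> (\<forall>u. le g u \<and> le h u \<longrightarrow> le s u))"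

definition meet :: "'a \<Rightarrow> 'a \<Rightarrow> 'a"
  where "meet g h = (SOME s. le s g \<and> le s h \<and> (\<forall>l. le l g \<and> le l h \<longrightarrow> le l s))"

lemma join:
  assumes "g \<in> carrier G" "h \<in> carrier G"
  shows "le g (join g h)" "le h (join g h)" "le g u \<Longrightarrow> le h u \<Longrightarrow> le (join g h) u"
  using someI_ex[OF join_exists[OF assms]] unfolding join_def by blast+

lemma meet:
  assumes "g \<in> carrier G" "h \<in> carrier G"
  shows "le (meet g h) g" "le (meet g h) h" "le l g \<Longrightarrow> le l h \<Longrightarrow> le l (meet g h)"
  using someI_ex[OF meet_exists[OF assms]] unfolding meet_def by blast+

lemma join_closed: "g \<in> carrier G \<Longrightarrow> h \<in> carrier G \<Longrightarrow> join g h \<in> carrier G"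
  using join(1) le_carrier by blast

lemma meet_closed: "g \<in> carrier G \<Longrightarrow> h \<in> carrier G \<Longrightarrow> meet g h \<in> carrier G"
  using meet(1) le_carrier by blast

lemma join_mono:
  assumes "le g g'" "le h h'" shows "le (join g h) (join g' h')"
proof -
  note c = assms[THEN le_carrier(1)] assms[THEN le_carrier(2)]
  show ?thesis
    by (rule join(3)[OF c(1,2)])
      (rule le_trans[OF assms(1) join(1)[OF c(3,4)]], rule le_trans[OF assms(2) join(2)[OF c(3,4)]])
qed

lemma meet_mono:
  assumes "le g g'" "le h h'" shows "le (meet g h) (meet g' h')"
proof -
  note c = assms[THEN le_carrier(1)] assms[THEN le_carrier(2)]
  show ?thesis
    by (rule meet(3)[OF c(3,4)])
      (rule le_trans[OF meet(1)[OF c(1,2)] assms(1)], rule le_trans[OF meet(2)[OF c(1,2)] assms(2)])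
qed

lemma join_Delta:
  assumes "g \<in> carrier G" "h \<in> carrier G"
  shows "le (join (g \<otimes> \<Delta>) (h \<otimes> \<Delta>)) (join g h \<otimes> \<Delta>)"
  using join[OF assms] join_closed[OF assms] assms Delta_carrier by (intro join(3)) (simp_all add: le_Delta)

lemma meet_Delta:
  assumes "g \<in> carrier G" "h \<in> carrier G"
  shows "le (meet (g \<otimes> \<Delta>) (h \<otimes> \<Delta>)) (meet g h \<otimes> \<Delta>)"
proof -
  note D = Delta_carrier
  let ?l = "meet (g \<otimes> \<Delta>) (h \<otimes> \<Delta>)"
  have l: "?l \<in> carrier G" using assms D by (intro meet_closed) auto
  have eq: "?l = ?l \<otimes> inv \<Delta> \<otimes> \<Delta>" using l D by (simp add: m_assoc)
  have "le (?l \<otimes> inv \<Delta> \<otimes> \<Delta>) (g \<otimes> \<Delta>)" "le (?l \<otimes> inv \<Delta> \<otimes> \<Delta>) (h \<otimes> \<Delta>)"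
    using meet(1,2)[of "g \<otimes> \<Delta>" "h \<otimes> \<Delta>"] eq assms D by simp_all
  then have "le (?l \<otimes> inv \<Delta>) (meet g h)"
    using assms l D by (intro meet(3)) (simp_all add: le_Delta)
  then have "le (?l \<otimes> inv \<Delta> \<otimes> \<Delta>) (meet g h \<otimes> \<Delta>)"
    using l D meet_closed[OF assms] by (subst le_Delta) auto
  then show ?thesis using eq by simp
qed

definition clamp :: "'a \<Rightarrow> 'a \<Rightarrow> 'a \<Rightarrow> 'a"
  where "clamp L U g = meet (join g L) U"

lemma clamp_closed: "\<lbrakk>L \<in> carrier G; U \<in> carrier G; g \<in> carrier G\<rbrakk> \<Longrightarrow> clamp L U g \<in> carrier G"
  by (simp add: clamp_def meet_closed join_closed)

lemma clamp_mono: "\<lbrakk>le g h; le L L'; le U U'\<rbrakk> \<Longrightarrow> le (clamp L U g) (clamp L' U' h)"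
  unfolding clamp_def by (intro meet_mono join_mono)

lemma clamp_Delta:
  assumes "g \<in> carrier G" "L \<in> carrier G" "U \<in> carrier G"
  shows "le (clamp (L \<otimes> \<Delta>) (U \<otimes> \<Delta>) (g \<otimes> \<Delta>)) (clamp L U g \<otimes> \<Delta>)"
proof -
  have "le (clamp (L \<otimes> \<Delta>) (U \<otimes> \<Delta>) (g \<otimes> \<Delta>)) (meet (join g L \<otimes> \<Delta>) (U \<otimes> \<Delta>))"
    unfolding clamp_def using assms Delta_carrier by (intro meet_mono join_Delta le_refl) auto
  then show ?thesis
    unfolding clamp_def using meet_Delta[OF join_closed[OF assms(1,2)] assms(3)] by (rule le_trans)
qed

lemma clamp_id:
  assumes "le L g" "le g U" shows "clamp L U g = g"
proof -
  have c: "L \<in> carrier G" "g \<in> carrier G" "U \<in> carrier G" using assms le_carrier by blast+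
  have "join g L = g"
    using join[OF c(2,1)] le_refl[OF c(2)] assms(1) le_antisym by blast
  moreover have "meet g U = g"
    using meet[OF c(2,3)] le_refl[OF c(2)] assms(2) le_antisym by blast
  ultimately show ?thesis by (simp add: clamp_def)
qed

lemma clamp_trivial:
  assumes "g \<in> carrier G" "L \<in> carrier G" shows "clamp L L g = L"
proof -
  have "le L (meet (join g L) L)"
    using join[OF assms] join_closed[OF assms] assms by (intro meet(3)) (auto intro: le_refl)
  then show ?thesis
    unfolding clamp_def using meet(2)[OF join_closed[OF assms] assms(2)] le_antisym by blast
qed

end


section \<open>The complex of a Garside group\<close>

context garside_group
begin

abbreviation "K \<equiv> cayley_flag_complex G \<D>"

text \<open>Adjacency together with its direction, and with equality allowed.\<close>

definition adj :: "'a \<Rightarrow> 'a \<Rightarrow> bool"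
  where "adj u v \<longleftrightarrow> le u v \<and> le v (u \<otimes> \<Delta>)"

lemma adj_carrier: "adj u v \<Longrightarrow> u \<in> carrier G" "adj u v \<Longrightarrow> v \<in> carrier G"
  using le_carrier by (auto simp: adj_def)

lemma cancel_left:
  "\<lbrakk>x \<in> carrier G; y \<in> carrier G\<rbrakk> \<Longrightarrow> inv x \<otimes> (x \<otimes> y) = y"
  "\<lbrakk>x \<in> carrier G; y \<in> carrier G\<rbrakk> \<Longrightarrow> x \<otimes> (inv x \<otimes> y) = y"
  by (simp_all add: m_assoc[symmetric])

lemma adj_iff:
  assumes "u \<in> carrier G" "v \<in> carrier G"
  shows "adj u v \<longleftrightarrow> inv u \<otimes> v \<in> \<D>"
proof -
  note D = Delta_carrier
  have eq: "(inv u \<otimes> v) \<otimes> (inv v \<otimes> (u \<otimes> \<Delta>)) = \<Delta>"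
    using assms D by (simp add: m_assoc) (simp add: m_assoc[symmetric])
  have "(\<exists>c\<in>P. \<Delta> = (inv u \<otimes> v) \<otimes> c) \<longleftrightarrow> inv v \<otimes> (u \<otimes> \<Delta>) \<in> P"
  proof
    assume "\<exists>c\<in>P. \<Delta> = (inv u \<otimes> v) \<otimes> c"
    then obtain c where c: "c \<in> P" "\<Delta> = (inv u \<otimes> v) \<otimes> c" by blast
    have "inv v \<otimes> (u \<otimes> \<Delta>) = c"
      unfolding c(2) using assms P_carrier[OF c(1)] by (simp add: m_assoc cancel_left)
    then show "inv v \<otimes> (u \<otimes> \<Delta>) \<in> P" using c(1) by simp
  qed (use eq in metis)
  then show ?thesis
    using assms D unfolding adj_def simple_iff_left le_def by auto
qed

lemma adj_refl: "u \<in> carrier G \<Longrightarrow> adj u u"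
  by (simp add: adj_def le_refl le_mult_P Delta_P)

lemma adj_mult_left:
  assumes "g \<in> carrier G" "adj u v" shows "adj (g \<otimes> u) (g \<otimes> v)"
  using assms adj_carrier[OF assms(2)] Delta_carrier
  by (simp add: adj_def le_mult_left m_assoc)

lemma cayley_edge_iff:
  assumes u: "u \<in> carrier G" and v: "v \<in> carrier G" and ne: "u \<noteq> v"
  shows "{u, v} \<in> cayley_edges G \<D> \<longleftrightarrow> adj u v \<or> adj v u"
proof
  assume "{u, v} \<in> cayley_edges G \<D>"
  then obtain g \<mu> where g: "{u, v} = {g, g \<otimes> \<mu>}" "g \<in> carrier G" "\<mu> \<in> \<D>"
    by (auto simp: cayley_edges_def)
  have \<mu>: "\<mu> \<in> carrier G" using g(3) simple_iff_left P_carrier by blast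
  have "inv g \<otimes> (g \<otimes> \<mu>) = \<mu>"
    using g(2) \<mu> by (simp add: m_assoc[symmetric])
  then have "adj g (g \<otimes> \<mu>)"
    using g(2,3) \<mu> by (simp add: adj_iff)
  then show "adj u v \<or> adj v u"
    using g(1) by (auto simp: doubleton_eq_iff)
next
  have *: "{a, b} \<in> cayley_edges G \<D>" if ab: "adj a b" "a \<noteq> b" for a b
  proof -
    note c = adj_carrier[OF ab(1)]
    have b: "a \<otimes> (inv a \<otimes> b) = b" using c by (rule cancel_left)
    have "inv a \<otimes> b \<noteq> \<one>"
    proof
      assume "inv a \<otimes> b = \<one>"
      then have "b = a" using b c by simp
      then show False using ab(2) by simp
    qed
    then have "inv a \<otimes> b \<in> \<D> - {\<one>}"
      using adj_iff[OF c] ab(1) by simp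
    then have "{a, a \<otimes> (inv a \<otimes> b)} \<in> cayley_edges G \<D>"
      unfolding cayley_edges_def using c(1) by blast
    then show ?thesis unfolding b .
  qed
  assume "adj u v \<or> adj v u"
  then show "{u, v} \<in> cayley_edges G \<D>"
    using *[of u v] *[of v u] ne by (auto simp: insert_commute)
qed

text \<open>Every pair of vertices of a simplex is comparable and \<open>le\<close> is transitive, so the simplices are
  chains.\<close>

lemma simplex_iff:
  "s \<in> K \<longleftrightarrow> finite s \<and> s \<noteq> {} \<and> s \<subseteq> carrier G \<and> (\<forall>u\<in>s. \<forall>v\<in>s. adj u v \<or> adj v u)"
proof -
  have "complete_on (cayley_edges G \<D>) s \<longleftrightarrow> (\<forall>u\<in>s. \<forall>v\<in>s. adj u v \<or> adj v u)" if sc: "s \<subseteq> carrier G"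
  proof -
    have "(u \<noteq> v \<longrightarrow> {u, v} \<in> cayley_edges G \<D>) \<longleftrightarrow> adj u v \<or> adj v u" if "u \<in> s" "v \<in> s" for u v
    proof (cases "u = v")
      case True
      then show ?thesis using adj_refl sc that by auto
    next
      case False
      then show ?thesis using cayley_edge_iff[of u v] sc that by auto
    qed
    then show ?thesis unfolding complete_on_def by simp
  qed
  then show ?thesis
    by (cases "s \<subseteq> carrier G") (simp_all add: cayley_flag_complex_def flag_complex_def)
qed

lemma simplex_carrier: "s \<in> K \<Longrightarrow> u \<in> s \<Longrightarrow> u \<in> carrier G"
  by (auto simp: simplex_iff)

lemma simplex_adjacent: "s \<in> K \<Longrightarrow> u \<in> s \<Longrightarrow> v \<in> s \<Longrightarrow> adj u v \<or> adj v u"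
  by (simp add: simplex_iff)

lemma simplex_adj:
  assumes "s \<in> K" "u \<in> s" "v \<in> s" "le u v" shows "adj u v"
proof (cases "adj u v")
  case False
  then have "adj v u" using simplex_adjacent[OF assms(1-3)] by simp
  then have "u = v" using assms(4) le_antisym by (simp add: adj_def)
  then show ?thesis using \<open>adj v u\<close> by simp
qed

lemma finite_adjacent: "finite {u. adj v u \<or> adj u v}"
proof (rule finite_subset)
  show "{u. adj v u \<or> adj u v} \<subseteq> (\<lambda>\<mu>. v \<otimes> \<mu>) ` \<D> \<union> (\<lambda>\<mu>. v \<otimes> inv \<mu>) ` \<D>"
  proof
    fix u assume u: "u \<in> {u. adj v u \<or> adj u v}"
    then have c: "u \<in> carrier G" "v \<in> carrier G" using adj_carrier by auto
    have "u = v \<otimes> (inv v \<otimes> u)" "u = v \<otimes> inv (inv u \<otimes> v)"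
      using c by (simp_all add: inv_mult_group m_assoc[symmetric])
    then show "u \<in> (\<lambda>\<mu>. v \<otimes> \<mu>) ` \<D> \<union> (\<lambda>\<mu>. v \<otimes> inv \<mu>) ` \<D>"
      using u adj_iff c by blast
  qed
qed (simp add: finite_simple)

sublocale cayley: ordered_complex K le
proof
  show "abstract_simplicial_complex K"
    unfolding abstract_simplicial_complex_def
  proof (intro conjI ballI allI impI)
    fix s assume s: "s \<in> K"
    then show "finite s" "s \<noteq> {}" by (simp_all add: simplex_iff)
    fix t assume t: "t \<subseteq> s \<and> t \<noteq> {}"
    then have "finite t" using \<open>finite s\<close> finite_subset by blast
    then show "t \<in> K" using s t unfolding simplex_iff by blast
  qed
  show "finite {s \<in> K. v \<in> s}" for v
  proof (rule finite_subset)
    show "{s \<in> K. v \<in> s} \<subseteq> Pow {u. adj v u \<or> adj u v}"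
      by (auto simp: simplex_iff)
    show "finite (Pow {u. adj v u \<or> adj u v})"
      using finite_adjacent by (rule finite_Pow_iff[THEN iffD2])
  qed
  fix s u v w assume s: "s \<in> K" and u: "u \<in> s"
  show "le u u" using simplex_carrier[OF s u] by (rule le_refl)
  show "le u v \<Longrightarrow> le v u \<Longrightarrow> u = v" by (rule le_antisym)
  show "le u v \<Longrightarrow> le v w \<Longrightarrow> le u w" by (rule le_trans)
  show "v \<in> s \<Longrightarrow> le u v \<or> le v u" using simplex_adjacent[OF s u, of v] by (auto simp: adj_def)
qed

text \<open>Clamping is monotone, and it commutes with right multiplication by \<open>\<Delta>\<close> if the bounds are moved
  along.\<close>

lemma adj_clamp:
  assumes L: "adj L L'" and U: "adj U U'" and ab: "adj a b"
  shows "adj (clamp L U a) (clamp L' U' b)"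
proof -
  note c = adj_carrier[OF L] adj_carrier[OF U] adj_carrier[OF ab]
  have "le (clamp L' U' b) (clamp (L \<otimes> \<Delta>) (U \<otimes> \<Delta>) (a \<otimes> \<Delta>))"
    using L U ab by (intro clamp_mono) (auto simp: adj_def)
  then have "le (clamp L' U' b) (clamp L U a \<otimes> \<Delta>)"
    using clamp_Delta[of a L U] c by (blast intro: le_trans)
  moreover have "le (clamp L U a) (clamp L' U' b)"
    using L U ab by (intro clamp_mono) (auto simp: adj_def)
  ultimately show ?thesis by (simp add: adj_def)
qed

lemma prism_compatible_clamp:
  assumes L: "adj L L'" and U: "adj U U'"
  shows "cayley.prism_compatible (clamp L U) (clamp L' U')"
  unfolding cayley.prism_compatible_def
proof (intro ballI allI impI)
  let ?p = "clamp L U" and ?q = "clamp L' U'"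
  note c = adj_carrier[OF L] adj_carrier[OF U]
  fix s A B assume s: "s \<in> K" and "A \<subseteq> s \<and> B \<subseteq> s \<and> A \<union> B \<noteq> {} \<and> (\<forall>a\<in>A. \<forall>b\<in>B. le a b)"
  then have A: "A \<subseteq> s" and B: "B \<subseteq> s" and ne: "A \<union> B \<noteq> {}" and AB: "\<And>a b. a \<in> A \<Longrightarrow> b \<in> B \<Longrightarrow> le a b"
    by auto
  have sc: "s \<subseteq> carrier G" and fin: "finite s" using s by (simp_all add: simplex_iff)
  have ss: "adj a a' \<or> adj a' a" if "a \<in> s" "a' \<in> s" for a a'
    using s that by (simp add: simplex_iff)
  have pp: "adj (?p a) (?p a') \<or> adj (?p a') (?p a)" if "a \<in> s" "a' \<in> s" for a a'
    using ss[OF that] adj_clamp[OF adj_refl[OF c(1)] adj_refl[OF c(3)]] by blast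
  have qq: "adj (?q a) (?q a') \<or> adj (?q a') (?q a)" if "a \<in> s" "a' \<in> s" for a a'
    using ss[OF that] adj_clamp[OF adj_refl[OF c(2)] adj_refl[OF c(4)]] by blast
  have pq: "adj (?p a) (?q b)" if "a \<in> A" "b \<in> B" for a b
    using adj_clamp[OF L U] simplex_adj[OF s] A B AB that by blast
  show "?p ` A \<union> ?q ` B \<in> K"
    unfolding simplex_iff
  proof (intro conjI ballI)
    show "finite (?p ` A \<union> ?q ` B)"
      using A B fin finite_subset by blast
    show "?p ` A \<union> ?q ` B \<noteq> {}" using ne by auto
    show "?p ` A \<union> ?q ` B \<subseteq> carrier G"
      using A B sc clamp_closed[OF c(1,3)] clamp_closed[OF c(2,4)] by blast
    fix x y assume "x \<in> ?p ` A \<union> ?q ` B" "y \<in> ?p ` A \<union> ?q ` B"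
    then show "adj x y \<or> adj y x"
      using pp qq pq A B by (elim UnE imageE) (simp_all add: subset_iff)
  qed
qed

text \<open>The upper and the lower end of the interval take turns in moving. Moving both at once in opposite
  directions would violate the hypotheses of \<open>prism_compatible_clamp\<close>.\<close>

definition squeeze :: "nat \<Rightarrow> 'a \<Rightarrow> 'a"
  where "squeeze n = clamp (inv (\<Delta> [^] (n div 2))) (\<Delta> [^] ((n + 1) div 2))"

lemma adj_Delta_pow: "adj (\<Delta> [^] (n::nat)) (\<Delta> [^] Suc n)"
  using Delta_pow_mono[of n "Suc n"] Delta_carrier by (simp add: adj_def le_refl)

lemma adj_inv_Delta_pow: "adj (inv (\<Delta> [^] Suc n)) (inv (\<Delta> [^] (n::nat)))"
proof -
  have "inv (\<Delta> [^] Suc n) \<otimes> \<Delta> = inv (\<Delta> [^] n)"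
    unfolding nat_pow_Suc2[OF Delta_carrier] using Delta_carrier by (simp add: inv_mult_group m_assoc)
  then show ?thesis
    using inv_Delta_pow_mono[of n "Suc n"] Delta_carrier by (simp add: adj_def le_refl)
qed

theorem contractible_garside_complex: "contractible_space (garside_complex G \<D>)"
  unfolding garside_complex_def
proof (rule cayley.contractible_realization)
  have c: "\<Delta> [^] (n::nat) \<in> carrier G" "inv (\<Delta> [^] n) \<in> carrier G" for n
    using Delta_carrier by auto
  show "cayley.prism_compatible (squeeze n) (squeeze (Suc n)) \<or> cayley.prism_compatible (squeeze (Suc n)) (squeeze n)" for n
  proof (cases "even n")
    case True
    then obtain k where n: "n = 2 * k" by (elim evenE)
    have "cayley.prism_compatible (squeeze n) (squeeze (Suc n))"
      unfolding squeeze_def n using adj_refl[OF c(2)] adj_Delta_pow by (intro prism_compatible_clamp) simp_all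
    then show ?thesis by blast
  next
    case False
    then obtain k where n: "n = 2 * k + 1" by (elim oddE)
    have "cayley.prism_compatible (squeeze (Suc n)) (squeeze n)"
      unfolding squeeze_def n using adj_refl[OF c(1)[of "Suc k"]] adj_inv_Delta_pow by (intro prism_compatible_clamp) simp_all
    then show ?thesis by blast
  qed
  show "squeeze 0 v = \<one>" if "v \<in> \<Union>K" for v
    using that simplex_carrier by (auto simp: squeeze_def intro!: clamp_trivial)
  show "\<exists>N. \<forall>n\<ge>N. squeeze n v = v" if "v \<in> \<Union>K" for v
  proof -
    have "v \<in> carrier G" using that simplex_carrier by auto
    then obtain N where N: "\<And>n. N \<le> n \<Longrightarrow> le (inv (\<Delta> [^] (n::nat))) v" "\<And>n. N \<le> n \<Longrightarrow> le v (\<Delta> [^] n)"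
      using bounded by metis
    have "squeeze n v = v" if "2 * N \<le> n" for n
      unfolding squeeze_def using that by (intro clamp_id N) linarith+
    then show ?thesis by blast
  qed
qed

subsection \<open>The action\<close>

abbreviation "pts \<equiv> simplicial_points K"

abbreviation "act \<equiv> garside_action G \<D>"

abbreviation translate :: "'a \<Rightarrow> 'a set \<Rightarrow> 'a set"
  where "translate g s \<equiv> (\<lambda>v. g \<otimes> v) ` s"

lemma topspace_garside: "topspace (garside_complex G \<D>) = pts"
  by (simp add: garside_complex_def cayley.topspace_realization_eq)

lemma support_carrier: "\<alpha> \<in> pts \<Longrightarrow> support \<alpha> \<subseteq> carrier G"
  using cayley.simplicial_pointsD(2) simplex_carrier by blast

lemma act_apply:
  assumes g: "g \<in> carrier G" and \<alpha>: "\<alpha> \<in> pts"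
  shows "act g \<alpha> = (\<lambda>w. if w \<in> carrier G then \<alpha> (inv g \<otimes> w) else 0)"
proof
  fix w
  have "{v. \<alpha> v \<noteq> 0 \<and> g \<otimes> v = w} = (if w \<in> carrier G \<and> \<alpha> (inv g \<otimes> w) \<noteq> 0 then {inv g \<otimes> w} else {})"
  proof -
    have "\<alpha> v \<noteq> 0 \<and> g \<otimes> v = w \<longleftrightarrow> w \<in> carrier G \<and> \<alpha> (inv g \<otimes> w) \<noteq> 0 \<and> v = inv g \<otimes> w" for v
    proof
      assume v: "\<alpha> v \<noteq> 0 \<and> g \<otimes> v = w"
      then have "v \<in> carrier G"
        using support_carrier[OF \<alpha>] by (auto simp: support_def)
      then show "w \<in> carrier G \<and> \<alpha> (inv g \<otimes> w) \<noteq> 0 \<and> v = inv g \<otimes> w"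
        using v g by (auto simp: cancel_left)
    next
      assume "w \<in> carrier G \<and> \<alpha> (inv g \<otimes> w) \<noteq> 0 \<and> v = inv g \<otimes> w"
      then show "\<alpha> v \<noteq> 0 \<and> g \<otimes> v = w"
        using g by (simp add: cancel_left)
    qed
    then show ?thesis by auto
  qed
  then show "act g \<alpha> w = (if w \<in> carrier G then \<alpha> (inv g \<otimes> w) else 0)"
    using \<alpha> by (simp add: garside_action_def topspace_garside realization_map_def)
qed

lemma support_act:
  assumes g: "g \<in> carrier G" and \<alpha>: "\<alpha> \<in> pts"
  shows "support (act g \<alpha>) = translate g (support \<alpha>)"
proof (intro Set.set_eqI iffI)
  fix w assume "w \<in> support (act g \<alpha>)"
  then have w: "w \<in> carrier G" "inv g \<otimes> w \<in> support \<alpha>"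
    by (auto simp: support_def act_apply[OF g \<alpha>] split: if_splits)
  moreover have "w = g \<otimes> (inv g \<otimes> w)" using g w by (simp add: m_assoc[symmetric])
  ultimately show "w \<in> translate g (support \<alpha>)" by blast
next
  fix w assume "w \<in> translate g (support \<alpha>)"
  then obtain v where v: "v \<in> support \<alpha>" "w = g \<otimes> v" by auto
  then have "v \<in> carrier G" using support_carrier[OF \<alpha>] by auto
  then show "w \<in> support (act g \<alpha>)"
    using v g by (simp add: support_def act_apply[OF g \<alpha>] m_assoc[symmetric])
qed

lemma translate_simplex:
  assumes "g \<in> carrier G" "s \<in> K" shows "translate g s \<in> K"
proof -
  have "adj (g \<otimes> u) (g \<otimes> v) \<or> adj (g \<otimes> v) (g \<otimes> u)" if "u \<in> s" "v \<in> s" for u v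
    using simplex_adjacent[OF assms(2) that] adj_mult_left[OF assms(1)] by blast
  then show ?thesis
    using assms unfolding simplex_iff by auto
qed

lemma act_closed:
  assumes g: "g \<in> carrier G" and \<alpha>: "\<alpha> \<in> pts" shows "act g \<alpha> \<in> pts"
  unfolding cayley.simplicial_points_iff
proof (intro conjI allI)
  note P = cayley.simplicial_pointsD[OF \<alpha>]
  show "0 \<le> act g \<alpha> v" for v
    using P(1) by (simp add: act_apply[OF g \<alpha>])
  show "support (act g \<alpha>) \<in> K"
    unfolding support_act[OF g \<alpha>] by (rule translate_simplex[OF g P(2)])
  have inj: "inj_on (\<lambda>v. g \<otimes> v) (support \<alpha>)"
    using support_carrier[OF \<alpha>] g by (auto simp: inj_on_def subset_iff)
  have "sum (act g \<alpha>) (support (act g \<alpha>)) = (\<Sum>v\<in>support \<alpha>. act g \<alpha> (g \<otimes> v))"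
    unfolding support_act[OF g \<alpha>] by (simp add: sum.reindex[OF inj])
  also have "\<dots> = sum \<alpha> (support \<alpha>)"
    using support_carrier[OF \<alpha>] g by (intro sum.cong) (auto simp: act_apply[OF g \<alpha>] m_assoc[symmetric] subset_iff)
  finally show "sum (act g \<alpha>) (support (act g \<alpha>)) = 1" using P(3) by simp
qed

lemma act_mult:
  assumes g: "g \<in> carrier G" and h: "h \<in> carrier G" and \<alpha>: "\<alpha> \<in> pts"
  shows "act (g \<otimes> h) \<alpha> = act g (act h \<alpha>)"
  using assms act_closed[OF h \<alpha>] by (auto simp: act_apply inv_mult_group m_assoc fun_eq_iff)

lemma act_one: assumes \<alpha>: "\<alpha> \<in> pts" shows "act \<one> \<alpha> = \<alpha>"
proof
  fix w show "act \<one> \<alpha> w = \<alpha> w"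
    using support_carrier[OF \<alpha>] by (auto simp: act_apply[OF P_carrier[OF one_closed] \<alpha>] support_def)
qed

lemma group_action_act: "group_action G pts act"
proof -
  have bij: "bij_betw (act g) pts pts" if g: "g \<in> carrier G" for g
  proof (rule bij_betw_byWitness[where f' = "act (inv g)"])
    show "\<forall>a\<in>pts. act (inv g) (act g a) = a"
      using g act_mult[of "inv g" g] act_one by auto
    show "\<forall>a\<in>pts. act g (act (inv g) a) = a"
      using g act_mult[of g "inv g"] act_one by auto
  qed (use g act_closed in auto)
  have Bij: "act g \<in> Bij pts" if g: "g \<in> carrier G" for g
    using bij[OF g] by (simp add: Bij_def garside_action_def topspace_garside)
  have "act \<in> hom G (BijGroup pts)"
  proof (rule homI)
    show "act g \<in> carrier (BijGroup pts)" if "g \<in> carrier G" for g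
      using Bij[OF that] by (simp add: BijGroup_def)
    show "act (g \<otimes> h) = act g \<otimes>\<^bsub>BijGroup pts\<^esub> act h" if gh: "g \<in> carrier G" "h \<in> carrier G" for g h
    proof
      fix \<alpha>
      have "act (g \<otimes> h) \<alpha> = compose pts (act g) (act h) \<alpha>"
        using gh act_mult by (cases "\<alpha> \<in> pts") (auto simp: compose_def garside_action_def topspace_garside)
      then show "act (g \<otimes> h) \<alpha> = (act g \<otimes>\<^bsub>BijGroup pts\<^esub> act h) \<alpha>"
        using gh Bij by (simp add: BijGroup_def)
    qed
  qed
  then show ?thesis
    by (simp add: group_action_def group_hom_def group_hom_axioms_def is_group group_BijGroup)
qed

lemma continuous_act:
  assumes g: "g \<in> carrier G"
  shows "continuous_map (garside_complex G \<D>) (garside_complex G \<D>) (act g)"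
proof -
  have "continuous_on pts (\<lambda>\<alpha>. (\<lambda>w. if w \<in> carrier G then \<alpha> (inv g \<otimes> w) else 0))"
  proof (rule continuous_on_coordinatewise_then_product)
    fix w show "continuous_on pts (\<lambda>\<alpha>. if w \<in> carrier G then \<alpha> (inv g \<otimes> w) else 0)"
      by (cases "w \<in> carrier G") (auto intro!: continuous_intros)
  qed
  then have "continuous_on pts (act g)"
    by (rule continuous_on_eq) (simp add: act_apply[OF g])
  then show ?thesis
    unfolding garside_complex_def cayley.realization_eq using act_closed[OF g]
    by (auto simp: continuous_map_subtopology_eu)
qed

lemma simplex_minimum:
  assumes "s \<in> K" obtains m where "m \<in> s" "\<And>v. v \<in> s \<Longrightarrow> le m v"
proof -
  have "\<exists>m\<in>t. \<forall>v\<in>t. le m v" if "finite t" "t \<noteq> {}" "t \<subseteq> s" for t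
    using that
  proof (induction t rule: finite_ne_induct)
    case (singleton x)
    then show ?case using cayley.le_refl[OF assms] by auto
  next
    case (insert x t)
    then obtain m where m: "m \<in> t" "\<And>v. v \<in> t \<Longrightarrow> le m v" by auto
    consider "le x m" | "le m x" using cayley.le_total[OF assms, of x m] m insert.prems by auto
    then show ?case
    proof cases
      case 1
      then have "\<forall>v\<in>insert x t. le x v"
        using m(2) le_trans cayley.le_refl[OF assms] insert.prems by auto
      then show ?thesis by blast
    next
      case 2
      then show ?thesis using m by blast
    qed
  qed
  from this[OF cayley.simplex_finite[OF assms] cayley.simplex_nonempty[OF assms] order_refl]
  obtain m where "m \<in> s" "\<forall>v\<in>s. le m v" by auto
  then show thesis by (intro that) auto
qed

text \<open>A translation that preserves a finite chain preserves its least element \<open>m\<close>, and \<open>g \<otimes> m = m\<close> forces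
  \<open>g = \<one>\<close>.\<close>

lemma translate_fixed:
  assumes g: "g \<in> carrier G" and s: "s \<in> K" and eq: "translate g s = s"
  shows "g = \<one>"
proof -
  obtain m where m: "m \<in> s" "\<And>v. v \<in> s \<Longrightarrow> le m v"
    using simplex_minimum[OF s] by blast
  have mc: "m \<in> carrier G" using simplex_carrier[OF s m(1)] .
  have "g \<otimes> m \<in> s" using m(1) eq by blast
  then have 1: "le m (g \<otimes> m)" using m(2) by blast
  obtain v where v: "v \<in> s" "m = g \<otimes> v" using m(1) eq by blast
  have vc: "v \<in> carrier G" using simplex_carrier[OF s v(1)] .
  have "le (g \<otimes> m) (g \<otimes> v)"
    using m(2)[OF v(1)] g mc vc by (simp add: le_mult_left)
  then have "g \<otimes> m = m"
    using 1 v(2) le_antisym by simp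
  then show ?thesis
    using g mc by simp
qed

text \<open>Start with the open stars of a vertex \<open>v\<close> of \<open>x\<close> and a vertex \<open>w\<close> of \<open>y\<close>. A translate of the first meets
  the second only if \<open>inv g \<otimes> w\<close> is a neighbour of \<open>v\<close>, which happens for finitely many \<open>g\<close>; those that do not
  take \<open>x\<close> to \<open>y\<close> are dealt with one by one by the Hausdorff property.\<close>

lemma act_properly_discontinuous:
  assumes x: "x \<in> pts" and y: "y \<in> pts"
  shows "\<exists>U V. openin (garside_complex G \<D>) U \<and> openin (garside_complex G \<D>) V \<and> x \<in> U \<and> y \<in> V \<and>
           (\<forall>g\<in>carrier G. act g x \<noteq> y \<longrightarrow> act g ` U \<inter> V = {})"
proof -
  let ?X = "garside_complex G \<D>"
  have T: "topspace ?X = pts" by (rule topspace_garside)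
  have X: "?X = top_of_set pts" by (simp add: garside_complex_def cayley.realization_eq)
  obtain v where v: "0 < x v" using cayley.positive_vertex[OF x] .
  obtain w where w: "0 < y w" using cayley.positive_vertex[OF y] .
  have vc: "v \<in> carrier G" and wc: "w \<in> carrier G"
    using support_carrier[OF x] support_carrier[OF y] v w by (auto simp: support_def)
  define F where "F = {g \<in> carrier G. inv g \<otimes> w \<in> cayley.neighbours v \<and> act g x \<noteq> y}"
  have "finite F"
  proof (rule finite_imageD)
    show "finite ((\<lambda>g. inv g \<otimes> w) ` F)"
      by (rule finite_subset[OF _ cayley.finite_neighbours[of v]]) (auto simp: F_def)
    show "inj_on (\<lambda>g. inv g \<otimes> w) F"
    proof (rule inj_onI)
      fix g h assume gh: "g \<in> F" "h \<in> F" "inv g \<otimes> w = inv h \<otimes> w"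
      then have c: "g \<in> carrier G" "h \<in> carrier G" by (auto simp: F_def)
      then have "inv g = inv h" using gh(3) wc by simp
      then show "g = h" using c by (metis inv_inv)
    qed
  qed
  have "\<exists>A B. openin ?X A \<and> openin ?X B \<and> act g x \<in> A \<and> y \<in> B \<and> disjnt A B" if "g \<in> F" for g
    using cayley.Hausdorff_realization act_closed[OF _ x] y that T
    unfolding Hausdorff_space_def garside_complex_def[symmetric] F_def by auto
  then obtain A B where AB: "\<And>g. g \<in> F \<Longrightarrow> openin ?X (A g) \<and> openin ?X (B g) \<and> act g x \<in> A g \<and> y \<in> B g \<and> disjnt (A g) (B g)"
    by metis
  have star: "openin ?X (pts \<inter> {\<gamma>. 0 < \<gamma> u})" for u
    unfolding X by (intro openin_open_Int open_Collect_less continuous_intros)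
  define U where "U = (pts \<inter> {\<gamma>. 0 < \<gamma> v}) \<inter> ((\<Inter>g\<in>F. {\<gamma> \<in> topspace ?X. act g \<gamma> \<in> A g}) \<inter> topspace ?X)"
  define V where "V = (pts \<inter> {\<gamma>. 0 < \<gamma> w}) \<inter> ((\<Inter>g\<in>F. B g) \<inter> topspace ?X)"
  have pre: "openin ?X {\<gamma> \<in> topspace ?X. act g \<gamma> \<in> A g}" if "g \<in> F" for g
    using continuous_act[of g] AB[OF that] that unfolding continuous_map_def F_def by blast
  have "openin ?X U"
    unfolding U_def by (rule openin_Int[OF star openin_INT[OF \<open>finite F\<close> pre]])
  moreover have "openin ?X V"
    unfolding V_def by (rule openin_Int[OF star openin_INT[OF \<open>finite F\<close>]]) (simp add: AB)
  moreover have "x \<in> U" "y \<in> V"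
    using x y v w AB T by (auto simp: U_def V_def)
  moreover have "act g ` U \<inter> V = {}" if g: "g \<in> carrier G" "act g x \<noteq> y" for g
  proof (rule ccontr)
    assume "act g ` U \<inter> V \<noteq> {}"
    then obtain \<gamma> where \<gamma>: "\<gamma> \<in> U" "act g \<gamma> \<in> V" by auto
    have \<gamma>p: "\<gamma> \<in> pts" "0 < \<gamma> v" using \<gamma>(1) by (auto simp: U_def)
    have "0 < act g \<gamma> w" using \<gamma>(2) by (auto simp: V_def)
    then have "0 < \<gamma> (inv g \<otimes> w)"
      using wc by (simp add: act_apply[OF g(1) \<gamma>p(1)])
    then have "inv g \<otimes> w \<in> cayley.neighbours v"
      using cayley.support_neighbours[OF \<gamma>p(1), of v] \<gamma>p(2) by (auto simp: support_def)
    then have "g \<in> F" using g by (simp add: F_def)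
    then have "act g \<gamma> \<in> A g" "act g \<gamma> \<in> B g"
      using \<gamma> by (auto simp: U_def V_def)
    then show False using AB[OF \<open>g \<in> F\<close>] by (auto simp: disjnt_iff)
  qed
  ultimately show ?thesis by blast
qed

lemma free_discontinuous_act: "free_discontinuous_action G (garside_complex G \<D>) act"
proof -
  interpret group_action G "topspace (garside_complex G \<D>)" act
    unfolding topspace_garside by (rule group_action_act)
  show ?thesis
  proof
    show "continuous_map (garside_complex G \<D>) (garside_complex G \<D>) (act g)" if "g \<in> carrier G" for g
      by (rule continuous_act[OF that])
    show "\<exists>U V. openin (garside_complex G \<D>) U \<and> openin (garside_complex G \<D>) V \<and> x \<in> U \<and> y \<in> V \<and>
           (\<forall>g\<in>carrier G. act g x \<noteq> y \<longrightarrow> act g ` U \<inter> V = {})"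
      if "x \<in> topspace (garside_complex G \<D>)" "y \<in> topspace (garside_complex G \<D>)" for x y
      using act_properly_discontinuous that unfolding topspace_garside .
    show "g = \<one>" if "g \<in> carrier G" "x \<in> topspace (garside_complex G \<D>)" "act g x = x" for g x
    proof (rule translate_fixed[OF that(1)])
      have x: "x \<in> pts" using that(2) by (simp add: topspace_garside)
      then show "support x \<in> K" by (rule cayley.simplicial_pointsD(2))
      show "translate g (support x) = support x"
        using support_act[OF that(1) x] that(3) by simp
    qed
  qed
qed

end


section \<open>The quotient complex\<close>

context garside_group
begin

sublocale action: free_discontinuous_action G "garside_complex G \<D>" act
  by (rule free_discontinuous_act)

abbreviation "X \<equiv> garside_complex G \<D>"

abbreviation "Y \<equiv> orbit_space G X act"

abbreviation "orb \<equiv> orbit G act"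

lemma act_open_simplex:
  assumes g: "g \<in> carrier G" and s: "s \<in> K"
  shows "act g ` open_simplex s = open_simplex (translate g s)"
proof -
  have fwd: "act h ` open_simplex t \<subseteq> open_simplex (translate h t)" if h: "h \<in> carrier G" and t: "t \<in> K" for h t
  proof
    fix \<beta> assume "\<beta> \<in> act h ` open_simplex t"
    then obtain \<alpha> where \<alpha>: "\<alpha> \<in> pts" "support \<alpha> = t" "\<beta> = act h \<alpha>"
      using cayley.open_simplex_simplicial_points[OF t] by auto
    then show "\<beta> \<in> open_simplex (translate h t)"
      using cayley.open_simplex_simplicial_points[OF translate_simplex[OF h t]] act_closed[OF h] support_act[OF h] by auto
  qed
  have back_translate: "translate (inv g) (translate g s) = s"
  proof -
    have "(\<lambda>v. inv g \<otimes> (g \<otimes> v)) ` s = (\<lambda>v. v) ` s"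
      using simplex_carrier[OF s] g by (intro image_cong) (auto simp: cancel_left)
    then show ?thesis by (simp add: image_image)
  qed
  have "open_simplex (translate g s) \<subseteq> act g ` open_simplex s"
  proof
    fix \<beta> assume \<beta>: "\<beta> \<in> open_simplex (translate g s)"
    have bp: "\<beta> \<in> pts"
      using \<beta> cayley.open_simplex_simplicial_points[OF translate_simplex[OF g s]] by simp
    have "act (inv g) \<beta> \<in> open_simplex s"
      using fwd[OF _ translate_simplex[OF g s], of "inv g"] g \<beta> unfolding back_translate by blast
    moreover have "act g (act (inv g) \<beta>) = \<beta>"
      using act_mult[of g "inv g" \<beta>] g bp act_one by simp
    ultimately show "\<beta> \<in> act g ` open_simplex s" by force
  qed
  then show ?thesis using fwd[OF g s] by blast
qed

lemma orb_open_simplex_translate: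
  assumes g: "g \<in> carrier G" and s: "s \<in> K"
  shows "orb ` open_simplex (translate g s) = orb ` open_simplex s"
proof -
  have "orb (act g \<alpha>) = orb \<alpha>" if "\<alpha> \<in> open_simplex s" for \<alpha>
    using that cayley.open_simplex_subset[OF s] by (intro action.q_act[OF g]) (auto simp: topspace_garside)
  then show ?thesis
    unfolding act_open_simplex[OF g s, symmetric] image_image by (intro image_cong) auto
qed

lemma orb_eq_support:
  assumes "\<alpha> \<in> pts" "\<beta> \<in> pts" "orb \<alpha> = orb \<beta>"
  obtains g where "g \<in> carrier G" "\<beta> = act g \<alpha>" "support \<beta> = translate g (support \<alpha>)"
proof -
  obtain g where g: "g \<in> carrier G" "\<beta> = act g \<alpha>"
    using action.q_eq_iff[of \<alpha> \<beta>] assms by (auto simp: topspace_garside)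
  show thesis
    by (rule that[OF g]) (simp add: g(2) support_act[OF g(1) assms(1)])
qed

lemma card_translate:
  assumes "g \<in> carrier G" "s \<in> K" shows "card (translate g s) = card s"
  using simplex_carrier[OF assms(2)] assms(1) by (intro card_image) (auto simp: inj_on_def)

text \<open>An orbit remembers the support of its points up to translation.\<close>

lemma orb_open_simplex_meet:
  assumes s: "s \<in> K" and t: "t \<in> K" and ne: "orb ` open_simplex s \<inter> orb ` open_simplex t \<noteq> {}"
  shows "orb ` open_simplex s = orb ` open_simplex t" "card s = card t"
proof -
  obtain \<alpha> \<beta> where ab: "\<alpha> \<in> open_simplex s" "\<beta> \<in> open_simplex t" "orb \<alpha> = orb \<beta>"
    using ne by auto
  then have p: "\<alpha> \<in> pts" "support \<alpha> = s" "\<beta> \<in> pts" "support \<beta> = t"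
    using cayley.open_simplex_simplicial_points s t by auto
  obtain g where g: "g \<in> carrier G" "t = translate g s"
    using orb_eq_support[OF p(1,3) ab(3)] p(2,4) by metis
  show "orb ` open_simplex s = orb ` open_simplex t" "card s = card t"
    unfolding g(2) using orb_open_simplex_translate[OF g(1) s] card_translate[OF g(1) s] by simp_all
qed

text \<open>The orbit map embeds every open simplex: an open simplex is relatively open in the union of its
  translates, and it meets each orbit at most once.\<close>

lemma homeomorphic_map_open_cell:
  assumes s: "s \<in> K"
  shows "homeomorphic_map (subtopology X (open_simplex s)) (subtopology Y (orb ` open_simplex s)) orb"
proof (rule bijective_open_imp_homeomorphic_map)
  let ?e = "open_simplex s"
  have XT: "topspace X = pts" by (rule topspace_garside)
  have eX: "?e \<subseteq> topspace X" using cayley.open_simplex_subset[OF s] XT by simp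
  show "continuous_map (subtopology X ?e) (subtopology Y (orb ` ?e)) orb"
    using action.continuous_map_q by (auto simp: continuous_map_in_subtopology continuous_map_from_subtopology)
  show "orb ` topspace (subtopology X ?e) = topspace (subtopology Y (orb ` ?e))"
    using eX action.topspace_B by auto
  show "inj_on orb (topspace (subtopology X ?e))"
  proof (rule inj_onI)
    fix \<alpha> \<beta> assume "\<alpha> \<in> topspace (subtopology X ?e)" "\<beta> \<in> topspace (subtopology X ?e)" and eq: "orb \<alpha> = orb \<beta>"
    then have p: "\<alpha> \<in> pts" "support \<alpha> = s" "\<beta> \<in> pts" "support \<beta> = s"
      using cayley.open_simplex_simplicial_points[OF s] by auto
    obtain g where g: "g \<in> carrier G" "\<beta> = act g \<alpha>" "s = translate g s"
      using orb_eq_support[OF p(1,3) eq] p(2,4) by metis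
    then have "g = \<one>" using translate_fixed[OF g(1) s] by simp
    then show "\<alpha> = \<beta>" using g(2) act_one[OF p(1)] by simp
  qed
  define S where "S = {\<alpha> \<in> topspace X. orb \<alpha> \<in> orb ` ?e}"
  have eS: "?e \<subseteq> S" using eX by (auto simp: S_def)
  have "?e = S \<inter> {\<alpha>. \<forall>v\<in>s. 0 < \<alpha> v}"
  proof (intro Set.set_eqI iffI)
    fix \<alpha> assume \<alpha>: "\<alpha> \<in> S \<inter> {\<alpha>. \<forall>v\<in>s. 0 < \<alpha> v}"
    then obtain \<beta> where \<beta>: "\<beta> \<in> ?e" "orb \<beta> = orb \<alpha>" and ap: "\<alpha> \<in> pts"
      using XT by (auto simp: S_def)
    have bp: "\<beta> \<in> pts" "support \<beta> = s" using \<beta>(1) cayley.open_simplex_simplicial_points[OF s] by auto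
    obtain g where g: "g \<in> carrier G" "support \<alpha> = translate g s"
      using orb_eq_support[OF bp(1) ap \<beta>(2)] bp(2) by metis
    have "s \<subseteq> support \<alpha>" using \<alpha> by (force simp: support_def)
    moreover have "card (support \<alpha>) = card s" using g card_translate[OF g(1) s] by simp
    ultimately have "support \<alpha> = s"
      using card_subset_eq[of "support \<alpha>" s] cayley.simplicial_pointsD(4)[OF ap] by simp
    then show "\<alpha> \<in> ?e" using ap cayley.open_simplex_simplicial_points[OF s] by simp
  qed (use eS in \<open>auto simp: open_simplex_def\<close>)
  moreover have "open {\<alpha> :: 'a \<Rightarrow> real. \<forall>v\<in>s. 0 < \<alpha> v}"
  proof -
    have "open (\<Inter>v\<in>s. {\<alpha> :: 'a \<Rightarrow> real. 0 < \<alpha> v})"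
      using cayley.simplex_finite[OF s] by (intro open_INT ballI open_Collect_less continuous_intros)
    moreover have "(\<Inter>v\<in>s. {\<alpha> :: 'a \<Rightarrow> real. 0 < \<alpha> v}) = {\<alpha>. \<forall>v\<in>s. 0 < \<alpha> v}" by auto
    ultimately show ?thesis by simp
  qed
  moreover have "subtopology X S = top_of_set S"
  proof -
    have "X = top_of_set pts" by (simp add: garside_complex_def cayley.realization_eq)
    moreover have "S \<subseteq> pts" by (auto simp: S_def XT)
    ultimately show ?thesis by (simp add: subtopology_subtopology Int_absorb1)
  qed
  ultimately have eopen: "openin (subtopology X S) ?e"
    by (simp add: openin_open_Int)
  have "open_map (subtopology X S) (subtopology Y (orb ` ?e)) orb"
    by (rule open_map_restriction[OF action.open_map_q]) (simp add: S_def)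
  then show "open_map (subtopology X ?e) (subtopology Y (orb ` ?e)) orb"
    unfolding open_map_def
  proof (intro allI impI)
    fix W assume o: "\<forall>U. openin (subtopology X S) U \<longrightarrow> openin (subtopology Y (orb ` ?e)) (orb ` U)"
      and W: "openin (subtopology X ?e) W"
    have "subtopology X ?e = subtopology (subtopology X S) ?e"
      using eS by (simp add: subtopology_subtopology Int_absorb1)
    then have "openin (subtopology X S) W"
      using W eopen openin_trans_full by metis
    then show "openin (subtopology Y (orb ` ?e)) (orb ` W)" using o by blast
  qed
qed

lemma garside_cells_eq: "garside_cells G \<D> = open_simplex ` K"
  by (simp add: garside_cells_def)

lemma orbit_cells_eq: "orbit_cells G (garside_cells G \<D>) act = (\<lambda>s. orb ` open_simplex s) ` K"
  by (simp add: orbit_cells_def garside_cells_def image_image)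

text \<open>Translating the least vertex of a simplex to \<open>\<one>\<close> moves all its vertices into the finite set of simple
  divisors.\<close>

lemma finite_orbit_cells: "finite (orbit_cells G (garside_cells G \<D>) act)"
proof (rule finite_subset)
  show "orbit_cells G (garside_cells G \<D>) act \<subseteq> (\<lambda>s. orb ` open_simplex s) ` Pow \<D>"
  proof
    fix e assume "e \<in> orbit_cells G (garside_cells G \<D>) act"
    then obtain s where s: "s \<in> K" "e = orb ` open_simplex s" by (auto simp: orbit_cells_eq)
    obtain m where m: "m \<in> s" "\<And>v. v \<in> s \<Longrightarrow> le m v" using simplex_minimum[OF s(1)] by blast
    have mc: "m \<in> carrier G" using simplex_carrier[OF s(1) m(1)] .
    have "translate (inv m) s \<subseteq> \<D>"
      using simplex_adj[OF s(1) m(1)] m(2) adj_iff[OF mc] simplex_carrier[OF s(1)] by auto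
    moreover have "e = orb ` open_simplex (translate (inv m) s)"
      using orb_open_simplex_translate[OF _ s(1), of "inv m"] mc s(2) by simp
    ultimately show "e \<in> (\<lambda>s. orb ` open_simplex s) ` Pow \<D>" by blast
  qed
qed (simp add: finite_simple)

text \<open>The characteristic maps are those of the complex followed by the orbit map. With finitely many cells
  the coherence condition is automatic.\<close>

proposition finite_CW_quotient:
  "finite_CW_complex Y (orbit_cells G (garside_cells G \<D>) act)"
  unfolding finite_CW_complex_def
proof (intro conjI)
  let ?C = "(\<lambda>s. orb ` open_simplex s) ` K"
  show "finite (orbit_cells G (garside_cells G \<D>) act)" by (rule finite_orbit_cells)
  have fin: "finite ?C" using finite_orbit_cells by (simp add: orbit_cells_eq)
  have XT: "topspace X = pts" by (rule topspace_garside)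
  have UC: "\<Union>?C = topspace Y"
  proof -
    have "\<Union>?C = orb ` \<Union>(open_simplex ` K)" by auto
    then show ?thesis by (simp add: cayley.Union_open_simplex action.topspace_B XT)
  qed
  show "CW_complex Y (orbit_cells G (garside_cells G \<D>) act)"
    unfolding orbit_cells_eq CW_complex_def
  proof (intro conjI allI impI)
    show "Hausdorff_space Y" by (rule action.Hausdorff_orbit_space)
    show "\<Union>?C = topspace Y" by (rule UC)
    show "pairwise disjnt ?C"
      unfolding pairwise_def disjnt_def
    proof (intro ballI impI)
      fix e e' assume "e \<in> ?C" "e' \<in> ?C" "e \<noteq> e'"
      then show "e \<inter> e' = {}" using orb_open_simplex_meet(1) by blast
    qed
    show "\<exists>dim. \<forall>e\<in>?C. \<exists>\<Phi>. characteristic_map Y (dim e) e \<Phi> \<and>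
       (\<exists>F. finite F \<and> F \<subseteq> {e' \<in> ?C. dim e' < dim e} \<and> \<Phi> ` disc_boundary (dim e) \<subseteq> \<Union>F)"
    proof -
      (* All simplices over the same cell of the quotient have the same number of vertices. *)
      define dim where "dim e = (SOME n. \<exists>s\<in>K. e = orb ` open_simplex s \<and> n = card s - 1)" for e
      have dim: "dim (orb ` open_simplex s) = card s - 1" if s: "s \<in> K" for s
        unfolding dim_def
      proof (rule some_equality)
        show "\<exists>t\<in>K. orb ` open_simplex s = orb ` open_simplex t \<and> card s - 1 = card t - 1" using s by blast
        fix n assume "\<exists>t\<in>K. orb ` open_simplex s = orb ` open_simplex t \<and> n = card t - 1"
        then obtain t where t: "t \<in> K" "orb ` open_simplex s = orb ` open_simplex t" "n = card t - 1" by blast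
        then have "orb ` open_simplex s \<inter> orb ` open_simplex t \<noteq> {}"
          using cayley.open_simplex_nonempty[OF t(1)] by simp
        then show "n = card s - 1" using orb_open_simplex_meet(2)[OF s t(1)] t(3) by simp
      qed
      have "\<exists>\<Phi>. characteristic_map Y (dim e) e \<Phi> \<and>
         (\<exists>F. finite F \<and> F \<subseteq> {e' \<in> ?C. dim e' < dim e} \<and> \<Phi> ` disc_boundary (dim e) \<subseteq> \<Union>F)"
        if e: "e \<in> ?C" for e
      proof -
        obtain s where s: "s \<in> K" "e = orb ` open_simplex s" using e by blast
        let ?n = "card s - 1"
        obtain \<Phi> where \<Phi>: "characteristic_map (realization K) ?n (open_simplex s) \<Phi>"
          "\<Phi> ` topspace (closed_disc ?n) \<subseteq> closed_simplex s"
          "\<Phi> ` disc_boundary ?n \<subseteq> \<Union>(open_simplex ` {t. t \<subset> s \<and> t \<noteq> {}})"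
          by (rule cayley.simplex_characteristic_map[OF s(1)])
        have \<Phi>1: "continuous_map (closed_disc ?n) X \<Phi>"
          "homeomorphic_map (open_disc ?n) (subtopology X (open_simplex s)) \<Phi>"
          using \<Phi>(1) by (simp_all add: characteristic_map_def garside_complex_def)
        have "characteristic_map Y ?n e (orb \<circ> \<Phi>)"
          unfolding characteristic_map_def s(2)
          using continuous_map_compose[OF \<Phi>1(1) action.continuous_map_q]
            homeomorphic_map_compose[OF \<Phi>1(2) homeomorphic_map_open_cell[OF s(1)]] by simp
        moreover define F where "F = (\<lambda>t. orb ` open_simplex t) ` {t. t \<subset> s \<and> t \<noteq> {}}"
        have "finite {t. t \<subset> s \<and> t \<noteq> {}}"
          using cayley.simplex_finite[OF s(1)] by (auto intro: finite_subset[of _ "Pow s"])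
        then have "finite F" by (simp add: F_def)
        moreover have "F \<subseteq> {e' \<in> ?C. dim e' < ?n}"
        proof
          fix x assume "x \<in> F"
          then obtain t where t: "t \<subset> s" "t \<noteq> {}" "x = orb ` open_simplex t" by (auto simp: F_def)
          then have tK: "t \<in> K" using cayley.simplex_face[OF s(1), of t] by auto
          have "card t < card s" "card t > 0"
            using t cayley.simplex_finite[OF s(1)] cayley.simplex_finite[OF tK]
            by (auto simp: psubset_card_mono card_gt_0_iff)
          then show "x \<in> {e' \<in> ?C. dim e' < ?n}" using tK t(3) dim[OF tK] by auto
        qed
        moreover have "(orb \<circ> \<Phi>) ` disc_boundary ?n \<subseteq> \<Union>F"
        proof -
          have "orb ` \<Phi> ` disc_boundary ?n \<subseteq> orb ` \<Union>(open_simplex ` {t. t \<subset> s \<and> t \<noteq> {}})"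
            using \<Phi>(3) by (rule image_mono)
          also have "\<dots> = \<Union>F" by (auto simp: F_def)
          finally show ?thesis by (simp add: image_comp)
        qed
        moreover have "dim e = ?n" using dim[OF s(1)] s(2) by simp
        ultimately show ?thesis by (intro exI[of _ "orb \<circ> \<Phi>"] conjI exI[of _ F]) simp_all
      qed
      then show ?thesis by (intro exI[of _ dim]) blast
    qed
    fix A assume A: "A \<subseteq> topspace Y"
    show "closedin Y A \<longleftrightarrow> (\<forall>e\<in>?C. closedin Y (A \<inter> Y closure_of e))"
    proof
      assume "closedin Y A"
      then show "\<forall>e\<in>?C. closedin Y (A \<inter> Y closure_of e)"
        by (intro ballI closedin_Int closedin_closure_of)
    next
      assume R: "\<forall>e\<in>?C. closedin Y (A \<inter> Y closure_of e)"
      have sub: "e \<subseteq> Y closure_of e" if "e \<in> ?C" for e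
      proof (rule closure_of_subset)
        show "e \<subseteq> topspace Y" using UC that by blast
      qed
      have "A = (\<Union>e\<in>?C. A \<inter> Y closure_of e)"
      proof (intro antisym subsetI)
        fix x assume x: "x \<in> A"
        then obtain e where e: "e \<in> ?C" "x \<in> e" using A UC by blast
        then have "x \<in> A \<inter> Y closure_of e" using x sub by blast
        then show "x \<in> (\<Union>e\<in>?C. A \<inter> Y closure_of e)" by (rule UN_I[OF e(1)])
      qed auto
      moreover have "closedin Y (\<Union>e\<in>?C. A \<inter> Y closure_of e)"
      proof (rule closedin_Union)
        show "finite ((\<lambda>e. A \<inter> Y closure_of e) ` ?C)" using fin by (rule finite_imageI)
        show "closedin Y S" if "S \<in> (\<lambda>e. A \<inter> Y closure_of e) ` ?C" for S
          using that R by blast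
      qed
      ultimately show "closedin Y A" by simp
    qed
  qed
qed

proposition G_complex_garside: "G_complex G X (garside_cells G \<D>) act"
  unfolding G_complex_def
proof (intro conjI ballI)
  show "CW_complex X (garside_cells G \<D>)"
    using cayley.CW_complex_realization by (simp add: garside_cells_eq garside_complex_def)
  show "group_action G (topspace X) act"
    unfolding topspace_garside by (rule group_action_act)
  fix g assume g: "g \<in> carrier G"
  show "homeomorphic_map X X (act g)" by (rule action.homeomorphic_action[OF g])
  fix e assume "e \<in> garside_cells G \<D>"
  then obtain s where "s \<in> K" "e = open_simplex s" by (auto simp: garside_cells_eq)
  then show "act g ` e \<in> garside_cells G \<D>"
    using act_open_simplex[OF g] translate_simplex[OF g] by (simp add: garside_cells_eq)
qed

lemma garside_complex_nonempty: "topspace X \<noteq> {}"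
proof -
  have "{\<one>} \<in> K" using adj_refl P_carrier[OF one_closed] by (simp add: simplex_iff)
  then show ?thesis
    using cayley.open_simplex_nonempty cayley.open_simplex_subset unfolding topspace_garside by blast
qed

end

theorem theorem3p1:
  fixes G :: "('g, 'b) monoid_scheme" and P :: "'g set" and \<Delta> :: 'g
  defines "\<D> \<equiv> simple_divisors G P \<Delta>"
  defines "X \<equiv> garside_complex G \<D>"
    and "C \<equiv> garside_cells G \<D>"
    and "\<phi> \<equiv> garside_action G \<D>"
  assumes "garside_group G P \<Delta>"
  shows "contractible_space X \<and> G_complex G X C \<phi> \<and>
    finite_CW_complex (orbit_space G X \<phi>) (orbit_cells G C \<phi>) \<and>
    Eilenberg_MacLane_space G 1 (orbit_space G X \<phi>)"
proof -
  interpret garside_group G P \<Delta> by fact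
  show ?thesis
    unfolding X_def C_def \<phi>_def \<D>_def
    using contractible_garside_complex G_complex_garside finite_CW_quotient
      action.Eilenberg_MacLane_orbit_space[OF contractible_garside_complex garside_complex_nonempty]
    by blast
qed

end
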